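(* Consider a fixed independent-factor shape with comparable role sizes $m_x\asymp n$, whose coordinates are real, symmetric, of variance one, independent by coordinate and occurrence, with laws that may depend on $n$. Suppose that for a fixed $C_0>0$, fixed nonnegative reals $\beta_e,\gamma_e$ and fixed constants $C_e$ independent of $n$, $$\mathbb E|\xi_e|^{2t}\le C_e^{2t}\,n^{\beta_e(t-1)}\,t^{\gamma_e(t-1)}\quad\text{for every integer }1\le t\le C_0\log n$$ and all sufficiently large $n$. Let $H_c$ be the core matrix, $r$ its number of roles, $s$ its minimum separator size, and for core separators $S$ put $$\kappa(S)=|S|-\sum_{e\subseteq S}\beta_e,\qquad b(S)=a(S)+\sum_{e\subseteq S}\gamma_e.$$ Then there is a constant $C$ (independent of $n,p$) such that for all sufficiently large $n$ and every integer $2\le p\le C_0\log n$, $$\mathbb E\operatorname{tr}((H_cH_c^* )^p)\le C^{2p}\sum_{(S_k)}n^{pr-\sum_k\kappa(S_k)}\,p^{\sum_kb(S_k)+K'_r\sum_k(|S_k|-s)},\qquad K'_r=3r^2+11r+2,$$ where the sum ranges over sequences $(S_1,\dots,S_{p-1})$ of core separators. If moreover every separator minimizing $\kappa$ has cardinality $s$, then, with $\kappa_*=\min_S\kappa(S)$ and $b_*^{\rm mw}=\max_{\kappa(S)=\kappa_*}b(S)$, $$\mathbb E\|H_c\|\le C\,n^{(r-\kappa_* )/2}(\log n)^{b_*^{\rm mw}/2}$$ (for a possibly different constant $C$ and all sufficiently large $n$), and for every fixed $A>0$ there is $C_A$ with $\mathbb P\{\|H_c\|>C_An^{(r-\kappa_*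 )/2}(\log n)^{b_*^{\rm mw}/2}\}\le n^{-A}$ for all sufficiently large $n$.
   Context: Independent-factor shape: a finite set $W$ of roles; ordered boundary tuples $U,V$ of roles (each with distinct entries, possibly overlapping or empty); a finite list $\mathcal F$ of nonempty scopes $e\subseteq W$ (repetitions allowed). Each role $x$ has a finite label set $I_x$ with $c_xn\le m_x=|I_x|\le C_xn$ for fixed positive constants. Each occurrence $e$ has its own array $(\xi^{(e)}_y)_{y\in\prod_{x\in e}I_x}$ of i.i.d. coordinates distributed as $\xi_e$, independent across occurrences even for equal scopes. The matrix of a shape is $\sum_{x\in\prod_{w}I_w}\prod_{e}\xi^{(e)}_{x_e}\,e_{x_U}e_{x_V}^*$, with $x_e,x_U,x_V$ restrictions of $x$ and $e_{x_U},e_{x_V}$ standard basis vectors of the spaces indexed by labels of $U$ and $V$ (one-dimensional if the tuple is empty). $\|\cdot\|$ is the operator norm. Core: the two-section graph joins two distinct roles lying in a common scope. Remove all roles outside $U\cup V$ lying in no scope, then every connected component of the two-section disjoint from $U\cup V$ (including singletons with only unary factors). The remaining shape is the core (boundary roles are kept even if unused) and $H_c$ is its matrix. Core separators: sets $S$ of core roles meeting every $U$–$V$ path of the core's two-section (including length-zero paths, so $U\cap V\subseteq S$). $a(S)$ is the number of connected components of the core's two-section minus $S$ that are disjoint from $U\cup V$ and adjacent to $S$. Sums over $e\subseteq S$ run over the core's factor occurrences, with repetition. *)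

theory Defs
  imports "HOL-Probability.Probability"
begin

section \<open>Shapes\<close>

text \<open>The finite list of factors is an indexed family: \<open>occs\<close> is the finite set of factor
  occurrences and \<open>scope f\<close> the set of roles on which the occurrence \<open>f\<close> depends. Distinct
  occurrences may have equal scopes, and occurrences keep their names when passing to the core.\<close>

record ('w, 'f) shape =
  roles :: "'w set"
  lbdry :: "'w list"
  rbdry :: "'w list"
  occs :: "'f set"
  scope :: "'f \<Rightarrow> 'w set"

definition is_shape :: "('w, 'f) shape \<Rightarrow> bool" where
  "is_shape G \<longleftrightarrow>
     finite (roles G) \<and>
     distinct (lbdry G) \<and> set (lbdry G) \<subseteq> roles G \<and>
     distinct (rbdry G) \<and> set (rbdry G) \<subseteq> roles G \<and>
     finite (occs G) \<and> (\<forall>f\<in>occs G. scope G f \<noteq> {} \<and> scope G f \<subseteq> roles G)"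

definition bdry :: "('w, 'f) shape \<Rightarrow> 'w set" where
  "bdry G = set (lbdry G) \<union> set (rbdry G)"

definition two_section :: "('w, 'f) shape \<Rightarrow> 'w \<Rightarrow> 'w \<Rightarrow> bool" where
  "two_section G x y \<longleftrightarrow> x \<noteq> y \<and> (\<exists>f\<in>occs G. x \<in> scope G f \<and> y \<in> scope G f)"

text \<open>Vertex sets of the connected components of the subgraph of the two-section induced on \<open>X\<close>.\<close>

definition components_on :: "('w, 'f) shape \<Rightarrow> 'w set \<Rightarrow> 'w set set" where
  "components_on G X =
     X // {(x, y). x \<in> X \<and> y \<in> X \<and> (\<lambda>u v. u \<in> X \<and> v \<in> X \<and> two_section G u v)\<^sup>*\<^sup>* x y}"

definition used_roles :: "('w, 'f) shape \<Rightarrow> 'w set" where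
  "used_roles G = {x \<in> roles G. x \<in> bdry G \<or> (\<exists>f\<in>occs G. x \<in> scope G f)}"

definition core_roles :: "('w, 'f) shape \<Rightarrow> 'w set" where
  "core_roles G =
     used_roles G - \<Union>{K \<in> components_on G (used_roles G). K \<inter> bdry G = {}}"

definition core :: "('w, 'f) shape \<Rightarrow> ('w, 'f) shape" where
  "core G = G\<lparr>roles := core_roles G, occs := {f \<in> occs G. scope G f \<subseteq> core_roles G}\<rparr>"

text \<open>The functions below are meant to be applied to a core shape.\<close>

definition is_boundary_path :: "('w, 'f) shape \<Rightarrow> 'w list \<Rightarrow> bool" where
  "is_boundary_path G xs \<longleftrightarrow>
     xs \<noteq> [] \<and> distinct xs \<and> set xs \<subseteq> roles G \<and> successively (two_section G) xs \<and>
     hd xs \<in> set (lbdry G) \<and> last xs \<in> set (rbdry G)"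

definition separators :: "('w, 'f) shape \<Rightarrow> 'w set set" where
  "separators G = {S. S \<subseteq> roles G \<and> (\<forall>xs. is_boundary_path G xs \<longrightarrow> set xs \<inter> S \<noteq> {})}"

definition min_separator_size :: "('w, 'f) shape \<Rightarrow> nat" where
  "min_separator_size G = Min (card ` separators G)"

definition floating_count :: "('w, 'f) shape \<Rightarrow> 'w set \<Rightarrow> nat" where
  "floating_count G S =
     card {K \<in> components_on G (roles G - S).
             K \<inter> bdry G = {} \<and> (\<exists>x\<in>K. \<exists>y\<in>S. two_section G x y)}"

definition sep_kappa :: "('w, 'f) shape \<Rightarrow> ('f \<Rightarrow> real) \<Rightarrow> 'w set \<Rightarrow> real" where
  "sep_kappa G \<beta> S = real (card S) - (\<Sum>f | f \<in> occs G \<and> scope G f \<subseteq> S. \<beta> f)"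

definition sep_b :: "('w, 'f) shape \<Rightarrow> ('f \<Rightarrow> real) \<Rightarrow> 'w set \<Rightarrow> real" where
  "sep_b G \<gamma> S = real (floating_count G S) + (\<Sum>f | f \<in> occs G \<and> scope G f \<subseteq> S. \<gamma> f)"

section \<open>Matrices with finite index sets\<close>

text \<open>A real matrix is a function of a row index and a column index; the finite sets over which
  the indices range are passed explicitly, since here they vary with \<open>n\<close>.\<close>

definition mat_mult :: "'k set \<Rightarrow> ('i \<Rightarrow> 'k \<Rightarrow> real) \<Rightarrow> ('k \<Rightarrow> 'j \<Rightarrow> real) \<Rightarrow> 'i \<Rightarrow> 'j \<Rightarrow> real" where
  "mat_mult K A B = (\<lambda>i j. \<Sum>k\<in>K. A i k * B k j)"

definition mat_adjoint :: "('i \<Rightarrow> 'j \<Rightarrow> real) \<Rightarrow> 'j \<Rightarrow> 'i \<Rightarrow> real" where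
  "mat_adjoint A = (\<lambda>j i. A i j)"

primrec mat_power :: "'i set \<Rightarrow> ('i \<Rightarrow> 'i \<Rightarrow> real) \<Rightarrow> nat \<Rightarrow> 'i \<Rightarrow> 'i \<Rightarrow> real" where
  "mat_power R A 0 = (\<lambda>i j. of_bool (i = j))"
| "mat_power R A (Suc p) = mat_mult R A (mat_power R A p)"

definition mat_trace :: "'i set \<Rightarrow> ('i \<Rightarrow> 'i \<Rightarrow> real) \<Rightarrow> real" where
  "mat_trace R A = (\<Sum>i\<in>R. A i i)"

definition op_norm :: "'i set \<Rightarrow> 'j set \<Rightarrow> ('i \<Rightarrow> 'j \<Rightarrow> real) \<Rightarrow> real" where
  "op_norm R C A = (SUP v\<in>{v. L2_set v C \<le> 1}. L2_set (\<lambda>i. \<Sum>j\<in>C. A i j * v j) R)"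

section \<open>The matrix of a shape\<close>

definition label_tuples :: "('w \<Rightarrow> 'l set) \<Rightarrow> 'w list \<Rightarrow> 'l list set" where
  "label_tuples I U = {ys. list_all2 (\<lambda>y u. y \<in> I u) ys U}"

text \<open>\<open>X f y\<close> is the coordinate at \<open>y\<close> of the array of the occurrence \<open>f\<close>.\<close>

definition shape_matrix ::
  "('w, 'f) shape \<Rightarrow> ('w \<Rightarrow> 'l set) \<Rightarrow> ('f \<Rightarrow> ('w \<Rightarrow> 'l) \<Rightarrow> real) \<Rightarrow> 'l list \<Rightarrow> 'l list \<Rightarrow> real" where
  "shape_matrix G I X = (\<lambda>i j.
     \<Sum>x\<in>PiE (roles G) I. (\<Prod>f\<in>occs G. X f (restrict x (scope G f))) *
        of_bool (map x (lbdry G) = i) * of_bool (map x (rbdry G) = j))"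

definition shape_trace_power ::
  "('w, 'f) shape \<Rightarrow> ('w \<Rightarrow> 'l set) \<Rightarrow> ('l list \<Rightarrow> 'l list \<Rightarrow> real) \<Rightarrow> nat \<Rightarrow> real" where
  "shape_trace_power G I H p =
     (let R = label_tuples I (lbdry G); C = label_tuples I (rbdry G)
      in mat_trace R (mat_power R (mat_mult C H (mat_adjoint H)) p))"

definition shape_op_norm ::
  "('w, 'f) shape \<Rightarrow> ('w \<Rightarrow> 'l set) \<Rightarrow> ('l list \<Rightarrow> 'l list \<Rightarrow> real) \<Rightarrow> real" where
  "shape_op_norm G I H = op_norm (label_tuples I (lbdry G)) (label_tuples I (rbdry G)) H"

section \<open>Independent-factor arrays\<close>

text \<open>\<open>\<xi> f y\<close> is the random coordinate at \<open>y\<close> of the array of \<open>f\<close>, and \<open>L f\<close> is the common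
  law of that array. Indexing independence by pairs \<open>(f, y)\<close> makes the arrays of distinct
  occurrences independent even when their scopes coincide.\<close>

definition independent_factor_arrays ::
  "('w, 'f) shape \<Rightarrow> ('w \<Rightarrow> 'l set) \<Rightarrow> 'a measure \<Rightarrow> ('f \<Rightarrow> real measure) \<Rightarrow>
   ('f \<Rightarrow> ('w \<Rightarrow> 'l) \<Rightarrow> 'a \<Rightarrow> real) \<Rightarrow> bool" where
  "independent_factor_arrays G I M L \<xi> \<longleftrightarrow>
     prob_space M \<and>
     prob_space.indep_vars M (\<lambda>_. borel) (\<lambda>(f, y). \<xi> f y)
       (SIGMA f:occs G. PiE (scope G f) I) \<and>
     (\<forall>f\<in>occs G. \<forall>y\<in>PiE (scope G f) I. distr M borel (\<xi> f y) = L f)"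

definition symmetric_unit_variance :: "real measure \<Rightarrow> bool" where
  "symmetric_unit_variance \<mu> \<longleftrightarrow>
     prob_space \<mu> \<and> sets \<mu> = sets borel \<and> distr \<mu> borel uminus = \<mu> \<and>
     integrable \<mu> (\<lambda>z. z\<^sup>2) \<and> prob_space.variance \<mu> (\<lambda>z. z) = 1"

end

theory Submission
  imports Defs "HOL-Real_Asymp.Real_Asymp"
begin

text \<open>Expand the trace over closed walks of \<open>2p\<close> copies of the core. By symmetry only walks count in
  which every array coordinate occurs an even number of times. In each copy a role shows its label
  for the first time, for the last time, or neither; two roles of a common scope cannot be first and
  last, so in every inner copy the roles that are neither form a separator \<open>M\<^sub>j\<close>. Counting labels and
  coordinates through the \<open>2p - 2\<close> sets \<open>M\<^sub>j\<close> gives the power of \<open>n\<close> as half the sum of the \<open>- \<kappa> M\<^sub>j\<close>.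

  It remains to count walks whose first and last occurrences are prescribed, besides the free choice
  of new labels. Reading from left to right, parity forces the label of every role that shares a
  scope with a role showing a known label for the last time. If \<open>M\<^sub>j\<close> has minimum size, this
  determines the whole copy except for one choice among at most \<open>2p\<close> per floating component of
  last roles; otherwise at most \<open>r\<close> further choices are needed, which the factor
  \<open>p powr (K' * (card M\<^sub>j - s))\<close> absorbs. Reading from right to left exchanges first and last roles, and
  the geometric mean of the two counts charges \<open>1/2\<close> per floating component. Finally only the
  largest weight of a separator matters, as the number of types is exponential in \<open>p\<close>.

  The norm bounds follow from \<open>\<parallel>H\<parallel> ^ (2p) \<le> tr ((H H\<^sup>*) ^ p)\<close> for even \<open>p\<close> near \<open>C0 * ln n\<close> and Markov's
  inequality.\<close>

section \<open>Operator norm and traces\<close>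

text \<open>In copy \<open>0\<close> every role is first and in the last copy every role is last, so
  \<open>2 * p - 2 = 2 * (p - 1)\<close> inner copies carry a separator. Counts of walks are
  therefore bounded in squared form: the square root leaves \<open>p - 1\<close> separator weights,
  one for each term of the sequences in the claim. The power of \<open>n\<close> combines two facts
  about an inner copy: a middle role brings no new label, and an array value that is used neither
  for the first nor for the last time forces its whole scope into the middle. This merges
  cardinality and \<open>\<beta>\<close> into \<open>\<kappa>\<close>. The obstacle is the power of
  the logarithm. Recording one label costs a factor of order \<open>p\<close>, so middle roles may
  be recorded only where the separator exceeds minimum size. In minimum size each middle role is
  instead reached from the incoming boundary through last roles, whose labels spread by parity.
  Whatever is exponential in \<open>p\<close>, such as the number of types or the factor
  \<open>p ^ (2 * r)\<close> of the two fully recorded end copies, disappears in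
  \<open>C ^ (2 * p)\<close>.\<close>

definition mat_vec :: "'i set \<Rightarrow> ('i \<Rightarrow> 'i \<Rightarrow> real) \<Rightarrow> ('i \<Rightarrow> real) \<Rightarrow> 'i \<Rightarrow> real" where
  "mat_vec R B u = (\<lambda>i. \<Sum>j\<in>R. B i j * u j)"

definition dot :: "'i set \<Rightarrow> ('i \<Rightarrow> real) \<Rightarrow> ('i \<Rightarrow> real) \<Rightarrow> real" where
  "dot R u v = (\<Sum>i\<in>R. u i * v i)"

lemma dot_self_nonneg: "0 \<le> dot R u u"
  by (simp add: dot_def sum_nonneg)

lemma dot_self_eq_L2_set: "dot R u u = (L2_set u R)\<^sup>2"
  by (simp add: dot_def L2_set_def sum_nonneg power2_eq_square)

lemma dot_Cauchy_Schwarz: "(dot R u v)\<^sup>2 \<le> dot R u u * dot R v v"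
  using Cauchy_Schwarz_ineq_sum[of u v R] by (simp add: dot_def power2_eq_square)

lemma mat_mult_assoc:
  "mat_mult R A (mat_mult S B C) = mat_mult S (mat_mult R A B) C"
proof (intro ext)
  fix i j
  have "(\<Sum>k\<in>R. A i k * (\<Sum>l\<in>S. B k l * C l j)) = (\<Sum>k\<in>R. \<Sum>l\<in>S. A i k * B k l * C l j)"
    by (simp add: sum_distrib_left mult.assoc)
  also have "\<dots> = (\<Sum>l\<in>S. \<Sum>k\<in>R. A i k * B k l * C l j)"
    by (rule sum.swap)
  finally show "mat_mult R A (mat_mult S B C) i j = mat_mult S (mat_mult R A B) C i j"
    by (simp add: mat_mult_def sum_distrib_right)
qed

lemma mat_power_add:
  assumes "finite R" "i \<in> R"
  shows "mat_power R B (a + b) i j = mat_mult R (mat_power R B a) (mat_power R B b) i j"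
  using assms(2)
proof (induction a arbitrary: i)
  case 0
  then show ?case using assms(1) by (simp add: mat_mult_def)
next
  case (Suc a)
  have "mat_power R B (Suc a + b) i j = (\<Sum>k\<in>R. B i k * mat_power R B (a + b) k j)"
    by (simp add: mat_mult_def)
  also have "\<dots> = mat_mult R B (mat_mult R (mat_power R B a) (mat_power R B b)) i j"
    using Suc.IH by (simp add: mat_mult_def)
  finally show ?case by (simp add: mat_mult_assoc)
qed

lemma mat_power_sym:
  assumes "finite R" "\<And>i j. B i j = B j i" "i \<in> R" "j \<in> R"
  shows "mat_power R B k i j = mat_power R B k j i"
  using assms(3,4)
proof (induction k arbitrary: i j)
  case 0
  then show ?case by auto
next
  case (Suc k)
  have one: "mat_power R B (Suc 0) a b = B a b" if "b \<in> R" for a b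
    using assms(1) that by (simp add: mat_mult_def)
  have "mat_power R B (Suc k) i j = (\<Sum>l\<in>R. B i l * mat_power R B k l j)"
    by (simp add: mat_mult_def)
  also have "\<dots> = (\<Sum>l\<in>R. mat_power R B k j l * B l i)"
    using Suc assms(2) by (intro sum.cong) (auto simp: mult.commute)
  also have "\<dots> = (\<Sum>l\<in>R. mat_power R B k j l * mat_power R B (Suc 0) l i)"
    using one Suc.prems by (intro sum.cong) auto
  also have "\<dots> = mat_power R B (k + Suc 0) j i"
    using mat_power_add[OF assms(1) Suc.prems(2), of B k "Suc 0" i] by (simp only: mat_mult_def)
  finally show ?case by simp
qed

lemma mat_vec_iterate:
  assumes "finite R" "i \<in> R"
  shows "(mat_vec R B ^^ k) u i = (\<Sum>j\<in>R. mat_power R B k i j * u j)"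
  using assms(2)
proof (induction k arbitrary: i)
  case 0
  then show ?case using assms(1) by simp
next
  case (Suc k)
  have "(mat_vec R B ^^ Suc k) u i = (\<Sum>l\<in>R. B i l * (mat_vec R B ^^ k) u l)"
    by (simp add: mat_vec_def[of R B "(mat_vec R B ^^ k) u"])
  also have "\<dots> = (\<Sum>l\<in>R. B i l * (\<Sum>j\<in>R. mat_power R B k l j * u j))"
    using Suc.IH by (intro sum.cong) auto
  also have "\<dots> = (\<Sum>l\<in>R. \<Sum>j\<in>R. B i l * mat_power R B k l j * u j)"
    by (simp add: sum_distrib_left mult.assoc)
  also have "\<dots> = (\<Sum>j\<in>R. \<Sum>l\<in>R. B i l * mat_power R B k l j * u j)"
    by (rule sum.swap)
  finally show ?case by (simp add: mat_mult_def sum_distrib_right)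
qed

lemma dot_mat_vec_sym:
  assumes "\<And>i j. B i j = B j i"
  shows "dot R (mat_vec R B u) v = dot R u (mat_vec R B v)"
proof -
  have "dot R (mat_vec R B u) v = (\<Sum>i\<in>R. \<Sum>j\<in>R. B i j * u j * v i)"
    by (simp add: dot_def mat_vec_def sum_distrib_right)
  also have "\<dots> = (\<Sum>j\<in>R. \<Sum>i\<in>R. B i j * u j * v i)"
    by (rule sum.swap)
  also have "\<dots> = dot R u (mat_vec R B v)"
    unfolding dot_def mat_vec_def sum_distrib_left
    by (intro sum.cong refl) (use assms in \<open>simp add: mult.commute mult.left_commute\<close>)
  finally show ?thesis .
qed

text \<open>Cauchy-Schwarz in each row bounds the iterate by the Hilbert-Schmidt norm of the power
  of \<open>B\<close>; by symmetry the square of that norm is the trace of the doubled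
  power.\<close>

lemma dot_iterate_le:
  assumes "finite R" and sym: "\<And>i j. B i j = B j i"
  shows "dot R ((mat_vec R B ^^ q) u) ((mat_vec R B ^^ q) u)
           \<le> mat_trace R (mat_power R B (2 * q)) * dot R u u"
proof -
  have "dot R ((mat_vec R B ^^ q) u) ((mat_vec R B ^^ q) u)
      = (\<Sum>i\<in>R. (dot R (mat_power R B q i) u)\<^sup>2)"
    unfolding dot_def[of R "(mat_vec R B ^^ q) u"] using assms(1)
    by (intro sum.cong) (auto simp: mat_vec_iterate dot_def power2_eq_square)
  also have "\<dots> \<le> (\<Sum>i\<in>R. dot R (mat_power R B q i) (mat_power R B q i) * dot R u u)"
    by (intro sum_mono dot_Cauchy_Schwarz)
  also have "\<dots> = (\<Sum>i\<in>R. mat_power R B (q + q) i i) * dot R u u"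
  proof -
    have "dot R (mat_power R B q i) (mat_power R B q i) = mat_power R B (q + q) i i"
      if "i \<in> R" for i
      unfolding mat_power_add[OF assms(1) that] dot_def mat_mult_def
      using mat_power_sym[OF assms(1) sym] that by (intro sum.cong) auto
    then show ?thesis by (simp add: sum_distrib_right)
  qed
  finally show ?thesis by (simp add: mat_trace_def mult_2)
qed

text \<open>The norms of the iterates of a symmetric matrix are log-convex, so they grow at least
  geometrically once the first ratio is bounded below.\<close>

lemma dot_iterate_ge:
  assumes sym: "\<And>i j. B i j = B j i"
    and c: "c = dot R u u" "0 < c" "c\<^sup>2 \<le> dot R u (mat_vec R B u)"
  shows "c * c ^ (2 * k) \<le> dot R ((mat_vec R B ^^ k) u) ((mat_vec R B ^^ k) u)"
proof -
  define d where "d k = dot R ((mat_vec R B ^^ k) u) ((mat_vec R B ^^ k) u)" for k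
  have d0: "d 0 = c" by (simp add: d_def c)
  have step: "0 < d k \<and> c\<^sup>2 * d k \<le> d (Suc k)" for k
  proof (induction k)
    case 0
    have "(c\<^sup>2)\<^sup>2 \<le> (dot R u (mat_vec R B u))\<^sup>2"
      using c(3) by (intro power_mono) auto
    also have "\<dots> \<le> c * d 1"
      using dot_Cauchy_Schwarz[of R u "mat_vec R B u"] by (simp add: c(1) d_def)
    finally have "c * (c\<^sup>2 * c) \<le> c * d 1"
      by (simp add: power2_eq_square mult.assoc)
    then show ?case using c(2) d0 by simp
  next
    case (Suc k)
    have pos: "0 < d (Suc k)"
      using Suc c(2) by (meson less_le_trans mult_pos_pos zero_less_power)
    have "d (Suc k) = dot R ((mat_vec R B ^^ k) u) ((mat_vec R B ^^ Suc (Suc k)) u)"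
      unfolding d_def using dot_mat_vec_sym[of B R "(mat_vec R B ^^ k) u", OF sym] by simp
    then have "(d (Suc k))\<^sup>2 \<le> d k * d (Suc (Suc k))"
      using dot_Cauchy_Schwarz unfolding d_def by metis
    moreover have "d (Suc k) * (c\<^sup>2 * d k) \<le> d (Suc k) * d (Suc k)"
      using Suc pos by (intro mult_left_mono) auto
    ultimately have "d k * (c\<^sup>2 * d (Suc k)) \<le> d k * d (Suc (Suc k))"
      by (simp add: power2_eq_square algebra_simps)
    then show ?case using Suc pos by simp
  qed
  have "c * c ^ (2 * k) \<le> d k"
  proof (induction k)
    case (Suc k)
    have "c * c ^ (2 * Suc k) = c\<^sup>2 * (c * c ^ (2 * k))"
      by (simp add: power2_eq_square)
    also have "\<dots> \<le> c\<^sup>2 * d k" using Suc by (intro mult_left_mono) auto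
    finally show ?case using step[of k] by simp
  qed (simp add: d0)
  then show ?thesis by (simp add: d_def)
qed

lemma mat_trace_even_power_nonneg:
  assumes "finite R" "\<And>i j. B i j = B j i"
  shows "0 \<le> mat_trace R (mat_power R B (2 * q))"
proof -
  have "0 \<le> mat_power R B (q + q) i i" if "i \<in> R" for i
    unfolding mat_power_add[OF assms(1) that] mat_mult_def
    using mat_power_sym[OF assms] that by (intro sum_nonneg) auto
  then show ?thesis by (simp add: mat_trace_def mult_2 sum_nonneg)
qed

text \<open>Let \<open>u\<close> be the image of \<open>v\<close> and \<open>c = dot R u u\<close>.
  Moving \<open>A\<close> to the other side and applying Cauchy-Schwarz with the unit vector
  \<open>v\<close> gives \<open>c\<^sup>2 \<le> dot R u (mat_vec R B u)\<close>. This is the initial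
  ratio from which the iterates of \<open>u\<close> grow; the trace bounds them from above, and one
  factor \<open>c\<close> cancels. The exponent is \<open>4 * q\<close> because \<open>c\<close> is
  already a squared norm.\<close>

lemma norm_mat_vec_power_le_trace:
  assumes fin: "finite R" "finite C" and q: "0 < q" and v: "L2_set v C \<le> 1"
  shows "L2_set (\<lambda>i. \<Sum>j\<in>C. A i j * v j) R ^ (4 * q)
           \<le> mat_trace R (mat_power R (mat_mult C A (mat_adjoint A)) (2 * q))"
proof -
  define B where "B = mat_mult C A (mat_adjoint A)"
  have sym: "B i j = B j i" for i j
    by (simp add: B_def mat_mult_def mat_adjoint_def mult.commute)
  define u where "u = (\<lambda>i. \<Sum>j\<in>C. A i j * v j)"
  define w where "w = (\<lambda>j. \<Sum>i\<in>R. A i j * u i)"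
  define c where "c = dot R u u"
  have c0: "0 \<le> c" by (simp add: c_def dot_self_nonneg)
  have L: "L2_set u R ^ (4 * q) = c ^ (2 * q)"
  proof -
    have "L2_set u R ^ (4 * q) = ((L2_set u R)\<^sup>2) ^ (2 * q)"
      by (simp only: power_mult[symmetric]) simp
    then show ?thesis by (simp add: c_def dot_self_eq_L2_set)
  qed
  have nonneg: "0 \<le> mat_trace R (mat_power R B (2 * q))"
    by (rule mat_trace_even_power_nonneg[OF fin(1) sym])
  have "c ^ (2 * q) \<le> mat_trace R (mat_power R B (2 * q))"
  proof (cases "c = 0")
    case True
    then show ?thesis using nonneg q by (simp add: zero_power)
  next
    case False
    then have pos: "0 < c" using c0 by simp
    have "c = dot C v w"
    proof -
      have "c = (\<Sum>i\<in>R. \<Sum>j\<in>C. A i j * v j * u i)"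
        by (simp add: c_def dot_def u_def sum_distrib_right)
      also have "\<dots> = (\<Sum>j\<in>C. \<Sum>i\<in>R. A i j * v j * u i)" by (rule sum.swap)
      finally show ?thesis
        by (simp add: dot_def w_def sum_distrib_left algebra_simps)
    qed
    moreover have "dot C w w = dot R u (mat_vec R B u)"
    proof -
      have "dot C w w = (\<Sum>j\<in>C. \<Sum>i\<in>R. \<Sum>k\<in>R. A i j * A k j * u i * u k)"
        by (simp add: dot_def w_def sum_product algebra_simps)
      also have "\<dots> = (\<Sum>i\<in>R. \<Sum>j\<in>C. \<Sum>k\<in>R. A i j * A k j * u i * u k)" by (rule sum.swap)
      also have "\<dots> = (\<Sum>i\<in>R. \<Sum>k\<in>R. \<Sum>j\<in>C. A i j * A k j * u i * u k)"
        by (intro sum.cong refl sum.swap)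
      also have "\<dots> = dot R u (mat_vec R B u)"
        unfolding dot_def mat_vec_def B_def mat_mult_def mat_adjoint_def
          sum_distrib_left sum_distrib_right
        by (intro sum.cong refl) (simp add: algebra_simps)
      finally show ?thesis .
    qed
    ultimately have "c\<^sup>2 \<le> dot C v v * dot R u (mat_vec R B u)"
      using dot_Cauchy_Schwarz[of C v w] by simp
    moreover have "dot C v v \<le> 1"
      using v by (simp add: dot_self_eq_L2_set power_le_one)
    moreover have "0 \<le> dot R u (mat_vec R B u)"
      using \<open>dot C w w = _\<close> dot_self_nonneg[of C w] by simp
    ultimately have "c\<^sup>2 \<le> dot R u (mat_vec R B u)"
      by (meson mult_left_le_one_le dot_self_nonneg order_trans)
    from dot_iterate_ge[of B c R u q, OF sym c_def pos this] dot_iterate_le[of R B q u, OF fin(1) sym]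
    have "c * c ^ (2 * q) \<le> c * mat_trace R (mat_power R B (2 * q))"
      by (simp add: c_def mult.commute)
    then show ?thesis using pos by simp
  qed
  then show ?thesis using L by (simp add: u_def B_def)
qed

lemma L2_set_zero_vec [simp]: "L2_set (\<lambda>_. 0) C = 0"
  by (simp add: L2_set_def)

lemma bdd_above_op_norm:
  assumes "finite R" "finite C"
  shows "bdd_above ((\<lambda>v. L2_set (\<lambda>i. \<Sum>j\<in>C. A i j * v j) R) ` {v. L2_set v C \<le> 1})"
proof (rule bdd_aboveI2)
  fix v assume "v \<in> {v. L2_set v C \<le> 1}"
  then have "L2_set (\<lambda>i. \<Sum>j\<in>C. A i j * v j) R ^ (4 * 1)
      \<le> mat_trace R (mat_power R (mat_mult C A (mat_adjoint A)) (2 * 1))" (is "_ \<le> ?t")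
    by (intro norm_mat_vec_power_le_trace assms) auto
  then have "root 4 (L2_set (\<lambda>i. \<Sum>j\<in>C. A i j * v j) R ^ 4) \<le> root 4 ?t"
    by (simp add: real_root_le_iff)
  then show "L2_set (\<lambda>i. \<Sum>j\<in>C. A i j * v j) R \<le> root 4 ?t"
    by (simp add: real_root_power_cancel)
qed

lemma op_norm_nonneg:
  assumes "finite R" "finite C"
  shows "0 \<le> op_norm R C A"
  unfolding op_norm_def
  by (rule cSUP_upper2[OF bdd_above_op_norm[OF assms], of "\<lambda>_. 0"]) auto

lemma op_norm_power_le_trace:
  assumes fin: "finite R" "finite C" and q: "0 < q"
  shows "op_norm R C A ^ (4 * q)
           \<le> mat_trace R (mat_power R (mat_mult C A (mat_adjoint A)) (2 * q))"
    (is "_ \<le> ?t")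
proof -
  have t0: "0 \<le> ?t"
    using norm_mat_vec_power_le_trace[OF fin q, of "\<lambda>_. 0" A] q by (simp add: zero_power)
  have "op_norm R C A \<le> root (4 * q) ?t"
    unfolding op_norm_def
  proof (rule cSUP_least)
    show "{v. L2_set v C \<le> 1} \<noteq> {}" by (auto intro: exI[of _ "\<lambda>_. 0"])
    fix v assume "v \<in> {v. L2_set v C \<le> 1}"
    then have "L2_set (\<lambda>i. \<Sum>j\<in>C. A i j * v j) R ^ (4 * q) \<le> ?t"
      by (intro norm_mat_vec_power_le_trace fin q) auto
    then have "root (4 * q) (L2_set (\<lambda>i. \<Sum>j\<in>C. A i j * v j) R ^ (4 * q)) \<le> root (4 * q) ?t"
      using q by (simp add: real_root_le_iff)
    then show "L2_set (\<lambda>i. \<Sum>j\<in>C. A i j * v j) R \<le> root (4 * q) ?t"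
      using q by (simp add: real_root_power_cancel)
  qed
  then have "op_norm R C A ^ (4 * q) \<le> root (4 * q) ?t ^ (4 * q)"
    by (intro power_mono op_norm_nonneg fin)
  also have "\<dots> = ?t" using q t0 by (simp add: real_root_pow_pos2)
  finally show ?thesis .
qed

section \<open>Measurability of the operator norm\<close>

definition trunc_approx :: "nat \<Rightarrow> real \<Rightarrow> real" where
  "trunc_approx N z = sgn z * real_of_int \<lfloor>real N * \<bar>z\<bar>\<rfloor> / real N"

lemma abs_trunc_approx_le: "\<bar>trunc_approx N z\<bar> \<le> \<bar>z\<bar>"
proof (cases "N = 0 \<or> z = 0")
  case False
  then have "\<bar>trunc_approx N z\<bar> = real_of_int \<lfloor>real N * \<bar>z\<bar>\<rfloor> / real N"
    by (simp add: trunc_approx_def abs_mult abs_sgn_eq)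
  also have "\<dots> \<le> real N * \<bar>z\<bar> / real N" by (intro divide_right_mono) auto
  finally show ?thesis using False by simp
qed (auto simp: trunc_approx_def)

lemma trunc_approx_in_Rats: "trunc_approx N z \<in> \<rat>"
  by (auto simp: trunc_approx_def sgn_if)

lemma trunc_approx_tendsto: "(\<lambda>N. trunc_approx N z) \<longlonglongrightarrow> z"
proof -
  have "(\<lambda>N. real_of_int \<lfloor>real N * \<bar>z\<bar>\<rfloor> / real N) \<longlonglongrightarrow> \<bar>z\<bar>"
  proof (rule tendsto_sandwich)
    show "\<forall>\<^sub>F N in sequentially. \<bar>z\<bar> - 1 / real N \<le> real_of_int \<lfloor>real N * \<bar>z\<bar>\<rfloor> / real N"
      using eventually_gt_at_top[of 0]
    proof eventually_elim
      case (elim N)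
      have "(real N * \<bar>z\<bar> - 1) / real N \<le> real_of_int \<lfloor>real N * \<bar>z\<bar>\<rfloor> / real N"
        by (intro divide_right_mono) linarith+
      then show ?case using elim by (simp add: field_simps)
    qed
    show "\<forall>\<^sub>F N in sequentially. real_of_int \<lfloor>real N * \<bar>z\<bar>\<rfloor> / real N \<le> \<bar>z\<bar>"
      using eventually_gt_at_top[of 0]
    proof eventually_elim
      case (elim N)
      have "real_of_int \<lfloor>real N * \<bar>z\<bar>\<rfloor> / real N \<le> (real N * \<bar>z\<bar>) / real N"
        by (intro divide_right_mono) linarith+
      then show ?case using elim by simp
    qed
    show "(\<lambda>N. \<bar>z\<bar> - 1 / real N) \<longlonglongrightarrow> \<bar>z\<bar>"
      by (rule tendsto_eq_intros lim_1_over_n refl)+ simp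
  qed simp
  then have "(\<lambda>N. sgn z * (real_of_int \<lfloor>real N * \<bar>z\<bar>\<rfloor> / real N)) \<longlonglongrightarrow> sgn z * \<bar>z\<bar>"
    by (intro tendsto_intros)
  then show ?thesis by (simp add: trunc_approx_def sgn_mult_abs)
qed

text \<open>Truncating towards zero does not leave the unit ball, so rational test vectors suffice.\<close>

lemma op_norm_eq_SUP_rational:
  assumes fin: "finite R" "finite C"
  shows "op_norm R C A =
    (SUP v\<in>{v \<in> PiE C (\<lambda>_. \<rat>). L2_set v C \<le> 1}. L2_set (\<lambda>i. \<Sum>j\<in>C. A i j * v j) R)"
    (is "_ = Sup (?g ` ?D)")
proof (rule antisym)
  have z: "restrict (\<lambda>_. 0) C \<in> ?D"
    by (auto simp: L2_set_def)
  have bdd: "bdd_above (?g ` ?D)"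
    by (rule bdd_above_mono[OF bdd_above_op_norm[OF fin]]) auto
  show "Sup (?g ` ?D) \<le> op_norm R C A"
    unfolding op_norm_def
    by (intro cSUP_subset_mono bdd_above_op_norm fin) (use z in blast, auto)
  show "op_norm R C A \<le> Sup (?g ` ?D)"
    unfolding op_norm_def
  proof (rule cSUP_least)
    show "{v. L2_set v C \<le> 1} \<noteq> {}" by (auto intro: exI[of _ "\<lambda>_. 0"])
    fix v :: "'b \<Rightarrow> real" assume v: "v \<in> {v. L2_set v C \<le> 1}"
    define vN where "vN N = restrict (\<lambda>j. trunc_approx N (v j)) C" for N
    have mem: "vN N \<in> ?D" for N
    proof -
      have "L2_set (vN N) C \<le> L2_set v C"
        unfolding L2_set_def
        by (intro real_sqrt_le_mono sum_mono)
           (simp add: vN_def abs_trunc_approx_le abs_le_square_iff[symmetric])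
      then show ?thesis using v by (auto simp: vN_def trunc_approx_in_Rats)
    qed
    have "(\<lambda>N. ?g (vN N)) \<longlonglongrightarrow> ?g v"
      unfolding L2_set_def
      by (intro tendsto_intros tendsto_real_sqrt) (simp add: vN_def trunc_approx_tendsto)
    then show "?g v \<le> Sup (?g ` ?D)"
      by (rule LIMSEQ_le_const2) (use cSUP_upper[OF mem bdd] in auto)
  qed
qed

text \<open>A supremum over the unit ball is uncountable, one over rational vectors is not.
  \<open>PiE\<close> pins the vectors outside \<open>C\<close>, which makes the test vectors
  countable whatever the index type is.\<close>

lemma borel_measurable_op_norm:
  assumes fin: "finite R" "finite C"
    and meas: "\<And>i j. i \<in> R \<Longrightarrow> j \<in> C \<Longrightarrow> (\<lambda>\<omega>. A \<omega> i j) \<in> borel_measurable M"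
  shows "(\<lambda>\<omega>. op_norm R C (A \<omega>)) \<in> borel_measurable M"
  unfolding op_norm_eq_SUP_rational[OF fin]
proof (rule borel_measurable_cSUP)
  have "countable (PiE C (\<lambda>_. \<rat> :: real set))"
    by (intro countable_PiE fin countable_rat)
  then show "countable {v \<in> PiE C (\<lambda>_. \<rat> :: real set). L2_set v C \<le> 1}"
    by (rule countable_subset[rotated]) auto
  show "(\<lambda>\<omega>. L2_set (\<lambda>i. \<Sum>j\<in>C. A \<omega> i j * v j) R) \<in> borel_measurable M" for v :: "'b \<Rightarrow> real"
    unfolding L2_set_def using meas by measurable
  show "bdd_above ((\<lambda>v. L2_set (\<lambda>i. \<Sum>j\<in>C. A \<omega> i j * v j) R) `
      {v \<in> PiE C (\<lambda>_. \<rat>). L2_set v C \<le> 1})" for \<omega>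
    by (rule bdd_above_mono[OF bdd_above_op_norm[OF fin]]) auto
qed

section \<open>Cores and separators\<close>

text \<open>Reflexive also at points outside \<open>X\<close>, so membership in \<open>X\<close> is
  carried separately.\<close>

definition reach_in :: "('w, 'f) shape \<Rightarrow> 'w set \<Rightarrow> 'w \<Rightarrow> 'w \<Rightarrow> bool" where
  "reach_in G X = (\<lambda>u v. u \<in> X \<and> v \<in> X \<and> two_section G u v)\<^sup>*\<^sup>*"

lemma two_section_sym: "two_section G u v \<Longrightarrow> two_section G v u"
  by (auto simp: two_section_def)

lemma reach_in_sym: "reach_in G X u v \<Longrightarrow> reach_in G X v u"
proof -
  have "symp (\<lambda>u v. u \<in> X \<and> v \<in> X \<and> two_section G u v)"
    by (rule sympI) (simp add: two_section_sym)
  then show "reach_in G X u v \<Longrightarrow> reach_in G X v u"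
    unfolding reach_in_def using symp_rtranclp sympD by metis
qed

lemma reach_in_trans: "reach_in G X u v \<Longrightarrow> reach_in G X v w \<Longrightarrow> reach_in G X u w"
  unfolding reach_in_def by (rule rtranclp_trans)

lemma reach_in_refl [simp]: "reach_in G X u u"
  by (simp add: reach_in_def)

lemma reach_in_step: "u \<in> X \<Longrightarrow> v \<in> X \<Longrightarrow> two_section G u v \<Longrightarrow> reach_in G X u v"
  unfolding reach_in_def by (simp add: r_into_rtranclp)

lemma reach_in_closed:
  assumes "reach_in G X u v" "u \<in> D"
    and "\<And>a b. a \<in> D \<Longrightarrow> a \<in> X \<Longrightarrow> b \<in> X \<Longrightarrow> two_section G a b \<Longrightarrow> b \<in> D"
  shows "v \<in> D"
  using assms(1) unfolding reach_in_def
  by (induction rule: rtranclp_induct) (use assms(2,3) in blast)+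

lemma components_on_eq: "components_on G X = (\<lambda>x. {y \<in> X. reach_in G X x y}) ` X"
  unfolding components_on_def quotient_def reach_in_def by auto

lemma components_on_closed:
  assumes "K \<in> components_on G X" "u \<in> K" "v \<in> X" "two_section G u v"
  shows "v \<in> K"
proof -
  obtain x where K: "K = {y \<in> X. reach_in G X x y}" using assms(1) by (auto simp: components_on_eq)
  then have "reach_in G X u v" using assms(2-4) by (auto intro!: reach_in_step)
  then show ?thesis using K assms(2,3) reach_in_trans[of G X x u v] by auto
qed

lemma components_on_reach:
  assumes "K \<in> components_on G X" "u \<in> K" "v \<in> K"
  shows "reach_in G X u v"
proof -
  obtain x where "K = {y \<in> X. reach_in G X x y}" using assms(1) by (auto simp: components_on_eq)
  then show ?thesis using assms(2,3) reach_in_sym[of G X x u] reach_in_trans[of G X u x v] by auto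
qed

lemma components_on_subset: "K \<in> components_on G X \<Longrightarrow> K \<subseteq> X \<and> K \<noteq> {}"
  unfolding components_on_eq by auto

text \<open>What the later arguments use of a core. The second clause prevents a role from being
  first and last in one copy; the third makes a component off the boundary adjacent to the separator
  that cuts it off.\<close>

definition cored :: "('w, 'f) shape \<Rightarrow> bool" where
  "cored G \<longleftrightarrow> is_shape G \<and>
     (\<forall>w\<in>roles G. w \<in> bdry G \<or> (\<exists>f\<in>occs G. w \<in> scope G f)) \<and>
     (\<forall>w\<in>roles G. \<exists>y\<in>bdry G. reach_in G (roles G) w y)"

lemma core_simps [simp]:
  "roles (core G) = core_roles G" "lbdry (core G) = lbdry G" "rbdry (core G) = rbdry G"
  "scope (core G) = scope G" "occs (core G) = {f \<in> occs G. scope G f \<subseteq> core_roles G}"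
  "bdry (core G) = bdry G"
  by (auto simp: core_def bdry_def)

text \<open>Reachability of the boundary replaces the quotient by components.\<close>

lemma core_roles_iff:
  "x \<in> core_roles G \<longleftrightarrow> x \<in> used_roles G \<and> (\<exists>y\<in>bdry G. y \<in> used_roles G \<and> reach_in G (used_roles G) x y)"
proof -
  have "(\<exists>K\<in>components_on G (used_roles G). x \<in> K \<and> K \<inter> bdry G = {}) \<longleftrightarrow>
      \<not> (\<exists>y\<in>bdry G. y \<in> used_roles G \<and> reach_in G (used_roles G) x y)" if "x \<in> used_roles G"
  proof
    assume "\<exists>K\<in>components_on G (used_roles G). x \<in> K \<and> K \<inter> bdry G = {}"
    then obtain K where K: "K \<in> components_on G (used_roles G)" "x \<in> K" "K \<inter> bdry G = {}" by blast
    have "y \<in> K" if "reach_in G (used_roles G) x y" for y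
      using that K(2) by (rule reach_in_closed) (rule components_on_closed[OF K(1)])
    with K(3) show "\<not> (\<exists>y\<in>bdry G. y \<in> used_roles G \<and> reach_in G (used_roles G) x y)" by blast
  next
    assume "\<not> (\<exists>y\<in>bdry G. y \<in> used_roles G \<and> reach_in G (used_roles G) x y)"
    then have "{y \<in> used_roles G. reach_in G (used_roles G) x y} \<inter> bdry G = {}" by auto
    with that show "\<exists>K\<in>components_on G (used_roles G). x \<in> K \<and> K \<inter> bdry G = {}"
      unfolding components_on_eq by (auto intro!: bexI[of _ x])
  qed
  then show ?thesis unfolding core_roles_def by blast
qed

lemma cored_core:
  assumes "is_shape G"
  shows "cored (core G)"
proof -
  have sub: "core_roles G \<subseteq> roles G" by (auto simp: core_roles_def used_roles_def)
  have bd: "bdry G \<subseteq> core_roles G"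
  proof
    fix x assume x: "x \<in> bdry G"
    then have "x \<in> used_roles G" using assms by (auto simp: used_roles_def is_shape_def bdry_def)
    then show "x \<in> core_roles G" using x by (auto simp: core_roles_iff)
  qed
  \<comment> \<open>A scope is a clique of the two-section, so a factor that meets the core lies in
    it, and restricting the occurrences loses no edge at a core role.\<close>
  have scope: "scope G f \<subseteq> core_roles G"
    if f: "f \<in> occs G" and x: "x \<in> scope G f" "x \<in> core_roles G" for f x
  proof
    fix y assume y: "y \<in> scope G f"
    have used: "y \<in> used_roles G" "x \<in> used_roles G"
      using assms f y x(1) by (auto simp: used_roles_def is_shape_def)
    have "reach_in G (used_roles G) y x"
      using f y x(1) used by (cases "x = y") (auto simp: two_section_def intro!: reach_in_step)
    then show "y \<in> core_roles G"
      using x(2) used(1) reach_in_trans[of G "used_roles G" y x] unfolding core_roles_iff by blast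
  qed
  have "is_shape (core G)"
    using assms sub bd by (auto simp: is_shape_def bdry_def intro: finite_subset)
  moreover have "w \<in> bdry G \<or> (\<exists>f\<in>occs (core G). w \<in> scope G f)" if "w \<in> core_roles G" for w
  proof -
    have "w \<in> bdry G \<or> (\<exists>f\<in>occs G. w \<in> scope G f)"
      using that by (simp add: core_roles_iff used_roles_def)
    then show ?thesis using scope[OF _ _ that] by simp blast
  qed
  moreover have "\<exists>y\<in>bdry G. reach_in (core G) (core_roles G) w y" if w: "w \<in> core_roles G" for w
  proof -
    from w obtain y where y: "y \<in> bdry G" and r: "reach_in G (used_roles G) w y"
      by (auto simp: core_roles_iff)
    have "y \<in> {v. reach_in (core G) (core_roles G) w v \<and> v \<in> core_roles G}"
    proof (rule reach_in_closed[OF r])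
      fix a b
      assume a: "a \<in> {v. reach_in (core G) (core_roles G) w v \<and> v \<in> core_roles G}"
        and "two_section G a b"
      then obtain f where f: "f \<in> occs G" "a \<in> scope G f" "b \<in> scope G f" "a \<noteq> b"
        by (auto simp: two_section_def)
      with scope[OF f(1,2)] a
      have "two_section (core G) a b" "b \<in> core_roles G" by (auto simp: two_section_def)
      with a reach_in_step[of a "core_roles G" b "core G"] reach_in_trans[of "core G" "core_roles G" w a b]
      show "b \<in> {v. reach_in (core G) (core_roles G) w v \<and> v \<in> core_roles G}" by blast
    qed (use w in auto)
    then show ?thesis using y by blast
  qed
  ultimately show ?thesis by (simp add: cored_def)
qed

lemma finite_separators:
  assumes "is_shape G" shows "finite (separators G)"
  by (rule finite_subset[of _ "Pow (roles G)"]) (use assms in \<open>auto simp: separators_def is_shape_def\<close>)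

text \<open>Ensures that minima and maxima over separators range over a nonempty set.\<close>

lemma roles_in_separators: "roles G \<in> separators G"
  by (auto simp: separators_def is_boundary_path_def neq_Nil_conv)

lemma min_separator_size_le:
  "is_shape G \<Longrightarrow> S \<in> separators G \<Longrightarrow> min_separator_size G \<le> card S"
  by (simp add: min_separator_size_def finite_separators)

lemma successively_two_section_rev:
  "successively (two_section G) xs \<Longrightarrow> successively (two_section G) (rev xs)"
  unfolding successively_rev by (erule successively_mono) (rule two_section_sym)

lemma successively_closed:
  assumes "successively (two_section G) zs" "zs \<noteq> []" "hd zs \<in> D"
    and "\<And>a b. a \<in> D \<Longrightarrow> b \<in> set zs \<Longrightarrow> two_section G a b \<Longrightarrow> b \<in> D"
  shows "last zs \<in> D"
  using assms(1-3) assms(4)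
proof (induction zs rule: induct_list012)
  case (3 x y zs)
  have "y \<in> D" using "3.prems"(4)[of x y] "3.prems"(1,3) by simp
  then show ?case
    using "3.IH"(2) "3.prems"(1) "3.prems"(4) by simp
qed simp_all

text \<open>A separator of minimum size is inclusion-minimal, so each of its roles is the only
  intersection with some boundary path; this replaces Menger's theorem.\<close>

lemma minimum_separator_access:
  assumes G: "is_shape G" and S: "S \<in> separators G" "card S = min_separator_size G" "v \<in> S"
    and inn: "inn = set (lbdry G) \<or> inn = set (rbdry G)"
  obtains zs where "zs \<noteq> []" "hd zs \<in> inn" "last zs = v"
    "set (butlast zs) \<subseteq> roles G - S" "successively (two_section G) zs"
proof -
  have finS: "finite S" using S(1) G finite_subset by (auto simp: separators_def is_shape_def)
  have "S - {v} \<notin> separators G"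
  proof
    assume "S - {v} \<in> separators G"
    from min_separator_size_le[OF G this] card.remove[OF finS S(3)] S(2) show False by simp
  qed
  then obtain xs where xs: "is_boundary_path G xs" "set xs \<inter> (S - {v}) = {}"
    using S(1) by (auto simp: separators_def)
  then have "v \<in> set xs" using S(1) by (auto simp: separators_def)
  \<comment> \<open>Boundary paths run from left to right and are read backwards when the access is
    to start at the right boundary.\<close>
  define ys where "ys = (if inn = set (lbdry G) then xs else rev xs)"
  have ys: "ys \<noteq> []" "hd ys \<in> inn" "v \<in> set ys" "distinct ys" "set ys \<subseteq> roles G"
    "successively (two_section G) ys" "set ys \<inter> (S - {v}) = {}"
    using xs inn \<open>v \<in> set xs\<close> successively_two_section_rev[of G xs]
    by (auto simp: ys_def is_boundary_path_def hd_rev simp del: successively_rev)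
  from \<open>v \<in> set ys\<close> obtain ps qs where split: "ys = ps @ v # qs"
    by (meson split_list)
  show thesis
  proof (rule that[of "ps @ [v]"])
    show "hd (ps @ [v]) \<in> inn" using ys(2) split by (cases ps) auto
    show "set (butlast (ps @ [v])) \<subseteq> roles G - S"
      using ys(4,5,7) split by auto
    show "successively (two_section G) (ps @ [v])"
      using ys(6) split by (auto simp: successively_append_iff)
  qed auto
qed

section \<open>Floating components and the roles whose labels are recorded\<close>

definition float_comps :: "('w, 'f) shape \<Rightarrow> 'w set \<Rightarrow> 'w set \<Rightarrow> 'w set set" where
  "float_comps G S T = {K \<in> components_on G (roles G - S). K \<inter> bdry G = {} \<and> K \<subseteq> T}"

text \<open>One role per component is enough, since in a component of last roles a single label
  determines all others.\<close>

definition float_reps :: "('w, 'f) shape \<Rightarrow> 'w set \<Rightarrow> 'w set \<Rightarrow> 'w set" where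
  "float_reps G S T = (\<lambda>K. SOME x. x \<in> K) ` float_comps G S T"

lemma finite_float_comps:
  assumes "is_shape G" shows "finite (float_comps G S T)"
  using assms by (auto simp: float_comps_def components_on_eq is_shape_def)

lemma float_reps_subset: "float_reps G S T \<subseteq> T \<inter> roles G"
proof
  fix x assume "x \<in> float_reps G S T"
  then obtain K where K: "K \<in> float_comps G S T" "x = (SOME x. x \<in> K)"
    by (auto simp: float_reps_def)
  then have "K \<noteq> {}" "K \<subseteq> T \<inter> roles G"
    using components_on_subset[of K G] by (auto simp: float_comps_def)
  then show "x \<in> T \<inter> roles G" using K(2) some_in_eq[of K] by auto
qed

text \<open>Components are nonempty, so none is counted for both \<open>F\<close> and
  \<open>L\<close>. The adjacency to \<open>S\<close> that \<open>floating_count\<close> requires is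
  automatic: a component not touching \<open>S\<close> would contain every path to the boundary that
  starts in it.\<close>

lemma card_float_reps_le:
  assumes "cored G" "F \<inter> L = {}"
  shows "card (float_reps G S F) + card (float_reps G S L) \<le> floating_count G S"
proof -
  have shape: "is_shape G" using assms by (simp add: cored_def)
  have "float_comps G S F \<inter> float_comps G S L = {}"
    using assms(2) components_on_subset unfolding float_comps_def by blast
  then have "card (float_comps G S F) + card (float_comps G S L)
      = card (float_comps G S F \<union> float_comps G S L)"
    by (intro card_Un_disjoint[symmetric] finite_float_comps shape)
  also have "\<dots> \<le> floating_count G S"
    unfolding floating_count_def
  proof (rule card_mono)
    show "finite {K \<in> components_on G (roles G - S). K \<inter> bdry G = {} \<and> (\<exists>x\<in>K. \<exists>y\<in>S. two_section G x y)}"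
      using shape by (auto simp: components_on_eq is_shape_def)
    have "\<exists>x\<in>K. \<exists>y\<in>S. two_section G x y"
      if K: "K \<in> components_on G (roles G - S)" "K \<inter> bdry G = {}" for K
    proof (rule ccontr)
      assume no: "\<not> (\<exists>x\<in>K. \<exists>y\<in>S. two_section G x y)"
      obtain x where x: "x \<in> K" "x \<in> roles G" using components_on_subset[OF K(1)] by blast
      with assms(1) obtain y where y: "y \<in> bdry G" "reach_in G (roles G) x y"
        by (auto simp: cored_def)
      have "y \<in> K"
        by (rule reach_in_closed[OF y(2) x(1)]) (use no components_on_closed[OF K(1)] in blast)
      with y K show False by blast
    qed
    then show "float_comps G S F \<union> float_comps G S L \<subseteq>
        {K \<in> components_on G (roles G - S). K \<inter> bdry G = {} \<and> (\<exists>x\<in>K. \<exists>y\<in>S. two_section G x y)}"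
      by (auto simp: float_comps_def)
  qed
  finally show ?thesis
    unfolding float_reps_def
    using card_image_le[OF finite_float_comps[OF shape], of "\<lambda>K. SOME x. x \<in> K" S F]
      card_image_le[OF finite_float_comps[OF shape], of "\<lambda>K. SOME x. x \<in> K" S L] by linarith
qed

text \<open>The roles whose labels an encoding has to record when the roles that are neither first nor last
  form \<open>S\<close>; \<open>T\<close> is the set of last roles.\<close>

definition paid_roles :: "('w, 'f) shape \<Rightarrow> 'w set \<Rightarrow> 'w set \<Rightarrow> 'w set" where
  "paid_roles G S T = float_reps G S T \<union> (if card S > min_separator_size G then S else {})"

text \<open>The two reading directions share the floating components but may each record all of
  \<open>S\<close>. If \<open>S\<close> is not minimum, the excess is at least \<open>1\<close>, so
  \<open>card S \<le> card (roles G)\<close> is paid for by \<open>card (roles G)\<close> times the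
  excess; twice this is the second summand.\<close>

lemma card_paid_roles_le:
  assumes "cored G" "S \<in> separators G" "F \<inter> L = {}"
  shows "card (paid_roles G S F) + card (paid_roles G S L)
           \<le> floating_count G S + 2 * card (roles G) * (card S - min_separator_size G)"
proof -
  let ?e = "if card S > min_separator_size G then S else {}"
  have shape: "is_shape G" using assms by (simp add: cored_def)
  have "card S \<le> card (roles G)"
    using assms(2) shape by (auto simp: separators_def is_shape_def intro: card_mono)
  have e: "card ?e \<le> card (roles G) * (card S - min_separator_size G)" (is "_ \<le> ?m")
  proof (cases "card S > min_separator_size G")
    case True
    then have "card (roles G) * 1 \<le> ?m" by (intro mult_le_mono2) simp
    with \<open>card S \<le> card (roles G)\<close> have "card S \<le> ?m" by linarith
    with True show ?thesis by simp
  qed simp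
  have "card (paid_roles G S T) \<le> card (float_reps G S T) + ?m" for T
    unfolding paid_roles_def by (rule order_trans[OF card_Un_le]) (use e in simp)
  from this[of F] this[of L] card_float_reps_le[OF assms(1,3), of S] show ?thesis
    unfolding mult.assoc by linarith
qed

text \<open>One copy of the walk: \<open>F\<close>, \<open>L\<close> and the separator \<open>roles G - F - L\<close> are the roles whose label
  occurs here for the first time, for the last time, and neither; \<open>inn\<close> and \<open>out\<close> are the boundaries
  shared with the previous and the next copy; \<open>D\<close> is the set of roles whose label is determined.\<close>

lemma all_determined:
  assumes G: "cored G" and D: "F \<subseteq> D" "inn \<subseteq> D" "paid_roles G (roles G - F - L) L \<subseteq> D"
    and spreads_to: "\<And>a b. a \<in> L \<inter> D \<Longrightarrow> two_section G a b \<Longrightarrow> b \<in> D"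
    and FL: "\<And>a b. a \<in> F \<Longrightarrow> b \<in> L \<Longrightarrow> \<not> two_section G a b"
    and io: "inn \<inter> F = {}" "out \<inter> L = {}" "inn \<union> out = bdry G"
      "inn = set (lbdry G) \<or> inn = set (rbdry G)"
    and S: "roles G - F - L \<in> separators G"
    and sub: "F \<subseteq> roles G" "L \<subseteq> roles G"
  shows "roles G \<subseteq> D"
proof
  define S' where "S' = roles G - F - L"
  have shape: "is_shape G" using G by (simp add: cored_def)
  have X: "roles G - S' = F \<union> L" using sub by (auto simp: S'_def)
  have LF: "b \<notin> F" if "a \<in> L" "two_section G a b" for a b
    using FL[of b a] two_section_sym[OF that(2)] that(1) by blast
  have stayL: "b \<in> L" if "reach_in G (F \<union> L) a b" "a \<in> L" for a b
  proof (rule reach_in_closed[OF that])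
    show "b \<in> L" if "a \<in> L" "b \<in> F \<union> L" "two_section G a b" for a b
      using LF[OF that(1,3)] that(2) by blast
  qed
  have spread: "b \<in> D" if "reach_in G (F \<union> L) a b" "a \<in> L" "a \<in> D" for a b
  proof -
    have "b \<in> L \<inter> D"
    proof (rule reach_in_closed[OF that(1)])
      show "a \<in> L \<inter> D" using that by simp
      show "b \<in> L \<inter> D" if "a \<in> L \<inter> D" "b \<in> F \<union> L" "two_section G a b" for a b
        using LF[of a b] spreads_to[OF that(1,3)] that by blast
    qed
    then show ?thesis by simp
  qed
  have L: "w \<in> D" if w: "w \<in> L" for w
  proof -
    define K where "K = {y \<in> F \<union> L. reach_in G (F \<union> L) w y}"
    have K: "K \<in> components_on G (roles G - S')" "w \<in> K"
      using w unfolding X components_on_eq K_def by auto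
    \<comment> \<open>No first role is adjacent to a last one, so the component of a last role
      consists of last roles.\<close>
    have KL: "K \<subseteq> L" using stayL[of w] w by (auto simp: K_def)
    show ?thesis
    proof (cases "K \<inter> bdry G = {}")
      case True
      then have "K \<in> float_comps G S' L" using K KL by (simp add: float_comps_def)
      then have "(SOME x. x \<in> K) \<in> paid_roles G S' L"
        by (auto simp: paid_roles_def float_reps_def)
      then have q: "(SOME x. x \<in> K) \<in> D" "(SOME x. x \<in> K) \<in> K"
        using D(3) K(2) some_in_eq[of K] by (auto simp: S'_def)
      from components_on_reach[OF K(1) q(2) K(2)] spread q KL
      show ?thesis unfolding X by blast
    next
      case False
      then obtain y where y: "y \<in> K" "y \<in> bdry G" by blast
      \<comment> \<open>\<open>out\<close> contains no last role, so a boundary role in this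
        component is shared with the previous copy, where its label is known.\<close>
      then have "y \<in> inn" using KL io by blast
      with D(2) have "y \<in> D" by blast
      with components_on_reach[OF K(1) y(1) K(2)] spread y KL
      show ?thesis unfolding X by blast
    qed
  qed
  fix w assume w: "w \<in> roles G"
  consider "w \<in> F" | "w \<in> L" | "w \<in> S'" using w by (auto simp: S'_def)
  then show "w \<in> D"
  proof cases
    case 1
    then show ?thesis using D(1) by blast
  next
    case 2
    then show ?thesis by (rule L)
  next
    case 3
    show ?thesis
    proof (cases "card S' > min_separator_size G")
      case True
      then show ?thesis using D(3) 3 by (auto simp: paid_roles_def S'_def)
    next
      case False
      with min_separator_size_le[OF shape S] have "card S' = min_separator_size G"
        by (simp add: S'_def)
      \<comment> \<open>The path to \<open>w\<close> avoids the separator before its end. It starts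
        in \<open>inn\<close>, hence outside \<open>F\<close>, and so stays inside \<open>L\<close>;
        its final edge carries the label to \<open>w\<close>. A path of length zero means that
        \<open>w\<close> is itself in \<open>inn\<close>.\<close>
      from minimum_separator_access[OF shape S[folded S'_def] this 3 io(4)]
      obtain zs where zs: "zs \<noteq> []" "hd zs \<in> inn" "last zs = w"
        "set (butlast zs) \<subseteq> roles G - S'" "successively (two_section G) zs" by metis
      show ?thesis
      proof (cases "butlast zs = []")
        case True
        then have "zs = [w]" using append_butlast_last_id[OF zs(1)] zs(3) by simp
        then show ?thesis using zs(2) D(2) by auto
      next
        case False
        have eq: "zs = butlast zs @ [w]" using append_butlast_last_id[OF zs(1)] zs(3) by simp
        have "successively (two_section G) (butlast zs @ [w])"
          using zs(5) eq by metis
        then have suc: "successively (two_section G) (butlast zs)"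
          "two_section G (last (butlast zs)) w"
          using False by (auto simp: successively_append_iff)
        have "hd (butlast zs) = hd zs" using False eq by (metis hd_append2)
        moreover have "hd (butlast zs) \<in> F \<union> L" using hd_in_set[OF False] zs(4) X by blast
        ultimately have "hd (butlast zs) \<in> L" using zs(2) io(1) by auto
        then have "last (butlast zs) \<in> L"
        proof (rule successively_closed[OF suc(1) False])
          show "b \<in> L" if "a \<in> L" "b \<in> set (butlast zs)" "two_section G a b" for a b
            using LF[OF that(1,3)] that(2) zs(4) X by blast
        qed
        then show ?thesis using L spreads_to suc(2) by blast
      qed
    qed
  qed
qed

text \<open>A boundary path enters outside \<open>F\<close> (or \<open>L\<close>) and leaves outside the other of the two.\<close>

lemma middle_separates:
  assumes FL: "\<And>a b. a \<in> F \<Longrightarrow> b \<in> L \<Longrightarrow> \<not> two_section G a b"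
    and ends: "set (lbdry G) \<inter> F = {} \<and> set (rbdry G) \<inter> L = {} \<or>
      set (lbdry G) \<inter> L = {} \<and> set (rbdry G) \<inter> F = {}"
    and disj: "F \<inter> L = {}"
  shows "roles G - F - L \<in> separators G"
proof -
  have "set xs \<inter> (roles G - F - L) \<noteq> {}" if xs: "is_boundary_path G xs" for xs
  proof
    assume no: "set xs \<inter> (roles G - F - L) = {}"
    have sub: "set xs \<subseteq> F \<union> L" and ne: "xs \<noteq> []" and suc: "successively (two_section G) xs"
      and hl: "hd xs \<in> set (lbdry G)" "last xs \<in> set (rbdry G)"
      using xs no by (auto simp: is_boundary_path_def)
    have hd: "hd xs \<in> F \<union> L" using sub hd_in_set[OF ne] by blast
    have "last xs \<in> T" if "hd xs \<in> T" "T = F \<or> T = L" for T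
    proof (rule successively_closed[OF suc ne that(1)])
      fix a b assume "a \<in> T" "b \<in> set xs" "two_section G a b"
      then show "b \<in> T"
        using that(2) sub FL[of a b] FL[of b a] two_section_sym[of G a b] by auto
    qed
    then show False using hd hl ends disj by blast
  qed
  then show ?thesis by (auto simp: separators_def)
qed

section \<open>Closed walks\<close>

definition firsts :: "('w, 'f) shape \<Rightarrow> ('w \<Rightarrow> 'l) list \<Rightarrow> nat \<Rightarrow> 'w set" where
  "firsts G xs j = {w \<in> roles G. \<forall>k<j. (xs ! k) w \<noteq> (xs ! j) w}"

definition lasts :: "('w, 'f) shape \<Rightarrow> ('w \<Rightarrow> 'l) list \<Rightarrow> nat \<Rightarrow> 'w set" where
  "lasts G xs j = {w \<in> roles G. \<forall>k. j < k \<and> k < length xs \<longrightarrow> (xs ! k) w \<noteq> (xs ! j) w}"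

text \<open>Copies are numbered from \<open>0\<close>; \<open>side G j\<close> is the boundary shared by the copies \<open>j\<close> and \<open>j + 1\<close>.\<close>

definition side :: "('w, 'f) shape \<Rightarrow> nat \<Rightarrow> 'w set" where
  "side G j = (if even j then set (rbdry G) else set (lbdry G))"

text \<open>The parity condition is part of the definition, so that counting walks counts only
  contributing terms. It ranges over all \<open>q\<close>; a value that is never taken has
  multiplicity \<open>0\<close>.\<close>

definition walks :: "('w, 'f) shape \<Rightarrow> ('w \<Rightarrow> 'l set) \<Rightarrow> nat \<Rightarrow> ('w \<Rightarrow> 'l) list set" where
  "walks G I p = {xs. length xs = 2 * p \<and> set xs \<subseteq> PiE (roles G) I \<and>
     (\<forall>j. Suc j < 2 * p \<longrightarrow> (\<forall>w\<in>side G j. (xs ! j) w = (xs ! Suc j) w)) \<and>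
     (\<forall>w\<in>set (lbdry G). (xs ! (2 * p - 1)) w = (xs ! 0) w) \<and>
     (\<forall>f\<in>occs G. \<forall>q. even (card {k. k < 2 * p \<and> restrict (xs ! k) (scope G f) = q}))}"

definition typed_walks ::
  "('w, 'f) shape \<Rightarrow> ('w \<Rightarrow> 'l set) \<Rightarrow> nat \<Rightarrow> (nat \<Rightarrow> 'w set) \<Rightarrow> (nat \<Rightarrow> 'w set) \<Rightarrow> ('w \<Rightarrow> 'l) list set" where
  "typed_walks G I p F L =
     {xs \<in> walks G I p. \<forall>j<2 * p. firsts G xs j = F j \<and> lasts G xs j = L j}"

lemma walks_partner:
  assumes "xs \<in> walks G I p" "f \<in> occs G" "j < 2 * p"
  obtains k where "k < 2 * p" "k \<noteq> j" "restrict (xs ! k) (scope G f) = restrict (xs ! j) (scope G f)"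
proof -
  define A where "A = {k. k < 2 * p \<and> restrict (xs ! k) (scope G f) = restrict (xs ! j) (scope G f)}"
  have "even (card A)" using assms unfolding walks_def A_def by blast
  then have "A \<noteq> {j}" by auto
  moreover have "j \<in> A" using assms by (simp add: A_def)
  ultimately obtain k where "k \<in> A" "k \<noteq> j" by blast
  then show thesis using that by (auto simp: A_def)
qed

lemma walks_side:
  assumes "xs \<in> walks G I p" "Suc j < 2 * p" "w \<in> side G j"
  shows "(xs ! Suc j) w = (xs ! j) w"
  using assms by (auto simp: walks_def)

lemma walks_length: "xs \<in> walks G I p \<Longrightarrow> length xs = 2 * p"
  by (simp add: walks_def)

lemma walks_nth:
  assumes "xs \<in> walks G I p" "j < 2 * p"
  shows "xs ! j \<in> PiE (roles G) I"
proof -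
  have "set xs \<subseteq> PiE (roles G) I" "length xs = 2 * p" using assms(1) by (simp_all add: walks_def)
  then show ?thesis using assms(2) by (metis nth_mem subsetD)
qed

lemma side_not_firsts:
  assumes "xs \<in> walks G I p" "Suc j < 2 * p" "w \<in> side G j"
  shows "w \<notin> firsts G xs (Suc j)"
  using walks_side[OF assms] by (auto simp: firsts_def)

lemma side_not_lasts:
  assumes "xs \<in> walks G I p" "Suc j < 2 * p" "w \<in> side G j"
  shows "w \<notin> lasts G xs j"
  using walks_side[OF assms] walks_length[OF assms(1)] assms(2) by (auto simp: lasts_def)

text \<open>By parity another copy carries the same array value and thus repeats both labels. If it
  is earlier, \<open>a\<close> is not first; if it is later, \<open>b\<close> is not last.\<close>

lemma firsts_lasts_not_adjacent:
  assumes "xs \<in> walks G I p" "j < 2 * p" "a \<in> firsts G xs j" "b \<in> lasts G xs j"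
    "f \<in> occs G" "a \<in> scope G f" "b \<in> scope G f"
  shows False
proof -
  obtain k where k: "k < 2 * p" "k \<noteq> j"
    "restrict (xs ! k) (scope G f) = restrict (xs ! j) (scope G f)"
    using walks_partner[OF assms(1,5,2)] by blast
  have "(xs ! k) a = (xs ! j) a" "(xs ! k) b = (xs ! j) b"
    using fun_cong[OF k(3), of a] fun_cong[OF k(3), of b] assms(6,7) by auto
  then have "\<not> k < j" "\<not> j < k"
    using assms(3,4) k(1) walks_length[OF assms(1)] by (auto simp: firsts_def lasts_def)
  then show False using k(2) by simp
qed

text \<open>A label seen once only is impossible: a boundary role shares its label with a cyclically
  neighbouring copy, and any other role of a cored shape lies in a scope, where the previous lemma
  applies with both roles equal.\<close>

lemma firsts_lasts_disjoint:
  assumes G: "cored G" and xs: "xs \<in> walks G I p" and j: "j < 2 * p"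
  shows "firsts G xs j \<inter> lasts G xs j = {}"
proof (rule ccontr)
  assume "firsts G xs j \<inter> lasts G xs j \<noteq> {}"
  then obtain w where w: "w \<in> firsts G xs j" "w \<in> lasts G xs j" by blast
  then have "w \<in> roles G" by (simp add: firsts_def)
  have no_next: False if "w \<in> side G j" "Suc j < 2 * p"
    using side_not_lasts[OF xs that(2,1)] w by simp
  have no_prev: False if "w \<in> side G i" "j = Suc i" for i
    using side_not_firsts[OF xs _ that(1)] w j that by simp
  from \<open>w \<in> roles G\<close> G consider "w \<in> set (lbdry G)" | "w \<in> set (rbdry G)"
    | f where "f \<in> occs G" "w \<in> scope G f" by (auto simp: cored_def bdry_def)
  then show False
  proof cases
    case 1
    \<comment> \<open>For a left boundary role the neighbour of copy \<open>0\<close> is copy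
      \<open>2 * p - 1\<close>, and conversely.\<close>
    have wrap: "(xs ! (2 * p - 1)) w = (xs ! 0) w" using xs 1 by (auto simp: walks_def)
    show False
    proof (cases "even j")
      case True
      show False
      proof (cases j)
        case 0
        then show False using wrap w(2) j walks_length[OF xs] by (auto simp: lasts_def)
      next
        case (Suc i)
        then show False using no_prev[of i] True 1 by (simp add: side_def)
      qed
    next
      case False
      then have "0 < j" by (cases j) auto
      show False
      proof (cases "Suc j = 2 * p")
        case True
        then have "2 * p - 1 = j" by simp
        with wrap have "(xs ! j) w = (xs ! 0) w" by simp
        then show False using w(1) \<open>0 < j\<close> by (force simp: firsts_def)
      next
        case ne: False
        then show False using no_next False 1 j by (auto simp: side_def)
      qed
    qed
  next
    case 2
    show False
    proof (cases "even j")
      case True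
      then have "Suc j < 2 * p" using j by (auto elim!: evenE)
      then show False using no_next True 2 by (auto simp: side_def)
    next
      case False
      then obtain i where "j = Suc i" "even i" by (cases j) auto
      then show False using no_prev[of i] 2 by (simp add: side_def)
    qed
  next
    case 3
    then show False using firsts_lasts_not_adjacent[OF xs j w] by blast
  qed
qed

text \<open>An inner copy shares one boundary with the previous copy, which excludes first roles
  there, and the other one with the next copy, which excludes last roles.\<close>

lemma middle_in_separators:
  assumes G: "cored G" and xs: "xs \<in> walks G I p" and j: "1 \<le> j" "Suc j < 2 * p"
  shows "roles G - firsts G xs j - lasts G xs j \<in> separators G"
proof (rule middle_separates)
  show "\<not> two_section G a b" if "a \<in> firsts G xs j" "b \<in> lasts G xs j" for a b
    using firsts_lasts_not_adjacent[OF xs _ that] j by (auto simp: two_section_def)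
  have "side G (j - 1) \<inter> firsts G xs j = {}" "side G j \<inter> lasts G xs j = {}"
    using side_not_firsts[OF xs, of "j - 1"] side_not_lasts[OF xs, of j] j by auto
  then show "set (lbdry G) \<inter> firsts G xs j = {} \<and> set (rbdry G) \<inter> lasts G xs j = {} \<or>
      set (lbdry G) \<inter> lasts G xs j = {} \<and> set (rbdry G) \<inter> firsts G xs j = {}"
    using j by (cases "even j") (auto simp: side_def)
  show "firsts G xs j \<inter> lasts G xs j = {}"
    using firsts_lasts_disjoint[OF G xs] j by simp
qed

text \<open>At the last occurrence of a label of \<open>a\<close>, among the values of an array whose scope contains \<open>a\<close>
  that are compatible with this label, exactly the current one has been used an odd number of
  times before. So the label of \<open>a\<close> and the past determine the whole value.\<close>

lemma last_label_spreads:
  assumes xs: "xs \<in> typed_walks G I p F L" and ys: "ys \<in> typed_walks G I p F L"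
    and j: "j < 2 * p" and past: "\<And>k. k < j \<Longrightarrow> xs ! k = ys ! k"
    and a: "a \<in> L j" "(xs ! j) a = (ys ! j) a" and ab: "two_section G a b"
  shows "(xs ! j) b = (ys ! j) b"
proof (rule ccontr)
  assume neq: "(xs ! j) b \<noteq> (ys ! j) b"
  obtain f where f: "f \<in> occs G" "a \<in> scope G f" "b \<in> scope G f"
    using ab by (auto simp: two_section_def)
  define q where "q = restrict (xs ! j) (scope G f)"
  define P where "P = {k. k < j \<and> restrict (xs ! k) (scope G f) = q}"
  have val: "(zs ! k) a = (xs ! j) a" if "restrict (zs ! k) (scope G f) = q" for zs k
    using fun_cong[OF that, of a] f(2) by (simp add: q_def)
  have last: "k \<le> j" if "zs \<in> typed_walks G I p F L" "k < 2 * p" "(zs ! k) a = (zs ! j) a" for zs k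
  proof -
    have "length zs = 2 * p" "a \<in> lasts G zs j"
      using that(1) a(1) j by (auto simp: typed_walks_def walks_length)
    then show ?thesis using that(2,3) by (auto simp: lasts_def not_le[symmetric])
  qed
  have "{k. k < 2 * p \<and> restrict (xs ! k) (scope G f) = q} = insert j P"
  proof (intro set_eqI iffI)
    fix k assume "k \<in> {k. k < 2 * p \<and> restrict (xs ! k) (scope G f) = q}"
    then show "k \<in> insert j P"
      using last[OF xs, of k] val[of xs k] by (auto simp: P_def)
  qed (use j in \<open>auto simp: P_def q_def\<close>)
  moreover have "even (card {k. k < 2 * p \<and> restrict (xs ! k) (scope G f) = q})"
    using xs f(1) by (auto simp: typed_walks_def walks_def)
  ultimately have "odd (card P)" by (simp add: P_def)
  have ne: "restrict (ys ! j) (scope G f) \<noteq> q"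
    using neq f(3) unfolding q_def by (metis restrict_apply')
  \<comment> \<open>The second walk takes another value at \<open>j\<close>, and the label of
    \<open>a\<close> does not return later, so it uses \<open>q\<close> at the common past copies
    only. Their number is odd by the first walk, which contradicts parity.\<close>
  have "{k. k < 2 * p \<and> restrict (ys ! k) (scope G f) = q} = P"
  proof (intro set_eqI iffI)
    fix k assume "k \<in> {k. k < 2 * p \<and> restrict (ys ! k) (scope G f) = q}"
    then have k: "k < 2 * p" "restrict (ys ! k) (scope G f) = q" by auto
    then have "k < j"
      using last[OF ys k(1)] val[OF k(2)] a(2) ne k(2) by (cases "k = j") auto
    then show "k \<in> P" using k past by (simp add: P_def)
  qed (use j past in \<open>auto simp: P_def\<close>)
  moreover have "even (card {k. k < 2 * p \<and> restrict (ys ! k) (scope G f) = q})"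
    using ys f(1) by (auto simp: typed_walks_def walks_def)
  ultimately show False using \<open>odd (card P)\<close> by simp
qed

text \<open>The last copy has no outgoing side and is recorded in full, at the price of one factor
  \<open>(2 * p) ^ card (roles G)\<close>. In copy \<open>0\<close> every label is new and already
  listed among the first occurrences.\<close>

definition paid_at :: "('w, 'f) shape \<Rightarrow> nat \<Rightarrow> (nat \<Rightarrow> 'w set) \<Rightarrow> (nat \<Rightarrow> 'w set) \<Rightarrow> nat \<Rightarrow> 'w set" where
  "paid_at G p F L j = (if Suc j = 2 * p then roles G else if j = 0 then {}
     else paid_roles G (roles G - F j - L j) (L j))"

lemma walk_copy_determined:
  assumes G: "cored G"
    and xs: "xs \<in> typed_walks G I p F L" and ys: "ys \<in> typed_walks G I p F L"
    and j: "j < 2 * p" and past: "\<And>k. k < j \<Longrightarrow> xs ! k = ys ! k"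
    and F: "\<And>w. w \<in> F j \<Longrightarrow> (xs ! j) w = (ys ! j) w"
    and Q: "\<And>w. w \<in> paid_at G p F L j \<Longrightarrow> (xs ! j) w = (ys ! j) w"
  shows "xs ! j = ys ! j"
proof -
  define D where "D = {w. (xs ! j) w = (ys ! j) w}"
  have xw: "xs \<in> walks G I p" and yw: "ys \<in> walks G I p"
    using xs ys by (simp_all add: typed_walks_def)
  have FL: "firsts G xs j = F j" "lasts G xs j = L j" using xs j by (simp_all add: typed_walks_def)
  have "roles G \<subseteq> D"
  proof -
    consider "Suc j = 2 * p" | "j = 0" | "1 \<le> j" "Suc j < 2 * p" using j by linarith
    then show ?thesis
    proof cases
      case 1
      then show ?thesis using Q by (auto simp: paid_at_def D_def)
    next
      case 2
      then show ?thesis using F FL(1) by (auto simp: firsts_def D_def)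
    next
      case 3
      show ?thesis
      proof (rule all_determined[OF G, where F = "F j" and L = "L j"
            and inn = "side G (j - 1)" and out = "side G j"])
        show "F j \<subseteq> D" using F by (auto simp: D_def)
        show "side G (j - 1) \<subseteq> D"
        proof
          fix w assume "w \<in> side G (j - 1)"
          then have "(xs ! j) w = (xs ! (j - 1)) w" "(ys ! j) w = (ys ! (j - 1)) w"
            using walks_side[OF xw, of "j - 1"] walks_side[OF yw, of "j - 1"] 3 by auto
          then show "w \<in> D" using past[of "j - 1"] 3 by (simp add: D_def)
        qed
        show "paid_roles G (roles G - F j - L j) (L j) \<subseteq> D"
          using Q 3 by (auto simp: paid_at_def D_def)
        show "b \<in> D" if "a \<in> L j \<inter> D" "two_section G a b" for a b
          using last_label_spreads[OF xs ys j past _ _ that(2)] that(1) by (auto simp: D_def)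
        show "\<not> two_section G a b" if "a \<in> F j" "b \<in> L j" for a b
          using firsts_lasts_not_adjacent[OF xw j] that FL by (auto simp: two_section_def)
        show "side G (j - 1) \<inter> F j = {}" "side G j \<inter> L j = {}"
          using side_not_firsts[OF xw, of "j - 1"] side_not_lasts[OF xw, of j] 3 FL by auto
        show "side G (j - 1) \<union> side G j = bdry G"
          using 3 by (cases "even j") (auto simp: side_def bdry_def)
        show "side G (j - 1) = set (lbdry G) \<or> side G (j - 1) = set (rbdry G)"
          by (simp add: side_def)
        show "roles G - F j - L j \<in> separators G"
          using middle_in_separators[OF G xw 3] FL by simp
        show "F j \<subseteq> roles G" "L j \<subseteq> roles G"
          using FL by (auto simp: firsts_def lasts_def)
      qed
    qed
  qed
  moreover have "xs ! j \<in> PiE (roles G) I" "ys ! j \<in> PiE (roles G) I"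
    using walks_nth[OF xw j] walks_nth[OF yw j] by simp_all
  ultimately show ?thesis by (intro PiE_ext) (auto simp: D_def)
qed

text \<open>A walk is recovered from its types, the labels at the first occurrences, and, for each paid
  role, the first time at which its label occurred.\<close>

lemma card_typed_walks_le:
  assumes G: "cored G" and fin: "\<And>w. w \<in> roles G \<Longrightarrow> finite (I w)"
    and D: "\<And>w. w \<in> roles G \<Longrightarrow> real (card (I w)) \<le> D"
    and xs0: "xs0 \<in> typed_walks G I p F L"
  shows "real (card (typed_walks G I p F L))
           \<le> D ^ (\<Sum>j<2 * p. card (F j)) * real (2 * p) ^ (\<Sum>j<2 * p. card (paid_at G p F L j))"
proof -
  have shape: "is_shape G" using G by (simp add: cored_def)
  then have finr: "finite (roles G)" by (simp add: is_shape_def)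
  define SF where "SF = (SIGMA j:{..<2 * p}. F j)"
  define SQ where "SQ = (SIGMA j:{..<2 * p}. paid_at G p F L j)"
  have Fsub: "F j \<subseteq> roles G" "L j \<subseteq> roles G" if "j < 2 * p" for j
    using xs0 that by (auto simp: typed_walks_def firsts_def lasts_def)
  have Qsub: "paid_at G p F L j \<subseteq> roles G" if "j < 2 * p" for j
    using Fsub[OF that] float_reps_subset[of G "roles G - F j - L j" "L j"]
    by (auto simp: paid_at_def paid_roles_def split: if_splits)
  have finF: "finite (F j)" "finite (paid_at G p F L j)" if "j < 2 * p" for j
    using that Fsub Qsub finr finite_subset by metis+
  have SF_roles: "snd x \<in> roles G" if "x \<in> SF" for x
    using that Fsub(1)[of "fst x"] by (auto simp: SF_def)
  have finS: "finite SF" "finite SQ"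
    using finF by (auto simp: SF_def SQ_def)
  \<comment> \<open>The search succeeds at \<open>j\<close> at the latest, so pointers stay below
    \<open>2 * p\<close> and decoding from left to right consults no later copy.\<close>
  define ptr where "ptr xs = (\<lambda>(j, w). LEAST k. (xs ! k) w = (xs ! j) w)" for xs :: "('a \<Rightarrow> 'c) list"
  define enc where "enc xs = (restrict (\<lambda>(j, w). (xs ! j) w) SF, restrict (ptr xs) SQ)" for xs :: "('a \<Rightarrow> 'c) list"
  have ptr_le: "ptr xs (j, w) \<le> j" "(xs ! ptr xs (j, w)) w = (xs ! j) w" for xs j w
    unfolding ptr_def by (auto intro: Least_le LeastI)
  have ptr_least: "(xs ! k) w \<noteq> (xs ! j) w" if "k < ptr xs (j, w)" for xs k j w
    using not_less_Least[of k "\<lambda>k. (xs ! k) w = (xs ! j) w"] that by (simp add: ptr_def)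
  have "inj_on enc (typed_walks G I p F L)"
  proof (rule inj_onI)
    fix xs ys
    assume xs: "xs \<in> typed_walks G I p F L" and ys: "ys \<in> typed_walks G I p F L"
      and enc: "enc xs = enc ys"
    have eqF: "(xs ! j) w = (ys ! j) w" if "j < 2 * p" "w \<in> F j" for j w
      using enc that unfolding enc_def by (auto simp: SF_def dest!: fun_cong[where x = "(j, w)"])
    have eqQ: "ptr xs (j, w) = ptr ys (j, w)" if "j < 2 * p" "w \<in> paid_at G p F L j" for j w
      using enc that unfolding enc_def by (auto simp: SQ_def dest!: fun_cong[where x = "(j, w)"])
    have "j < 2 * p \<longrightarrow> xs ! j = ys ! j" for j
    proof (induction j rule: less_induct)
      case (less j)
      show ?case
      proof
        assume j: "j < 2 * p"
        have past: "xs ! k = ys ! k" if "k < j" for k using less that j by simp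
        show "xs ! j = ys ! j"
        proof (rule walk_copy_determined[OF G xs ys j past])
          show "(xs ! j) w = (ys ! j) w" if "w \<in> F j" for w using eqF[OF j that] .
          show "(xs ! j) w = (ys ! j) w" if w: "w \<in> paid_at G p F L j" for w
          proof (cases "ptr xs (j, w) < j")
            case True
            then show ?thesis
              using ptr_le(2)[of xs j w] ptr_le(2)[of ys j w] eqQ[OF j w] past by metis
          next
            case False
            \<comment> \<open>A pointer to the current copy says that the label is new; then
              \<open>w\<close> is a first role and its label stands in the other component of the
              code.\<close>
            then have "ptr xs (j, w) = j" using ptr_le(1)[of xs j w] by simp
            then have "w \<in> firsts G xs j"
              using Qsub[OF j] w ptr_least[of _ xs j w] by (auto simp: firsts_def)
            then show ?thesis using eqF[OF j] xs j by (simp add: typed_walks_def)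
          qed
        qed
      qed
    qed
    moreover have "length xs = 2 * p" "length ys = 2 * p"
      using xs ys by (auto simp: typed_walks_def walks_length)
    ultimately show "xs = ys" by (simp add: nth_equalityI)
  qed
  moreover have "enc ` typed_walks G I p F L \<subseteq> PiE SF (\<lambda>(j, w). I w) \<times> PiE SQ (\<lambda>_. {..<2 * p})"
  proof
    fix e assume "e \<in> enc ` typed_walks G I p F L"
    then obtain xs where xs: "xs \<in> walks G I p" "e = enc xs" by (auto simp: typed_walks_def)
    have "(xs ! j) w \<in> I w" if "(j, w) \<in> SF" for j w
      using walks_nth[OF xs(1), of j] Fsub(1)[of j] that by (auto simp: SF_def)
    moreover have "ptr xs (j, w) < 2 * p" if "(j, w) \<in> SQ" for j w
      using ptr_le(1)[of xs j w] that by (auto simp: SQ_def)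
    ultimately show "e \<in> PiE SF (\<lambda>(j, w). I w) \<times> PiE SQ (\<lambda>_. {..<2 * p})"
      unfolding xs(2) enc_def by (auto simp: restrict_PiE_iff)
  qed
  moreover have "finite (PiE SF (\<lambda>(j, w). I w) \<times> PiE SQ (\<lambda>_. {..<2 * p}))"
  proof (intro finite_cartesian_product finite_PiE finS)
    show "finite (case x of (j, w) \<Rightarrow> I w)" if "x \<in> SF" for x
      using SF_roles[OF that] fin by (simp add: case_prod_beta)
  qed auto
  ultimately have "card (typed_walks G I p F L) \<le> card (PiE SF (\<lambda>(j, w). I w) \<times> PiE SQ (\<lambda>_. {..<2 * p}))"
    by (rule card_inj_on_le)
  also have "\<dots> = (\<Prod>x\<in>SF. card (I (snd x))) * (2 * p) ^ card SQ"
    using finS by (simp add: card_cartesian_product card_PiE case_prod_beta)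
  finally have "real (card (typed_walks G I p F L)) \<le> (\<Prod>x\<in>SF. real (card (I (snd x)))) * real (2 * p) ^ card SQ"
    by (metis of_nat_le_iff of_nat_mult of_nat_power of_nat_prod)
  also have "\<dots> \<le> (\<Prod>x\<in>SF. D) * real (2 * p) ^ card SQ"
    by (intro mult_right_mono prod_mono) (use D SF_roles in auto)
  also have "\<dots> = D ^ (\<Sum>j<2 * p. card (F j)) * real (2 * p) ^ (\<Sum>j<2 * p. card (paid_at G p F L j))"
    using finF by (simp add: SF_def SQ_def card_SigmaI)
  finally show ?thesis .
qed

section \<open>Reversal of walks\<close>

lemma lasts_rev:
  assumes "length xs = N" "j < N"
  shows "lasts G (rev xs) j = firsts G xs (N - 1 - j)"
proof -
  have "(\<forall>k. j < k \<and> k < N \<longrightarrow> (rev xs ! k) w \<noteq> (rev xs ! j) w) \<longleftrightarrow>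
      (\<forall>k<N - 1 - j. (xs ! k) w \<noteq> (xs ! (N - 1 - j)) w)" (is "?l \<longleftrightarrow> ?r") for w
  proof
    assume l: ?l
    show ?r
    proof (intro allI impI)
      fix k assume k: "k < N - 1 - j"
      then have "(rev xs ! (N - 1 - k)) w \<noteq> (rev xs ! j) w" using l assms by simp
      then show "(xs ! k) w \<noteq> (xs ! (N - 1 - j)) w" using k assms by (simp add: rev_nth)
    qed
  next
    assume r: ?r
    show ?l using r assms by (auto simp: rev_nth)
  qed
  then show ?thesis using assms by (auto simp: lasts_def firsts_def)
qed

lemma firsts_rev:
  assumes "length xs = N" "j < N"
  shows "firsts G (rev xs) j = lasts G xs (N - 1 - j)"
  using lasts_rev[of "rev xs" N "N - 1 - j" G] assms by simp

lemma rev_in_walks: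
  assumes "xs \<in> walks G I p"
  shows "rev xs \<in> walks G I p"
proof (cases "p = 0")
  case False
  have len: "length xs = 2 * p" using assms by (rule walks_length)
  have nth: "rev xs ! j = xs ! (2 * p - 1 - j)" if "j < 2 * p" for j
    using that len by (simp add: rev_nth)
  have "(rev xs ! j) w = (rev xs ! Suc j) w" if j: "Suc j < 2 * p" and w: "w \<in> side G j" for j w
  proof -
    \<comment> \<open>Since \<open>2 * p - 2\<close> is even, \<open>i\<close> has the parity of
      \<open>j\<close>; so reversal keeps left sides left and right sides right.\<close>
    define i where "i = 2 * p - 2 - j"
    have i: "2 * p - 1 - j = Suc i" "2 * p - 1 - Suc j = i" "Suc i < 2 * p" "even i = even j"
      using j by (auto simp: i_def)
    have "(xs ! Suc i) w = (xs ! i) w"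
      using walks_side[OF assms i(3)] w i(4) by (simp add: side_def)
    then show ?thesis using nth[of j] nth[of "Suc j"] i j by simp
  qed
  moreover have "(rev xs ! (2 * p - 1)) w = (rev xs ! 0) w" if "w \<in> set (lbdry G)" for w
    using nth[of "2 * p - 1"] nth[of 0] that assms False by (simp add: walks_def)
  moreover have "even (card {k. k < 2 * p \<and> restrict (rev xs ! k) (scope G f) = q})"
    if "f \<in> occs G" for f q
  proof -
    have "{k. k < 2 * p \<and> restrict (rev xs ! k) (scope G f) = q}
        = (\<lambda>k. 2 * p - 1 - k) ` {k. k < 2 * p \<and> restrict (xs ! k) (scope G f) = q}"
    proof (intro set_eqI iffI)
      fix k assume "k \<in> {k. k < 2 * p \<and> restrict (rev xs ! k) (scope G f) = q}"
      then show "k \<in> (\<lambda>k. 2 * p - 1 - k) ` {k. k < 2 * p \<and> restrict (xs ! k) (scope G f) = q}"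
        using nth[of k] by (intro image_eqI[of _ _ "2 * p - 1 - k"]) auto
    next
      fix k assume "k \<in> (\<lambda>k. 2 * p - 1 - k) ` {k. k < 2 * p \<and> restrict (xs ! k) (scope G f) = q}"
      then show "k \<in> {k. k < 2 * p \<and> restrict (rev xs ! k) (scope G f) = q}"
        using nth[of k] by auto
    qed
    moreover have "inj_on (\<lambda>k. 2 * p - 1 - k) {k. k < 2 * p \<and> restrict (xs ! k) (scope G f) = q}"
      by (rule inj_onI) auto
    ultimately show ?thesis using assms that by (simp add: card_image walks_def)
  qed
  ultimately show ?thesis using assms by (simp add: walks_def)
qed (use assms in \<open>simp add: walks_def\<close>)

lemma rev_in_typed_walks:
  assumes "xs \<in> typed_walks G I p F L"
  shows "rev xs \<in> typed_walks G I p (\<lambda>j. L (2 * p - 1 - j)) (\<lambda>j. F (2 * p - 1 - j))"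
  using assms rev_in_walks[of xs G I p] lasts_rev[of xs "2 * p" _ G] firsts_rev[of xs "2 * p" _ G]
  by (auto simp: typed_walks_def walks_length)

lemma sum_split_ends:
  fixes f :: "nat \<Rightarrow> 'b::comm_monoid_add"
  assumes "2 \<le> N"
  shows "(\<Sum>j<N. f j) = f 0 + f (N - 1) + (\<Sum>j=1..<N - 1. f j)"
proof -
  obtain m where N: "N = Suc (Suc m)" using assms by (metis Suc_le_D numeral_2_eq_2 Suc_le_mono)
  have "(\<Sum>j<N. f j) = (\<Sum>j=0..<Suc m. f j) + f (Suc m)"
    by (simp add: N lessThan_atLeast0)
  also have "(\<Sum>j=0..<Suc m. f j) = f 0 + (\<Sum>j=1..<Suc m. f j)"
    using sum.atLeast_Suc_lessThan[of 0 "Suc m" f] by simp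
  finally show ?thesis by (simp add: N ac_simps)
qed

lemma finite_walks:
  assumes "is_shape G" "\<And>w. w \<in> roles G \<Longrightarrow> finite (I w)"
  shows "finite (walks G I p)"
proof (rule finite_subset)
  show "walks G I p \<subseteq> {xs. set xs \<subseteq> PiE (roles G) I \<and> length xs = 2 * p}"
    by (auto simp: walks_def)
  show "finite {xs. set xs \<subseteq> PiE (roles G) I \<and> length xs = 2 * p}"
    using assms by (intro finite_lists_length_eq finite_PiE) (auto simp: is_shape_def)
qed

text \<open>Encoding a walk from left to right pays for floating components inside \<open>L j\<close>, encoding it from
  right to left for those inside \<open>F j\<close>; the product of both bounds is symmetric.\<close>

lemma card_typed_walks_sq_le:
  assumes G: "cored G" and p: "1 \<le> p" and fin: "\<And>w. w \<in> roles G \<Longrightarrow> finite (I w)"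
    and D: "\<And>w. w \<in> roles G \<Longrightarrow> real (card (I w)) \<le> D"
    and xs0: "xs0 \<in> typed_walks G I p F L"
  shows "(real (card (typed_walks G I p F L)))\<^sup>2
    \<le> D ^ (\<Sum>j<2 * p. card (F j) + card (L j)) *
       real (2 * p) ^ (2 * card (roles G) + (\<Sum>j=1..<2 * p - 1. floating_count G (roles G - F j - L j)
         + 2 * card (roles G) * (card (roles G - F j - L j) - min_separator_size G)))"
proof -
  define r where "r = card (roles G)"
  define M where "M j = roles G - F j - L j" for j
  define F' where "F' = (\<lambda>j. L (2 * p - 1 - j))"
  define L' where "L' = (\<lambda>j. F (2 * p - 1 - j))"
  have shape: "is_shape G" using G by (simp add: cored_def)
  have xw: "xs0 \<in> walks G I p" using xs0 by (simp add: typed_walks_def)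
  \<comment> \<open>Without roles the hypotheses say nothing about the sign of \<open>D\<close>. In
    that case the exponent of \<open>D\<close> turns out to be \<open>0\<close>.\<close>
  have D0: "0 \<le> D" if "roles G \<noteq> {}"
    using that D by (meson all_not_in_conv of_nat_0_le_iff order_trans)
  define a where "a = (\<Sum>j<2 * p. card (F j))"
  define b where "b = (\<Sum>j<2 * p. card (L j))"
  define u where "u = (\<Sum>j=1..<2 * p - 1. card (paid_roles G (M j) (L j)))"
  define v where "v = (\<Sum>j=1..<2 * p - 1. card (paid_roles G (M j) (F j)))"
  have inner: "1 \<le> j" "Suc j < 2 * p" if "j \<in> {1..<2 * p - 1}" for j using that by auto
  have "(\<Sum>j<2 * p. card (paid_at G p F L j)) = r + u"
    using p by (subst sum_split_ends) (auto simp: paid_at_def r_def u_def M_def intro!: sum.cong)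
  with card_typed_walks_le[OF G fin D xs0]
  have 1: "real (card (typed_walks G I p F L)) \<le> D ^ a * real (2 * p) ^ (r + u)"
    by (simp add: a_def)
  have "(\<Sum>j<2 * p. card (F' j)) = b"
    unfolding F'_def b_def using sum.nat_diff_reindex[of "\<lambda>j. card (L j)" "2 * p"] by simp
  moreover have "(\<Sum>j<2 * p. card (paid_at G p F' L' j)) = r + v"
  proof -
    \<comment> \<open>The cost of the reversed walk in the original numbering: now copy
      \<open>0\<close> is recorded in full and copy \<open>2 * p - 1\<close> is free.\<close>
    define h where "h j = card (if j = 0 then roles G else if Suc j = 2 * p then {} else paid_roles G (M j) (F j))" for j
    have "(\<Sum>j<2 * p. card (paid_at G p F' L' j)) = (\<Sum>j<2 * p. h (2 * p - Suc j))"
      using p by (intro sum.cong refl)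
        (auto simp: paid_at_def h_def M_def F'_def L'_def Diff_eq Int_ac)
    also have "\<dots> = (\<Sum>j<2 * p. h j)" by (rule sum.nat_diff_reindex)
    also have "\<dots> = r + v"
      using p by (subst sum_split_ends) (auto simp: h_def r_def v_def intro!: sum.cong)
    finally show ?thesis .
  qed
  moreover have "card (typed_walks G I p F L) \<le> card (typed_walks G I p F' L')"
  proof (rule card_inj_on_le)
    show "rev ` typed_walks G I p F L \<subseteq> typed_walks G I p F' L'"
      unfolding F'_def L'_def using rev_in_typed_walks by blast
    show "finite (typed_walks G I p F' L')"
      by (rule finite_subset[OF _ finite_walks[OF shape fin]]) (auto simp: typed_walks_def)
  qed simp
  ultimately have 2: "real (card (typed_walks G I p F L)) \<le> D ^ b * real (2 * p) ^ (r + v)"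
    using card_typed_walks_le[OF G fin D rev_in_typed_walks[OF xs0, folded F'_def L'_def]]
    by (metis of_nat_le_iff order_trans)
  have "(real (card (typed_walks G I p F L)))\<^sup>2 \<le> (D ^ a * real (2 * p) ^ (r + u)) * (D ^ b * real (2 * p) ^ (r + v))"
    unfolding power2_eq_square using 1 2 by (intro mult_mono) (auto intro: order_trans[OF of_nat_0_le_iff])
  also have "\<dots> = D ^ (a + b) * real (2 * p) ^ (2 * r + (u + v))"
    by (simp add: power_add power_mult_distrib mult_ac power2_eq_square power_mult)
  also have "\<dots> \<le> D ^ (a + b) * real (2 * p) ^ (2 * r + (\<Sum>j=1..<2 * p - 1. floating_count G (M j)
         + 2 * r * (card (M j) - min_separator_size G)))"
  proof (intro mult_left_mono power_increasing add_mono order_refl)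
    show "u + v \<le> (\<Sum>j=1..<2 * p - 1. floating_count G (M j) + 2 * r * (card (M j) - min_separator_size G))"
      unfolding u_def v_def sum.distrib[symmetric]
    proof (rule sum_mono)
      fix j assume j: "j \<in> {1..<2 * p - 1}"
      have FL: "F j = firsts G xs0 j" "L j = lasts G xs0 j"
        using xs0 inner[OF j] by (auto simp: typed_walks_def)
      show "card (paid_roles G (M j) (L j)) + card (paid_roles G (M j) (F j))
          \<le> floating_count G (M j) + 2 * r * (card (M j) - min_separator_size G)"
        unfolding r_def
        using card_paid_roles_le[OF G, of "M j" "L j" "F j"]
          middle_in_separators[OF G xw inner[OF j]] firsts_lasts_disjoint[OF G xw, of j] inner[OF j] FL
        by (simp add: M_def Int_commute)
    qed
    show "0 \<le> D ^ (a + b)"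
    proof (cases "roles G = {}")
      case True
      have "F j = {}" "L j = {}" if "j < 2 * p" for j
        using xs0 that True by (auto simp: typed_walks_def firsts_def lasts_def)
      then have "a + b = 0" by (simp add: a_def b_def)
      then show ?thesis by simp
    qed (use D0 in auto)
  qed (use p in auto)
  finally show ?thesis
    by (simp add: a_def b_def r_def M_def sum.distrib)
qed

text \<open>First, last and middle roles partition each copy, and the end copies have no middle. So
  the number of labels available to both reading directions together falls short of
  \<open>2 * p * card (roles G)\<close> by the total size of the separators.\<close>

lemma sum_card_types:
  assumes G: "cored G" and p: "1 \<le> p" and xs: "xs \<in> typed_walks G I p F L"
  shows "(\<Sum>j<2 * p. card (F j) + card (L j)) + (\<Sum>j=1..<2 * p - 1. card (roles G - F j - L j))
    = 2 * p * card (roles G)"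
proof -
  have xw: "xs \<in> walks G I p" using xs by (simp add: typed_walks_def)
  have finr: "finite (roles G)" using G by (simp add: cored_def is_shape_def)
  have FL: "F j = firsts G xs j" "L j = lasts G xs j" if "j < 2 * p" for j
    using xs that by (auto simp: typed_walks_def)
  have parts: "card (F j) + card (L j) + card (roles G - F j - L j) = card (roles G)" if "j < 2 * p" for j
  proof -
    have sub: "F j \<subseteq> roles G" "L j \<subseteq> roles G" "F j \<inter> L j = {}"
      using FL[OF that] firsts_lasts_disjoint[OF G xw that] by (auto simp: firsts_def lasts_def)
    then have "card (F j) + card (L j) = card (F j \<union> L j)"
      using finr finite_subset by (metis card_Un_disjoint)
    moreover have "card (roles G - (F j \<union> L j)) = card (roles G) - card (F j \<union> L j)"
      using sub finr finite_subset by (intro card_Diff_subset) auto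
    moreover have "card (F j \<union> L j) \<le> card (roles G)"
      using sub finr by (intro card_mono) auto
    ultimately show ?thesis by (simp add: Diff_eq Int_assoc)
  qed
  have ends: "roles G - F 0 - L 0 = {}" "roles G - F (2 * p - 1) - L (2 * p - 1) = {}"
    using FL[of 0] FL[of "2 * p - 1"] p walks_length[OF xw] by (auto simp: firsts_def lasts_def)
  have "(\<Sum>j<2 * p. card (F j) + card (L j)) + (\<Sum>j<2 * p. card (roles G - F j - L j)) = (\<Sum>j<2 * p. card (roles G))"
    unfolding sum.distrib[symmetric] by (intro sum.cong) (auto simp: parts)
  moreover have "(\<Sum>j<2 * p. card (roles G - F j - L j)) = (\<Sum>j=1..<2 * p - 1. card (roles G - F j - L j))"
  proof -
    have "card (roles G - F 0 - L 0) = 0" "card (roles G - F (2 * p - 1) - L (2 * p - 1)) = 0"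
      unfolding ends by simp_all
    moreover have "2 \<le> 2 * p" using p by simp
    ultimately show ?thesis
      using sum_split_ends[of "2 * p" "\<lambda>j. card (roles G - F j - L j)"] by linarith
  qed
  ultimately show ?thesis by simp
qed

text \<open>Each value of the array has one first and one last use. At any other copy the value is
  seen before and after, hence so is every label in the scope, and the scope lies in the middle.
  These copies account for the contributions of scopes contained in separators.\<close>

lemma card_values_ge:
  assumes G: "cored G" and xs: "xs \<in> typed_walks G I p F L" and f: "f \<in> occs G"
  shows "2 * p \<le> 2 * card ((\<lambda>j. restrict (xs ! j) (scope G f)) ` {..<2 * p})
    + card {j \<in> {1..<2 * p - 1}. scope G f \<subseteq> roles G - F j - L j}"
proof -
  define u where "u j = restrict (xs ! j) (scope G f)" for j
  define A where "A = {j. j < 2 * p \<and> (\<forall>k<j. u k \<noteq> u j)}"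
  define B where "B = {j. j < 2 * p \<and> (\<forall>k. j < k \<and> k < 2 * p \<longrightarrow> u k \<noteq> u j)}"
  define E where "E = {j \<in> {1..<2 * p - 1}. scope G f \<subseteq> roles G - F j - L j}"
  have len: "length xs = 2 * p" using xs by (auto simp: typed_walks_def walks_length)
  have sc: "scope G f \<subseteq> roles G" using G f by (auto simp: cored_def is_shape_def)
  have "inj_on u A" "inj_on u B"
    by (rule inj_onI, rule ccontr, force simp: A_def B_def neq_iff)+
  then have AB: "card A \<le> card (u ` {..<2 * p})" "card B \<le> card (u ` {..<2 * p})"
    by (auto intro!: card_inj_on_le simp: A_def B_def)
  have "{..<2 * p} \<subseteq> A \<union> B \<union> E"
  proof
    fix j assume "j \<in> {..<2 * p}"
    then have j: "j < 2 * p" by simp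
    show "j \<in> A \<union> B \<union> E"
    proof (cases "j \<in> A \<union> B")
      case False
      then obtain k k' where k: "k < j" "u k = u j" and k': "j < k'" "k' < 2 * p" "u k' = u j"
        using j by (auto simp: A_def B_def)
      have "w \<notin> F j \<and> w \<notin> L j" if w: "w \<in> scope G f" for w
      proof -
        have "(xs ! k) w = (xs ! j) w" "(xs ! k') w = (xs ! j) w"
          using fun_cong[OF k(2), of w] fun_cong[OF k'(3), of w] w by (auto simp: u_def)
        then have "w \<notin> firsts G xs j" "w \<notin> lasts G xs j"
          using k k' len by (auto simp: firsts_def lasts_def)
        then show ?thesis using xs j by (simp add: typed_walks_def)
      qed
      then show ?thesis using k k' sc by (auto simp: E_def)
    qed simp
  qed
  then have "card {..<2 * p} \<le> card (A \<union> B \<union> E)"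
    by (rule card_mono[rotated]) (auto simp: A_def B_def E_def)
  also have "\<dots> \<le> card A + card B + card E"
    by (meson card_Un_le add_right_mono order_trans)
  finally show ?thesis using AB unfolding u_def E_def by simp
qed

section \<open>The expected trace\<close>

text \<open>Consecutive pairs \<open>x # y\<close> stand for one product of the matrix with its
  adjoint: \<open>x\<close> leaves the row index \<open>i\<close>, meets \<open>y\<close> in a
  common column index, and \<open>y\<close> supplies the next row index. Lists of odd length are
  excluded.\<close>

fun linked :: "'w list \<Rightarrow> 'w list \<Rightarrow> 'l list \<Rightarrow> 'l list \<Rightarrow> ('w \<Rightarrow> 'l) list \<Rightarrow> bool" where
  "linked U V i i' [] \<longleftrightarrow> i = i'"
| "linked U V i i' [x] \<longleftrightarrow> False"
| "linked U V i i' (x # y # xs) \<longleftrightarrow> map x U = i \<and> map x V = map y V \<and> linked U V (map y U) i' xs"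

definition closed_lists :: "('w, 'f) shape \<Rightarrow> ('w \<Rightarrow> 'l set) \<Rightarrow> nat \<Rightarrow> ('w \<Rightarrow> 'l) list set" where
  "closed_lists G I p = {xs. set xs \<subseteq> PiE (roles G) I \<and> length xs = 2 * p \<and>
     linked (lbdry G) (rbdry G) (map (hd xs) (lbdry G)) (map (hd xs) (lbdry G)) xs}"

definition factor_weight :: "('w, 'f) shape \<Rightarrow> ('f \<Rightarrow> ('w \<Rightarrow> 'l) \<Rightarrow> real) \<Rightarrow> ('w \<Rightarrow> 'l) \<Rightarrow> real" where
  "factor_weight G X x = (\<Prod>f\<in>occs G. X f (restrict x (scope G f)))"

lemma sum_lists_Suc:
  fixes g :: "'a list \<Rightarrow> 'b::comm_monoid_add"
  shows "(\<Sum>xs | set xs \<subseteq> P \<and> length xs = Suc n. g xs) = (\<Sum>x\<in>P. \<Sum>xs | set xs \<subseteq> P \<and> length xs = n. g (x # xs))"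
proof -
  have "{xs. set xs \<subseteq> P \<and> length xs = Suc n}
      = (\<lambda>(x, xs). x # xs) ` (P \<times> {xs. set xs \<subseteq> P \<and> length xs = n})"
    by (auto simp: length_Suc_conv)
  then have "(\<Sum>xs | set xs \<subseteq> P \<and> length xs = Suc n. g xs)
      = (\<Sum>z\<in>P \<times> {xs. set xs \<subseteq> P \<and> length xs = n}. g (fst z # snd z))"
    by (simp add: sum.reindex inj_on_def case_prod_beta)
  then show ?thesis by (simp add: sum.cartesian_product case_prod_beta)
qed

lemma finite_label_tuples:
  assumes "\<And>u. u \<in> set U \<Longrightarrow> finite (I u)"
  shows "finite (label_tuples I U)"
  using assms
proof (induction U)
  case (Cons u U)
  have "label_tuples I (u # U) = (\<lambda>(y, ys). y # ys) ` (I u \<times> label_tuples I U)"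
    by (auto simp: label_tuples_def list_all2_Cons2)
  then show ?case using Cons by simp
qed (simp add: label_tuples_def)

lemma map_in_label_tuples:
  assumes "x \<in> PiE W I" "set U \<subseteq> W"
  shows "map x U \<in> label_tuples I U"
  using assms(2) by (induction U) (use assms(1) in \<open>auto simp: label_tuples_def\<close>)

lemma sum_of_bool_eq:
  fixes g :: "'a \<Rightarrow> real"
  assumes "finite A" "a \<in> A"
  shows "(\<Sum>k\<in>A. of_bool (a = k) * g k) = g a"
  using assms by (simp add: of_bool_def if_distrib[of "\<lambda>c. c * _"] cong: if_cong)

lemma mat_mult_shape_matrix_adjoint:
  assumes "is_shape G" "\<And>w. w \<in> roles G \<Longrightarrow> finite (I w)"
  shows "mat_mult (label_tuples I (rbdry G)) (shape_matrix G I X) (mat_adjoint (shape_matrix G I X)) i k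
    = (\<Sum>x\<in>PiE (roles G) I. \<Sum>y\<in>PiE (roles G) I. factor_weight G X x * factor_weight G X y *
        of_bool (map x (lbdry G) = i \<and> map x (rbdry G) = map y (rbdry G)) * of_bool (map y (lbdry G) = k))"
proof -
  let ?P = "PiE (roles G) I" and ?C = "label_tuples I (rbdry G)" and ?w = "factor_weight G X"
  have sub: "set (rbdry G) \<subseteq> roles G" using assms(1) by (simp add: is_shape_def)
  have finC: "finite ?C" using assms(2) sub by (intro finite_label_tuples) auto
  have "mat_mult ?C (shape_matrix G I X) (mat_adjoint (shape_matrix G I X)) i k
    = (\<Sum>j\<in>?C. \<Sum>x\<in>?P. \<Sum>y\<in>?P. (?w x * of_bool (map x (lbdry G) = i) * of_bool (map x (rbdry G) = j)) *
        (?w y * of_bool (map y (lbdry G) = k) * of_bool (map y (rbdry G) = j)))"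
    by (simp add: mat_mult_def mat_adjoint_def shape_matrix_def factor_weight_def sum_product)
  also have "\<dots> = (\<Sum>x\<in>?P. \<Sum>j\<in>?C. \<Sum>y\<in>?P. (?w x * of_bool (map x (lbdry G) = i) * of_bool (map x (rbdry G) = j)) *
        (?w y * of_bool (map y (lbdry G) = k) * of_bool (map y (rbdry G) = j)))"
    by (rule sum.swap)
  also have "\<dots> = (\<Sum>x\<in>?P. \<Sum>y\<in>?P. \<Sum>j\<in>?C. of_bool (map x (rbdry G) = j) * (?w x * of_bool (map x (lbdry G) = i) *
        (?w y * of_bool (map y (lbdry G) = k) * of_bool (map y (rbdry G) = j))))"
    by (subst sum.swap) (simp add: mult_ac)
  also have "\<dots> = (\<Sum>x\<in>?P. \<Sum>y\<in>?P. ?w x * of_bool (map x (lbdry G) = i) *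
        (?w y * of_bool (map y (lbdry G) = k) * of_bool (map y (rbdry G) = map x (rbdry G))))"
    by (intro sum.cong refl sum_of_bool_eq finC map_in_label_tuples[OF _ sub])
  also have "\<dots> = (\<Sum>x\<in>?P. \<Sum>y\<in>?P. ?w x * ?w y *
        of_bool (map x (lbdry G) = i \<and> map x (rbdry G) = map y (rbdry G)) * of_bool (map y (lbdry G) = k))"
    by (intro sum.cong refl) (auto simp: of_bool_def)
  finally show ?thesis .
qed

lemma mat_power_shape_matrix:
  assumes "is_shape G" "\<And>w. w \<in> roles G \<Longrightarrow> finite (I w)"
  shows "mat_power (label_tuples I (lbdry G)) (mat_mult (label_tuples I (rbdry G)) (shape_matrix G I X)
      (mat_adjoint (shape_matrix G I X))) p i i'
    = (\<Sum>xs | set xs \<subseteq> PiE (roles G) I \<and> length xs = 2 * p.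
        of_bool (linked (lbdry G) (rbdry G) i i' xs) * (\<Prod>x\<leftarrow>xs. factor_weight G X x))"
    (is "mat_power ?R ?B p i i' = _")
proof (induction p arbitrary: i)
  case 0
  have "{xs. set xs \<subseteq> PiE (roles G) I \<and> length xs = 0} = {[]}" by auto
  then show ?case by simp
next
  case (Suc p)
  let ?P = "PiE (roles G) I" and ?w = "factor_weight G X"
  let ?Q = "{xs. set xs \<subseteq> ?P \<and> length xs = 2 * p}"
  let ?ok = "\<lambda>x y. map x (lbdry G) = i \<and> map x (rbdry G) = map y (rbdry G)"
  let ?t = "\<lambda>k. \<Sum>xs\<in>?Q. of_bool (linked (lbdry G) (rbdry G) k i' xs) * (\<Prod>x\<leftarrow>xs. ?w x)"
  have sub: "set (lbdry G) \<subseteq> roles G" using assms(1) by (simp add: is_shape_def)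
  have finR: "finite ?R" using assms(2) sub by (intro finite_label_tuples) auto
  have "mat_power ?R ?B (Suc p) i i' = (\<Sum>k\<in>?R. ?B i k * ?t k)"
    by (simp add: mat_mult_def[of ?R] Suc.IH)
  also have "\<dots> = (\<Sum>k\<in>?R. \<Sum>x\<in>?P. \<Sum>y\<in>?P. ?w x * ?w y * of_bool (?ok x y) * of_bool (map y (lbdry G) = k) * ?t k)"
    by (simp only: mat_mult_shape_matrix_adjoint[OF assms] sum_distrib_right)
  also have "\<dots> = (\<Sum>x\<in>?P. \<Sum>k\<in>?R. \<Sum>y\<in>?P. ?w x * ?w y * of_bool (?ok x y) * of_bool (map y (lbdry G) = k) * ?t k)"
    by (rule sum.swap)
  also have "\<dots> = (\<Sum>x\<in>?P. \<Sum>y\<in>?P. \<Sum>k\<in>?R. of_bool (map y (lbdry G) = k) * (?w x * ?w y * of_bool (?ok x y) * ?t k))"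
    by (subst sum.swap) (simp only: mult_ac)
  also have "\<dots> = (\<Sum>x\<in>?P. \<Sum>y\<in>?P. ?w x * ?w y * of_bool (?ok x y) * ?t (map y (lbdry G)))"
    by (intro sum.cong refl sum_of_bool_eq finR map_in_label_tuples[OF _ sub])
  also have "\<dots> = (\<Sum>x\<in>?P. \<Sum>y\<in>?P. \<Sum>xs\<in>?Q. of_bool (linked (lbdry G) (rbdry G) i i' (x # y # xs)) * (\<Prod>x\<leftarrow>x # y # xs. ?w x))"
    unfolding sum_distrib_left by (intro sum.cong refl) (simp add: of_bool_conj mult_ac)
  finally show ?case by (simp only: sum_lists_Suc mult_Suc_right add_2_eq_Suc)
qed

lemma shape_trace_power_eq:
  assumes "is_shape G" "\<And>w. w \<in> roles G \<Longrightarrow> finite (I w)" "1 \<le> p"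
  shows "shape_trace_power G I (shape_matrix G I X) p = (\<Sum>xs\<in>closed_lists G I p. \<Prod>x\<leftarrow>xs. factor_weight G X x)"
proof -
  let ?R = "label_tuples I (lbdry G)" and ?U = "lbdry G" and ?V = "rbdry G"
  let ?Q = "{xs. set xs \<subseteq> PiE (roles G) I \<and> length xs = 2 * p}"
  let ?w = "\<lambda>xs. \<Prod>x\<leftarrow>xs. factor_weight G X x"
  have sub: "set ?U \<subseteq> roles G" using assms(1) by (simp add: is_shape_def)
  have finR: "finite ?R" using assms(2) sub by (intro finite_label_tuples) auto
  have finQ: "finite ?Q"
    using assms(1,2) by (intro finite_lists_length_eq finite_PiE) (auto simp: is_shape_def)
  have "shape_trace_power G I (shape_matrix G I X) p = (\<Sum>i\<in>?R. \<Sum>xs\<in>?Q. of_bool (linked ?U ?V i i xs) * ?w xs)"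
    by (simp add: shape_trace_power_def mat_trace_def mat_power_shape_matrix[OF assms(1,2)])
  also have "\<dots> = (\<Sum>xs\<in>?Q. \<Sum>i\<in>?R. of_bool (linked ?U ?V i i xs) * ?w xs)" by (rule sum.swap)
  \<comment> \<open>A linked list determines its initial row index, so the sum over the diagonal
    collapses to one term per list.\<close>
  also have "\<dots> = (\<Sum>xs\<in>?Q. \<Sum>i\<in>?R. of_bool (map (hd xs) ?U = i) * (of_bool (linked ?U ?V i i xs) * ?w xs))"
  proof (intro sum.cong refl)
    fix xs i assume "xs \<in> ?Q"
    then have "length xs = 2 * p" by simp
    then obtain x y zs where "xs = x # y # zs" using assms(3)
      by (cases xs; cases "tl xs") (auto simp: Suc_double_not_eq_double)
    then show "of_bool (linked ?U ?V i i xs) * ?w xs = of_bool (map (hd xs) ?U = i) * (of_bool (linked ?U ?V i i xs) * ?w xs)"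
      by auto
  qed
  also have "\<dots> = (\<Sum>xs\<in>?Q. of_bool (linked ?U ?V (map (hd xs) ?U) (map (hd xs) ?U) xs) * ?w xs)"
  proof (intro sum.cong refl sum_of_bool_eq finR map_in_label_tuples[OF _ sub])
    fix xs assume "xs \<in> ?Q"
    then have "xs \<noteq> []" "set xs \<subseteq> PiE (roles G) I" using assms(3) by auto
    then show "hd xs \<in> PiE (roles G) I" using hd_in_set by blast
  qed
  also have "\<dots> = (\<Sum>xs\<in>closed_lists G I p. ?w xs)"
    unfolding closed_lists_def by (rule sum.mono_neutral_cong_right) (use finQ in auto)
  finally show ?thesis .
qed

lemma linked_sides:
  assumes "linked (lbdry G) (rbdry G) i i' xs"
  shows "(Suc j < length xs \<longrightarrow> w \<in> side G j \<longrightarrow> (xs ! j) w = (xs ! Suc j) w) \<and>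
    (xs \<noteq> [] \<longrightarrow> map (hd xs) (lbdry G) = i \<and> map (last xs) (lbdry G) = i')"
  using assms
proof (induction "lbdry G" "rbdry G" i i' xs arbitrary: j rule: linked.induct)
  case (3 i i' x y xs)
  then have xy: "map x (lbdry G) = i" "map x (rbdry G) = map y (rbdry G)"
    and tl: "linked (lbdry G) (rbdry G) (map y (lbdry G)) i' xs" by auto
  note IH = "3.hyps"[OF tl]
  have last: "map (last (x # y # xs)) (lbdry G) = i'"
    using tl IH by (cases xs) auto
  have step: "((x # y # xs) ! j) w = ((x # y # xs) ! Suc j) w"
    if "Suc j < length (x # y # xs)" "w \<in> side G j"
  proof -
    consider "j = 0" | "j = 1" | k where "j = Suc (Suc k)" by (metis One_nat_def not0_implies_Suc)
    then show ?thesis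
    proof cases
      case 1
      then show ?thesis using xy(2) that by (simp add: side_def)
    next
      case 2
      then have "xs \<noteq> []" using that by auto
      then have "map (hd xs) (lbdry G) = map y (lbdry G)" using IH by blast
      then show ?thesis using 2 that \<open>xs \<noteq> []\<close> by (simp add: side_def hd_conv_nth)
    next
      \<comment> \<open>The recursion drops two copies at a time, which leaves the parity that
        selects the side unchanged.\<close>
      case (3 k)
      then show ?thesis using IH[of k] that by (simp add: side_def)
    qed
  qed
  show ?case using xy last step by auto
qed auto

lemma closed_lists_subset_walks:
  assumes "xs \<in> closed_lists G I p" "1 \<le> p"
    and "\<And>f q. f \<in> occs G \<Longrightarrow> even (card {k. k < 2 * p \<and> restrict (xs ! k) (scope G f) = q})"
  shows "xs \<in> walks G I p"
proof -
  have xs: "set xs \<subseteq> PiE (roles G) I" "length xs = 2 * p"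
    and l: "linked (lbdry G) (rbdry G) (map (hd xs) (lbdry G)) (map (hd xs) (lbdry G)) xs"
    using assms(1) by (auto simp: closed_lists_def)
  have "xs \<noteq> []" using xs(2) assms(2) by auto
  then have "map (last xs) (lbdry G) = map (hd xs) (lbdry G)"
    using linked_sides[OF l] by blast
  then have "\<forall>w\<in>set (lbdry G). (xs ! (2 * p - 1)) w = (xs ! 0) w"
    using \<open>xs \<noteq> []\<close> xs(2) by (simp add: last_conv_nth hd_conv_nth)
  then show ?thesis
    using xs linked_sides[OF l] assms(3) by (auto simp: walks_def)
qed

section \<open>Moments along a single walk\<close>

lemma prod_group_power:
  fixes g :: "'a \<Rightarrow> real" and N :: nat
  assumes "finite Y" "u ` {..<N} \<subseteq> Y"
  shows "(\<Prod>j<N. g (u j)) = (\<Prod>y\<in>Y. g y ^ card {j. j < N \<and> u j = y})"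
proof -
  have "(\<Prod>j<N. g (u j)) = (\<Prod>y\<in>Y. \<Prod>j\<in>{j. j \<in> {..<N} \<and> u j = y}. g (u j))"
    by (rule prod.group[symmetric]) (use assms in auto)
  also have "\<dots> = (\<Prod>y\<in>Y. g y ^ card {j. j < N \<and> u j = y})"
  proof (rule prod.cong[OF refl])
    fix y
    have "(\<Prod>j | j \<in> {..<N} \<and> u j = y. g (u j)) = (\<Prod>j | j < N \<and> u j = y. g y)"
      by (rule prod.cong) auto
    then show "(\<Prod>j | j \<in> {..<N} \<and> u j = y. g (u j)) = g y ^ card {j. j < N \<and> u j = y}"
      by simp
  qed
  finally show ?thesis .
qed

lemma shape_scope:
  assumes "is_shape G" "f \<in> occs G"
  shows "scope G f \<subseteq> roles G" "finite (scope G f)"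
proof -
  show "scope G f \<subseteq> roles G" using assms by (simp add: is_shape_def)
  then show "finite (scope G f)" using assms(1) by (auto simp: is_shape_def intro: finite_subset)
qed

lemma prod_list_factor_weight:
  assumes "is_shape G" "\<And>w. w \<in> roles G \<Longrightarrow> finite (I w)" "set xs \<subseteq> PiE (roles G) I"
  shows "(\<Prod>x\<leftarrow>xs. factor_weight G X x) = (\<Prod>f\<in>occs G. \<Prod>y\<in>PiE (scope G f) I.
    X f y ^ card {j. j < length xs \<and> restrict (xs ! j) (scope G f) = y})"
proof -
  have "(\<Prod>x\<leftarrow>xs. factor_weight G X x) = (\<Prod>j<length xs. factor_weight G X (xs ! j))"
    by (induction xs) (simp_all add: prod.lessThan_Suc_shift del: prod.lessThan_Suc)
  also have "\<dots> = (\<Prod>f\<in>occs G. \<Prod>j<length xs. X f (restrict (xs ! j) (scope G f)))"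
    unfolding factor_weight_def by (rule prod.swap)
  also have "\<dots> = (\<Prod>f\<in>occs G. \<Prod>y\<in>PiE (scope G f) I.
    X f y ^ card {j. j < length xs \<and> restrict (xs ! j) (scope G f) = y})"
  proof (rule prod.cong[OF refl])
    fix f assume f: "f \<in> occs G"
    note sc = shape_scope[OF assms(1) f]
    show "(\<Prod>j<length xs. X f (restrict (xs ! j) (scope G f))) = (\<Prod>y\<in>PiE (scope G f) I.
      X f y ^ card {j. j < length xs \<and> restrict (xs ! j) (scope G f) = y})"
    proof (rule prod_group_power)
      show "finite (PiE (scope G f) I)" using sc assms(2) by (intro finite_PiE) auto
      show "(\<lambda>j. restrict (xs ! j) (scope G f)) ` {..<length xs} \<subseteq> PiE (scope G f) I"
      proof
        fix y assume "y \<in> (\<lambda>j. restrict (xs ! j) (scope G f)) ` {..<length xs}"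
        then obtain j where j: "y = restrict (xs ! j) (scope G f)" "j < length xs" by auto
        have "xs ! j \<in> PiE (roles G) I" using assms(3) nth_mem[OF j(2)] by blast
        then show "y \<in> PiE (scope G f) I" using sc(1) j(1) by auto
      qed
    qed
  qed
  finally show ?thesis .
qed

lemma integrable_power_le:
  assumes "prob_space \<mu>" "sets \<mu> = sets borel" "integrable \<mu> (\<lambda>z::real. \<bar>z\<bar> ^ N)" "k \<le> N"
  shows "integrable \<mu> (\<lambda>z. z ^ k)"
proof -
  interpret prob_space \<mu> by fact
  note [measurable_cong] = assms(2)
  show ?thesis
  proof (rule Bochner_Integration.integrable_bound)
    show "integrable \<mu> (\<lambda>z. 1 + \<bar>z\<bar> ^ N)" using assms(3) by simp
    have "\<bar>z ^ k\<bar> \<le> \<bar>1 + \<bar>z\<bar> ^ N\<bar>" for z :: real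
    proof (cases "\<bar>z\<bar> \<le> 1")
      case True
      then have "\<bar>z\<bar> ^ k \<le> 1" by (simp add: power_le_one)
      then show ?thesis by (simp add: power_abs add_increasing2)
    next
      case False
      then have "\<bar>z\<bar> ^ k \<le> \<bar>z\<bar> ^ N" using assms(4) by (intro power_increasing) auto
      then show ?thesis by (simp add: power_abs)
    qed
    then show "AE z in \<mu>. norm (z ^ k) \<le> norm (1 + \<bar>z\<bar> ^ N)" by simp
  qed measurable
qed

lemma odd_moment_zero:
  assumes "sets \<mu> = sets borel" "distr \<mu> borel uminus = (\<mu> :: real measure)" "odd k"
  shows "(LINT z|\<mu>. z ^ k) = 0"
proof -
  note [measurable_cong] = assms(1)
  have "(LINT z|distr \<mu> borel uminus. z ^ k) = (LINT z|\<mu>. (- z) ^ k)"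
    by (rule integral_distr) measurable
  then have "(LINT z|\<mu>. z ^ k) = - (LINT z|\<mu>. z ^ k)"
    using assms(2,3) by (simp add: power_minus_odd)
  then show ?thesis by simp
qed

text \<open>The weight of a walk is a monomial in independent coordinates whose exponents are the
  multiplicities, so its expectation is a product of moments of single laws.\<close>

lemma expectation_walk:
  fixes G :: "('w, 'f) shape" and I :: "'w \<Rightarrow> 'l set"
  assumes "prob_space M" and shape: "is_shape G" and fin: "\<And>w. w \<in> roles G \<Longrightarrow> finite (I w)"
    and indep: "prob_space.indep_vars M (\<lambda>_. borel) (\<lambda>(f, y). \<xi> f y) (SIGMA f:occs G. PiE (scope G f) I)"
    and law: "\<And>f y. f \<in> occs G \<Longrightarrow> y \<in> PiE (scope G f) I \<Longrightarrow> distr M borel (\<xi> f y) = L f"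
    and int: "\<And>f k. f \<in> occs G \<Longrightarrow> k \<le> length xs \<Longrightarrow> integrable (L f) (\<lambda>z::real. z ^ k)"
    and xs: "set xs \<subseteq> PiE (roles G) I"
  shows "integrable M (\<lambda>\<omega>. \<Prod>x\<leftarrow>xs. factor_weight G (\<lambda>f y. \<xi> f y \<omega>) x)"
    and "(LINT \<omega>|M. (\<Prod>x\<leftarrow>xs. factor_weight G (\<lambda>f y. \<xi> f y \<omega>) x)) = (\<Prod>f\<in>occs G. \<Prod>y\<in>PiE (scope G f) I.
      LINT z|L f. z ^ card {j. j < length xs \<and> restrict (xs ! j) (scope G f) = y})"
proof -
  interpret prob_space M by fact
  let ?S = "SIGMA f:occs G. PiE (scope G f) I"
  define N where "N f y = card {j. j < length xs \<and> restrict (xs ! j) (scope G f) = y}" for f y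
  have N_le: "N f y \<le> length xs" for f y
  proof -
    have "N f y \<le> card {..<length xs}" unfolding N_def by (rule card_mono) auto
    then show ?thesis by simp
  qed
  have finY: "finite (PiE (scope G f) I)" if "f \<in> occs G" for f
    using shape_scope[OF shape that] fin by (intro finite_PiE) auto
  have finS: "finite ?S" using shape finY by (auto simp: is_shape_def)
  have rv: "\<xi> f y \<in> borel_measurable M" if "f \<in> occs G" "y \<in> PiE (scope G f) I" for f y
  proof -
    have "\<forall>i\<in>?S. (case i of (f, y) \<Rightarrow> \<xi> f y) \<in> borel_measurable M"
      using indep unfolding indep_vars_def by blast
    then show ?thesis using that by auto
  qed
  have "indep_vars (\<lambda>_. borel) (\<lambda>i \<omega>. (case i of (f, y) \<Rightarrow> \<lambda>z. z ^ N f y) ((case i of (f, y) \<Rightarrow> \<xi> f y) \<omega>)) ?S"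
    by (rule indep_vars_compose2[OF indep]) auto
  then have ind: "indep_vars (\<lambda>_. borel) (\<lambda>i \<omega>. \<xi> (fst i) (snd i) \<omega> ^ N (fst i) (snd i)) ?S"
    by (simp add: case_prod_beta)
  have momint: "integrable M (\<lambda>\<omega>. \<xi> f y \<omega> ^ N f y)" "(LINT \<omega>|M. \<xi> f y \<omega> ^ N f y) = (LINT z|L f. z ^ N f y)"
    if "f \<in> occs G" "y \<in> PiE (scope G f) I" for f y
  proof -
    have "integrable (distr M borel (\<xi> f y)) (\<lambda>z. z ^ N f y)"
      using int[OF that(1) N_le] law[OF that] by simp
    then show "integrable M (\<lambda>\<omega>. \<xi> f y \<omega> ^ N f y)"
      using rv[OF that] by (simp add: integrable_distr_eq)
    show "(LINT \<omega>|M. \<xi> f y \<omega> ^ N f y) = (LINT z|L f. z ^ N f y)"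
      unfolding law[OF that, symmetric] using rv[OF that] by (simp add: integral_distr)
  qed
  have sig: "(\<Prod>f\<in>occs G. \<Prod>y\<in>PiE (scope G f) I. h f y) = (\<Prod>i\<in>?S. h (fst i) (snd i))"
    for h :: "'f \<Rightarrow> ('w \<Rightarrow> 'l) \<Rightarrow> real"
    using shape finY by (simp add: prod.Sigma is_shape_def case_prod_beta)
  have eq: "(\<Prod>x\<leftarrow>xs. factor_weight G (\<lambda>f y. \<xi> f y \<omega>) x) = (\<Prod>i\<in>?S. \<xi> (fst i) (snd i) \<omega> ^ N (fst i) (snd i))" for \<omega>
    unfolding N_def
    by (rule trans[OF prod_list_factor_weight[OF shape fin xs] sig[of "\<lambda>f y. \<xi> f y \<omega> ^ N f y", unfolded N_def]])
  show "integrable M (\<lambda>\<omega>. \<Prod>x\<leftarrow>xs. factor_weight G (\<lambda>f y. \<xi> f y \<omega>) x)"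
    unfolding eq by (rule indep_vars_integrable[OF finS ind]) (auto intro: momint)
  have "(LINT \<omega>|M. (\<Prod>i\<in>?S. \<xi> (fst i) (snd i) \<omega> ^ N (fst i) (snd i)))
      = (\<Prod>i\<in>?S. LINT \<omega>|M. \<xi> (fst i) (snd i) \<omega> ^ N (fst i) (snd i))"
    by (rule indep_vars_lebesgue_integral[OF finS ind]) (auto intro: momint)
  also have "\<dots> = (\<Prod>i\<in>?S. LINT z|L (fst i). z ^ N (fst i) (snd i))"
    by (intro prod.cong refl) (auto simp: momint)
  also have "\<dots> = (\<Prod>f\<in>occs G. \<Prod>y\<in>PiE (scope G f) I. LINT z|L f. z ^ N f y)"
    using sig[of "\<lambda>f y. LINT z|L f. z ^ N f y"] by simp
  finally show "(LINT \<omega>|M. (\<Prod>x\<leftarrow>xs. factor_weight G (\<lambda>f y. \<xi> f y \<omega>) x)) = (\<Prod>f\<in>occs G. \<Prod>y\<in>PiE (scope G f) I.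
      LINT z|L f. z ^ card {j. j < length xs \<and> restrict (xs ! j) (scope G f) = y})"
    unfolding eq N_def .
qed

text \<open>A value of multiplicity \<open>2 * t\<close> costs the exponent \<open>t - 1\<close>.
  Over the distinct values these add up to \<open>p\<close> minus their number, hence to at most
  \<open>m / 2\<close>. Later \<open>m\<close> is the number of inner copies whose middle contains
  the scope.\<close>

lemma prod_moments_le:
  fixes u :: "nat \<Rightarrow> 'y" and \<mu> :: "real measure" and n C \<beta> \<gamma> :: real
  assumes "prob_space \<mu>" and Y: "finite Y" "u ` {..<2 * p} \<subseteq> Y"
    and ev: "\<And>y. even (card {j. j < 2 * p \<and> u j = y})"
    and mom: "\<And>t. 1 \<le> t \<Longrightarrow> t \<le> p \<Longrightarrow> (LINT z|\<mu>. \<bar>z\<bar> ^ (2 * t))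
      \<le> C ^ (2 * t) * n powr (\<beta> * (real t - 1)) * real t powr (\<gamma> * (real t - 1))"
    and n: "1 \<le> n" and p: "1 \<le> p" and bg: "0 \<le> \<beta>" "0 \<le> \<gamma>"
    and m: "2 * p \<le> 2 * card (u ` {..<2 * p}) + m"
  shows "0 \<le> (\<Prod>y\<in>Y. LINT z|\<mu>. z ^ card {j. j < 2 * p \<and> u j = y})"
    and "(\<Prod>y\<in>Y. LINT z|\<mu>. z ^ card {j. j < 2 * p \<and> u j = y})
      \<le> \<bar>C\<bar> ^ (2 * p) * n powr (\<beta> * real m / 2) * real p powr (\<gamma> * real m / 2)"
proof -
  interpret prob_space \<mu> by fact
  define N where "N y = card {j. j < 2 * p \<and> u j = y}" for y
  define Y' where "Y' = u ` {..<2 * p}"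
  define x where "x y = real (N y) / 2 - 1" for y
  have nonneg: "0 \<le> (LINT z|\<mu>. z ^ N y)" for y
    using ev by (intro Bochner_Integration.integral_nonneg) (simp add: N_def zero_le_even_power)
  then show "0 \<le> (\<Prod>y\<in>Y. LINT z|\<mu>. z ^ card {j. j < 2 * p \<and> u j = y})"
    unfolding N_def by (intro prod_nonneg) auto
  have "(\<Prod>y\<in>Y. LINT z|\<mu>. z ^ N y) = (\<Prod>y\<in>Y'. LINT z|\<mu>. z ^ N y)"
  proof (rule prod.mono_neutral_right)
    have "N y = 0" if "y \<notin> Y'" for y using that by (auto simp: N_def Y'_def)
    then show "\<forall>y\<in>Y - Y'. (LINT z|\<mu>. z ^ N y) = 1" by (simp add: prob_space)
  qed (use Y in \<open>auto simp: Y'_def\<close>)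
  also have "\<dots> \<le> (\<Prod>y\<in>Y'. \<bar>C\<bar> ^ N y * n powr (\<beta> * x y) * real p powr (\<gamma> * x y))"
  proof (intro prod_mono conjI nonneg)
    fix y assume "y \<in> Y'"
    then obtain i where i: "i < 2 * p" "u i = y" by (auto simp: Y'_def)
    obtain t where t: "N y = 2 * t" using ev[of y] by (auto simp: N_def elim: evenE)
    have "N y \<noteq> 0" using i by (auto simp: N_def)
    then have "1 \<le> t" using t by simp
    have "N y \<le> card {..<2 * p}" unfolding N_def by (rule card_mono) auto
    then have "t \<le> p" using t by simp
    have "(LINT z|\<mu>. z ^ N y) = (LINT z|\<mu>. \<bar>z\<bar> ^ (2 * t))"
      by (simp add: t power_even_abs)
    also have "\<dots> \<le> C ^ (2 * t) * n powr (\<beta> * (real t - 1)) * real t powr (\<gamma> * (real t - 1))"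
      by (rule mom) fact+
    \<comment> \<open>Replacing the base \<open>t\<close> by \<open>p\<close> gives all values the
      same base, so that their exponents can be added.\<close>
    also have "\<dots> \<le> C ^ (2 * t) * n powr (\<beta> * (real t - 1)) * real p powr (\<gamma> * (real t - 1))"
      using \<open>1 \<le> t\<close> \<open>t \<le> p\<close> bg
      by (intro mult_left_mono powr_mono2 mult_nonneg_nonneg) (auto simp: zero_le_even_power)
    finally show "(LINT z|\<mu>. z ^ N y) \<le> \<bar>C\<bar> ^ N y * n powr (\<beta> * x y) * real p powr (\<gamma> * x y)"
      by (simp add: t x_def power_even_abs)
  qed
  also have "\<dots> = \<bar>C\<bar> ^ (\<Sum>y\<in>Y'. N y) * n powr (\<beta> * (\<Sum>y\<in>Y'. x y)) * real p powr (\<gamma> * (\<Sum>y\<in>Y'. x y))"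
    using n p by (simp add: prod.distrib power_sum powr_sum sum_distrib_left Y'_def)
  also have sumN: "(\<Sum>y\<in>Y'. N y) = 2 * p"
  proof -
    have "(\<Sum>y\<in>Y'. N y) = (\<Sum>y\<in>Y'. \<Sum>j | j \<in> {..<2 * p} \<and> u j = y. 1)"
      by (simp add: N_def)
    also have "\<dots> = (\<Sum>j<2 * p. 1)" by (rule sum.group) (auto simp: Y'_def)
    finally show ?thesis by simp
  qed
  also have "(\<Sum>y\<in>Y'. x y) = real p - real (card Y')"
  proof -
    have "(\<Sum>y\<in>Y'. x y) = real (\<Sum>y\<in>Y'. N y) / 2 - real (card Y')"
      by (simp add: x_def sum_subtractf sum_divide_distrib)
    then show ?thesis by (simp add: sumN)
  qed
  also have "\<bar>C\<bar> ^ (2 * p) * n powr (\<beta> * (real p - real (card Y'))) * real p powr (\<gamma> * (real p - real (card Y')))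
      \<le> \<bar>C\<bar> ^ (2 * p) * n powr (\<beta> * real m / 2) * real p powr (\<gamma> * real m / 2)"
  proof -
    have "real (2 * p) \<le> real (2 * card Y' + m)" using m unfolding Y'_def of_nat_le_iff .
    then have d: "real p - real (card Y') \<le> real m / 2" by simp
    show ?thesis
      using n p mult_left_mono[OF d bg(1)] mult_left_mono[OF d bg(2)]
      by (intro mult_mono mult_left_mono powr_mono) auto
  qed
  finally show "(\<Prod>y\<in>Y. LINT z|\<mu>. z ^ card {j. j < 2 * p \<and> u j = y})
      \<le> \<bar>C\<bar> ^ (2 * p) * n powr (\<beta> * real m / 2) * real p powr (\<gamma> * real m / 2)"
    by (simp add: N_def)
qed

text \<open>Double counting that turns sums over factors into sums over copies; for each copy the
  inner sum is the one in \<open>sep_kappa\<close> or \<open>sep_b\<close>.\<close>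

lemma sum_card_swap:
  fixes g :: "'f \<Rightarrow> real"
  assumes "finite A" "finite J"
  shows "(\<Sum>f\<in>A. g f * real (card {j \<in> J. P f j})) = (\<Sum>j\<in>J. \<Sum>f | f \<in> A \<and> P f j. g f)"
proof -
  have "(\<Sum>f\<in>A. g f * real (card {j \<in> J. P f j})) = (\<Sum>f\<in>A. \<Sum>j\<in>J. if P f j then g f else 0)"
    using assms(2) by (intro sum.cong refl) (simp add: sum.inter_filter[symmetric])
  also have "\<dots> = (\<Sum>j\<in>J. \<Sum>f\<in>A. if P f j then g f else 0)" by (rule sum.swap)
  also have "\<dots> = (\<Sum>j\<in>J. \<Sum>f | f \<in> A \<and> P f j. g f)"
    using assms(1) by (simp add: sum.inter_filter)
  finally show ?thesis .
qed

lemma floating_count_le: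
  assumes "is_shape G" shows "floating_count G S \<le> card (roles G)"
proof -
  have fin: "finite (roles G)" using assms by (simp add: is_shape_def)
  have "floating_count G S \<le> card (components_on G (roles G - S))"
    unfolding floating_count_def using fin by (intro card_mono) (auto simp: components_on_eq)
  also have "\<dots> \<le> card (roles G - S)"
    unfolding components_on_eq using fin by (intro card_image_le) simp
  also have "\<dots> \<le> card (roles G)" using fin by (intro card_mono) auto
  finally show ?thesis .
qed

text \<open>The squared count is multiplied by the squared moment bound, and the result is a product
  of separator weights over \<open>2 * (p - 1)\<close> inner copies. Each weight is at most
  \<open>Fm\<close>, and the square root gives \<open>Fm ^ (p - 1)\<close>.\<close>

lemma typed_class_bound:
  fixes G :: "('w, 'f) shape" and n c Kp Fm A :: real and \<beta> \<gamma> :: "'f \<Rightarrow> real"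
  assumes G: "cored G" and p: "1 \<le> p" and fin: "\<And>w. w \<in> roles G \<Longrightarrow> finite (I w)"
    and n: "1 \<le> n" and c: "1 \<le> c" and D: "\<And>w. w \<in> roles G \<Longrightarrow> real (card (I w)) \<le> c * n"
    and xs0: "xs0 \<in> typed_walks G I p F L" and A: "0 \<le> A"
    and Kp: "2 * real (card (roles G)) \<le> Kp"
    and Fm: "\<And>S. S \<in> separators G \<Longrightarrow> n powr (- sep_kappa G \<beta> S) *
      real p powr (sep_b G \<gamma> S + Kp * (real (card S) - real (min_separator_size G))) \<le> Fm"
  defines "m \<equiv> \<lambda>f. card {j \<in> {1..<2 * p - 1}. scope G f \<subseteq> roles G - F j - L j}"
  shows "real (card (typed_walks G I p F L)) *
      (A ^ (2 * p) * n powr (\<Sum>f\<in>occs G. \<beta> f * real (m f) / 2) * real p powr (\<Sum>f\<in>occs G. \<gamma> f * real (m f) / 2))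
    \<le> (A * c ^ card (roles G) * 2 ^ (3 * card (roles G) + 2 * (card (roles G))\<^sup>2)) ^ (2 * p) *
      n powr (real p * real (card (roles G))) * Fm ^ (p - 1)"
proof -
  define r where "r = card (roles G)"
  define s where "s = min_separator_size G"
  define M where "M j = roles G - F j - L j" for j
  define J where "J = {1..<2 * p - 1}"
  have shape: "is_shape G" using G by (simp add: cored_def)
  have finocc: "finite (occs G)" and finr: "finite (roles G)" using shape by (auto simp: is_shape_def)
  have xw: "xs0 \<in> walks G I p" using xs0 by (simp add: typed_walks_def)
  have J: "finite J" "card J = 2 * (p - 1)" by (auto simp: J_def)
  have Msep: "M j \<in> separators G" if "j \<in> J" for j
    using middle_in_separators[OF G xw, of j] that xs0 by (auto simp: M_def J_def typed_walks_def)
  have Mge: "s \<le> card (M j)" if "j \<in> J" for j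
    using min_separator_size_le[OF shape Msep[OF that]] by (simp add: s_def)
  have Mle: "card (M j) \<le> r" for j
    unfolding r_def M_def using finr by (intro card_mono) auto
  define X where "X = real (card (typed_walks G I p F L))"
  define b\<beta> where "b\<beta> S = (\<Sum>f | f \<in> occs G \<and> scope G f \<subseteq> S. \<beta> f)" for S
  define b\<gamma> where "b\<gamma> S = (\<Sum>f | f \<in> occs G \<and> scope G f \<subseteq> S. \<gamma> f)" for S
  define fl where "fl j = floating_count G (M j)" for j
  define ex where "ex j = card (M j) - s" for j
  have sum\<beta>: "(\<Sum>f\<in>occs G. \<beta> f * real (m f) / 2) = (\<Sum>j\<in>J. b\<beta> (M j)) / 2"
    using sum_card_swap[OF finocc J(1), of \<beta> "\<lambda>f j. scope G f \<subseteq> M j"]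
    by (simp add: m_def J_def M_def b\<beta>_def sum_divide_distrib[symmetric])
  have sum\<gamma>: "(\<Sum>f\<in>occs G. \<gamma> f * real (m f) / 2) = (\<Sum>j\<in>J. b\<gamma> (M j)) / 2"
    using sum_card_swap[OF finocc J(1), of \<gamma> "\<lambda>f j. scope G f \<subseteq> M j"]
    by (simp add: m_def J_def M_def b\<gamma>_def sum_divide_distrib[symmetric])
  define a where "a = (\<Sum>j<2 * p. card (F j) + card (L j))"
  define e where "e = (\<Sum>j\<in>J. fl j + 2 * r * ex j)"
  have a_eq: "a + (\<Sum>j\<in>J. card (M j)) = 2 * p * r"
    using sum_card_types[OF G p xs0] by (simp add: a_def J_def M_def r_def)
  have X2: "X\<^sup>2 \<le> (c * n) ^ a * real (2 * p) ^ (2 * r + e)"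
    using card_typed_walks_sq_le[OF G p fin D xs0]
    by (simp add: X_def a_def e_def J_def M_def r_def fl_def ex_def s_def)
  \<comment> \<open>The factor \<open>c ^ r\<close> comes from the label sets. In the power of
    \<open>2\<close>, \<open>2 * r + 2 * r\<^sup>2\<close> serves the constant in the base
    \<open>2 * p\<close> through \<open>e_le\<close>, and one further \<open>r\<close> absorbs
    \<open>p ^ (2 * r)\<close>.\<close>
  define Y where "Y = c ^ r * 2 ^ (3 * r + 2 * r\<^sup>2)"
  have Y1: "1 \<le> Y" using c unfolding Y_def
    by (metis mult_mono' one_le_power one_le_numeral mult_1 zero_le_one)
  have e_le: "2 * r + e \<le> (2 * r + 2 * r\<^sup>2) * (2 * p)"
  proof -
    have "e \<le> (\<Sum>j\<in>J. r + 2 * r\<^sup>2)"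
      unfolding e_def
    proof (rule sum_mono)
      fix j
      have "fl j \<le> r" unfolding fl_def r_def by (rule floating_count_le[OF shape])
      moreover have "r * ex j \<le> r * r"
        using Mle[of j] by (intro mult_le_mono2) (simp add: ex_def)
      ultimately show "fl j + 2 * r * ex j \<le> r + 2 * r\<^sup>2"
        unfolding power2_eq_square mult.assoc by linarith
    qed
    also have "\<dots> \<le> (2 * p) * (r + 2 * r\<^sup>2)"
      unfolding sum_constant of_nat_id J(2) by (intro mult_le_mono1) simp
    finally have "2 * r + e \<le> 2 * r * p + (2 * p) * (r + 2 * r\<^sup>2)"
      using p by (intro add_mono) auto
    then show ?thesis by (simp add: algebra_simps)
  qed
  have "(c * n) ^ a \<le> (c ^ r) ^ (2 * p) * n powr (2 * real p * real r - (\<Sum>j\<in>J. real (card (M j))))"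
  proof -
    have "real a = 2 * real p * real r - (\<Sum>j\<in>J. real (card (M j)))"
      using a_eq by (metis add_diff_cancel_right' of_nat_add of_nat_mult of_nat_numeral of_nat_sum)
    moreover have "a \<le> r * (2 * p)" using a_eq by (metis le_add1 mult.commute mult.assoc)
    then have "c ^ a \<le> c ^ (r * (2 * p))"
      using c by (intro power_increasing) auto
    ultimately show ?thesis
      using n by (simp add: power_mult_distrib powr_realpow[symmetric] power_mult mult_right_mono)
  qed
  moreover have "real (2 * p) ^ (2 * r + e) \<le> (2 ^ (3 * r + 2 * r\<^sup>2)) ^ (2 * p) * real p powr real e"
  proof -
    \<comment> \<open>\<open>p \<le> 2 ^ p\<close> makes the polynomial cost of the end copies
      exponential.\<close>
    have "real p ^ (2 * r) \<le> (2 ^ p) ^ (2 * r)"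
      by (intro power_mono) (auto simp: less_imp_le of_nat_less_two_power)
    also have "\<dots> = (2 ^ r) ^ (2 * p)" by (simp add: power_mult[symmetric] mult_ac)
    finally have 1: "real p ^ (2 * r) \<le> (2 ^ r) ^ (2 * p)" .
    have "(2::real) ^ (2 * r + e) \<le> 2 ^ ((2 * r + 2 * r\<^sup>2) * (2 * p))"
      using e_le by (intro power_increasing) auto
    then have 2: "(2::real) ^ (2 * r + e) \<le> (2 ^ (2 * r + 2 * r\<^sup>2)) ^ (2 * p)"
      by (simp only: power_mult)
    have "real (2 * p) ^ (2 * r + e) = 2 ^ (2 * r + e) * (real p ^ (2 * r) * real p ^ e)"
      by (simp add: power_mult_distrib power_add)
    also have "\<dots> \<le> (2 ^ (2 * r + 2 * r\<^sup>2)) ^ (2 * p) * ((2 ^ r) ^ (2 * p) * real p ^ e)"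
      using 1 2 by (intro mult_mono) auto
    also have "\<dots> = (2 ^ (3 * r + 2 * r\<^sup>2)) ^ (2 * p) * real p ^ e"
      by (simp add: power_mult_distrib[symmetric] power_add[symmetric] mult.assoc[symmetric])
    finally show ?thesis using p by (simp add: powr_realpow)
  qed
  ultimately have "(c * n) ^ a * real (2 * p) ^ (2 * r + e)
      \<le> ((c ^ r) ^ (2 * p) * n powr (2 * real p * real r - (\<Sum>j\<in>J. real (card (M j))))) *
        ((2 ^ (3 * r + 2 * r\<^sup>2)) ^ (2 * p) * real p powr real e)"
    using c n by (intro mult_mono) auto
  with X2 have X2': "X\<^sup>2 \<le> Y ^ (2 * p) * (n powr (2 * real p * real r - (\<Sum>j\<in>J. real (card (M j)))) * real p powr real e)"
    by (simp add: Y_def power_mult_distrib mult_ac)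
  define B where "B = A ^ (2 * p) * n powr ((\<Sum>j\<in>J. b\<beta> (M j)) / 2) * real p powr ((\<Sum>j\<in>J. b\<gamma> (M j)) / 2)"
  have sq: "(y powr (z / 2))\<^sup>2 = y powr z" for y z :: real
    by (simp add: power2_eq_square powr_add[symmetric])
  have B2: "B\<^sup>2 = (A ^ (2 * p))\<^sup>2 * (n powr (\<Sum>j\<in>J. b\<beta> (M j)) * real p powr (\<Sum>j\<in>J. b\<gamma> (M j)))"
    by (simp only: B_def power_mult_distrib sq mult.assoc)
  have "(X * B)\<^sup>2 \<le> (Y ^ (2 * p) * (n powr (2 * real p * real r - (\<Sum>j\<in>J. real (card (M j)))) * real p powr real e)) *
      ((A ^ (2 * p))\<^sup>2 * (n powr (\<Sum>j\<in>J. b\<beta> (M j)) * real p powr (\<Sum>j\<in>J. b\<gamma> (M j))))"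
    unfolding power_mult_distrib B2[symmetric] by (intro mult_right_mono X2') simp
  \<comment> \<open>Regrouping by copies: the size of the middle and its \<open>\<beta>\<close> sum
    form \<open>sep_kappa\<close>, the floating count and the \<open>\<gamma>\<close> sum form
    \<open>sep_b\<close>.\<close>
  also have "\<dots> = Y ^ (2 * p) * (A ^ (2 * p))\<^sup>2 *
      (n powr (2 * real p * real r - (\<Sum>j\<in>J. real (card (M j))) + (\<Sum>j\<in>J. b\<beta> (M j))) *
       real p powr (real e + (\<Sum>j\<in>J. b\<gamma> (M j))))"
    by (simp add: powr_add mult_ac)
  also have "\<dots> = Y ^ (2 * p) * (A ^ (2 * p))\<^sup>2 * (n powr (2 * real p * real r) *
      (\<Prod>j\<in>J. n powr (- sep_kappa G \<beta> (M j)) * real p powr (sep_b G \<gamma> (M j) + 2 * real r * real (ex j))))"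
  proof -
    have "2 * real p * real r - (\<Sum>j\<in>J. real (card (M j))) + (\<Sum>j\<in>J. b\<beta> (M j))
        = 2 * real p * real r + (\<Sum>j\<in>J. - sep_kappa G \<beta> (M j))"
      by (simp add: sep_kappa_def b\<beta>_def sum_subtractf)
    moreover have "real e + (\<Sum>j\<in>J. b\<gamma> (M j)) = (\<Sum>j\<in>J. sep_b G \<gamma> (M j) + 2 * real r * real (ex j))"
      by (simp add: e_def sep_b_def b\<gamma>_def sum.distrib fl_def)
    ultimately show ?thesis
      using n p J(1) by (simp only: powr_add) (simp add: powr_sum prod.distrib powr_add mult_ac)
  qed
  also have "\<dots> \<le> (Y ^ (2 * p))\<^sup>2 * (A ^ (2 * p))\<^sup>2 * (n powr (2 * real p * real r) * (\<Prod>j\<in>J. Fm))"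
  proof (intro mult_mono mult_left_mono prod_mono conjI)
    \<comment> \<open>A deliberate loss that turns the right-hand side into a perfect
      square.\<close>
    show "Y ^ (2 * p) \<le> (Y ^ (2 * p))\<^sup>2"
      using one_le_power[OF Y1, of "2 * p"] by (simp add: power2_eq_square)
    fix j assume j: "j \<in> J"
    have "2 * real r * real (ex j) \<le> Kp * (real (card (M j)) - real s)"
      using Kp Mge[OF j] by (auto simp: r_def ex_def of_nat_diff intro!: mult_right_mono)
    then have "n powr (- sep_kappa G \<beta> (M j)) * real p powr (sep_b G \<gamma> (M j) + 2 * real r * real (ex j))
        \<le> n powr (- sep_kappa G \<beta> (M j)) * real p powr (sep_b G \<gamma> (M j) + Kp * (real (card (M j)) - real s))"
      using p by (intro mult_left_mono powr_mono) auto
    also have "\<dots> \<le> Fm" using Fm[OF Msep[OF j]] by (simp add: s_def)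
    finally show "n powr (- sep_kappa G \<beta> (M j)) * real p powr (sep_b G \<gamma> (M j) + 2 * real r * real (ex j)) \<le> Fm" .
  qed (use n Y1 in \<open>auto intro!: prod_nonneg mult_nonneg_nonneg\<close>)
  also have "\<dots> = ((A * Y) ^ (2 * p) * n powr (real p * real r) * Fm ^ (p - 1))\<^sup>2"
  proof -
    have "(\<Prod>j\<in>J. Fm) = (Fm ^ (p - 1))\<^sup>2"
      by (simp add: J(2) power_mult[symmetric] mult.commute)
    moreover have "n powr (2 * real p * real r) = (n powr (real p * real r))\<^sup>2"
      by (simp add: power2_eq_square powr_add[symmetric] mult.assoc)
    ultimately show ?thesis by (simp only: power_mult_distrib mult_ac)
  qed
  finally have "X * B \<le> (A * Y) ^ (2 * p) * n powr (real p * real r) * Fm ^ (p - 1)"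
  proof (rule power2_le_imp_le)
    have "0 \<le> Fm" using Fm[OF roles_in_separators] by (meson order_trans mult_nonneg_nonneg powr_ge_zero)
    then show "0 \<le> (A * Y) ^ (2 * p) * n powr (real p * real r) * Fm ^ (p - 1)"
      using A Y1 by simp
  qed
  then show ?thesis
    unfolding sum\<beta> sum\<gamma> X_def B_def Y_def r_def by (simp only: mult.assoc)
qed

text \<open>\<open>Fm\<close> stays a parameter: the trace bound inserts the largest separator
  weight, the norm bound an explicit majorant.\<close>

lemma expected_trace_le:
  fixes G :: "('w, 'f) shape" and n c Kp Fm :: real and \<beta> \<gamma> Ce :: "'f \<Rightarrow> real" and I :: "'w \<Rightarrow> 'l set"
  assumes G: "cored G" and "prob_space M" and p: "1 \<le> p"
    and fin: "\<And>w. w \<in> roles G \<Longrightarrow> finite (I w)"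
    and n: "1 \<le> n" and c: "1 \<le> c" and D: "\<And>w. w \<in> roles G \<Longrightarrow> real (card (I w)) \<le> c * n"
    and indep: "prob_space.indep_vars M (\<lambda>_. borel) (\<lambda>(f, y). \<xi> f y) (SIGMA f:occs G. PiE (scope G f) I)"
    and law: "\<And>f y. f \<in> occs G \<Longrightarrow> y \<in> PiE (scope G f) I \<Longrightarrow> distr M borel (\<xi> f y) = L f"
    and sym: "\<And>f. f \<in> occs G \<Longrightarrow> symmetric_unit_variance (L f)"
    and bg: "\<And>f. f \<in> occs G \<Longrightarrow> 0 \<le> \<beta> f \<and> 0 \<le> \<gamma> f"
    and mom: "\<And>f t. f \<in> occs G \<Longrightarrow> 1 \<le> t \<Longrightarrow> t \<le> p \<Longrightarrow> integrable (L f) (\<lambda>z. \<bar>z\<bar> ^ (2 * t)) \<and>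
      (LINT z|L f. \<bar>z\<bar> ^ (2 * t)) \<le> Ce f ^ (2 * t) * n powr (\<beta> f * (real t - 1)) * real t powr (\<gamma> f * (real t - 1))"
    and Kp: "2 * real (card (roles G)) \<le> Kp"
    and Fm: "\<And>S. S \<in> separators G \<Longrightarrow> n powr (- sep_kappa G \<beta> S) *
      real p powr (sep_b G \<gamma> S + Kp * (real (card S) - real (min_separator_size G))) \<le> Fm"
  shows "integrable M (\<lambda>\<omega>. shape_trace_power G I (shape_matrix G I (\<lambda>f y. \<xi> f y \<omega>)) p)" (is ?int)
    and "(LINT \<omega>|M. shape_trace_power G I (shape_matrix G I (\<lambda>f y. \<xi> f y \<omega>)) p)
      \<le> (4 ^ card (roles G) * ((\<Prod>f\<in>occs G. \<bar>Ce f\<bar>) * c ^ card (roles G) *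
            2 ^ (3 * card (roles G) + 2 * (card (roles G))\<^sup>2))) ^ (2 * p) *
        n powr (real p * real (card (roles G))) * Fm ^ (p - 1)" (is ?bound)
proof -
  define r where "r = card (roles G)"
  define A where "A = (\<Prod>f\<in>occs G. \<bar>Ce f\<bar>)"
  define K where "K = A * c ^ r * 2 ^ (3 * r + 2 * r\<^sup>2)"
  have shape: "is_shape G" using G by (simp add: cored_def)
  have finocc: "finite (occs G)" and finr: "finite (roles G)" using shape by (auto simp: is_shape_def)
  have probL: "prob_space (L f)" "sets (L f) = sets borel" "distr (L f) borel uminus = L f" if "f \<in> occs G" for f
    using sym[OF that] by (auto simp: symmetric_unit_variance_def)
  have intk: "integrable (L f) (\<lambda>z. z ^ k)" if "f \<in> occs G" "k \<le> 2 * p" for f k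
    using integrable_power_le[OF probL(1,2)[OF that(1)] _ that(2)] mom[OF that(1) p] by simp
  have finc: "finite (closed_lists G I p)"
  proof (rule finite_subset)
    show "closed_lists G I p \<subseteq> {xs. set xs \<subseteq> PiE (roles G) I \<and> length xs = 2 * p}"
      by (auto simp: closed_lists_def)
    show "finite {xs. set xs \<subseteq> PiE (roles G) I \<and> length xs = 2 * p}"
      using finr fin by (intro finite_lists_length_eq finite_PiE) auto
  qed
  have finw: "finite (walks G I p)" by (rule finite_walks[OF shape fin])
  define w where "w xs \<omega> = (\<Prod>x\<leftarrow>xs. factor_weight G (\<lambda>f y. \<xi> f y \<omega>) x)" for xs \<omega>
  define E where "E xs = (\<Prod>f\<in>occs G. \<Prod>y\<in>PiE (scope G f) I.
      LINT z|L f. z ^ card {j. j < 2 * p \<and> restrict (xs ! j) (scope G f) = y})" for xs :: "('w \<Rightarrow> 'l) list"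
  have w: "integrable M (w xs)" "(LINT \<omega>|M. w xs \<omega>) = E xs" if "xs \<in> closed_lists G I p" for xs
  proof -
    have xs: "set xs \<subseteq> PiE (roles G) I" "length xs = 2 * p" using that by (auto simp: closed_lists_def)
    show "integrable M (w xs)"
      unfolding w_def using intk xs(2) by (intro expectation_walk(1)[OF assms(2) shape fin indep law _ xs(1)]) auto
    show "(LINT \<omega>|M. w xs \<omega>) = E xs"
      unfolding w_def E_def xs(2)[symmetric] using intk xs(2)
      by (intro expectation_walk(2)[OF assms(2) shape fin indep law _ xs(1)]) auto
  qed
  have trace: "shape_trace_power G I (shape_matrix G I (\<lambda>f y. \<xi> f y \<omega>)) p = (\<Sum>xs\<in>closed_lists G I p. w xs \<omega>)" for \<omega>
    unfolding w_def by (rule shape_trace_power_eq[OF shape fin p])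
  show ?int unfolding trace by (intro Bochner_Integration.integrable_sum w)
  have finY: "finite (PiE (scope G f) I)" if "f \<in> occs G" for f
    using shape_scope[OF shape that] fin by (intro finite_PiE) auto
  have im: "(\<lambda>j. restrict (xs ! j) (scope G f)) ` {..<2 * p} \<subseteq> PiE (scope G f) I"
    if "xs \<in> walks G I p" "f \<in> occs G" for f xs
    using walks_nth[OF that(1)] shape_scope(1)[OF shape that(2)] by fastforce
  have bound: "0 \<le> E xs \<and> E xs \<le> A ^ (2 * p) *
      n powr (\<Sum>f\<in>occs G. \<beta> f * real (card {j \<in> {1..<2 * p - 1}. scope G f \<subseteq> roles G - F j - L' j}) / 2) *
      real p powr (\<Sum>f\<in>occs G. \<gamma> f * real (card {j \<in> {1..<2 * p - 1}. scope G f \<subseteq> roles G - F j - L' j}) / 2)"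
    (is "_ \<and> _ \<le> _ * n powr (\<Sum>f\<in>_. _ * real (?m f) / 2) * _")
    if xs: "xs \<in> typed_walks G I p F L'" for xs F L'
  proof -
    have xw: "xs \<in> walks G I p" using xs by (simp add: typed_walks_def)
    have ev: "even (card {j. j < 2 * p \<and> restrict (xs ! j) (scope G f) = y})" if "f \<in> occs G" for f y
      using xw that by (simp add: walks_def)
    note pm = prod_moments_le[OF probL(1) finY im[OF xw] ev conjunct2[OF mom] n p conjunct1[OF bg] conjunct2[OF bg] card_values_ge[OF G xs]]
    have "E xs \<le> (\<Prod>f\<in>occs G. \<bar>Ce f\<bar> ^ (2 * p) * n powr (\<beta> f * real (?m f) / 2) * real p powr (\<gamma> f * real (?m f) / 2))"
      unfolding E_def by (intro prod_mono conjI pm)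
    also have "\<dots> = A ^ (2 * p) * n powr (\<Sum>f\<in>occs G. \<beta> f * real (?m f) / 2) * real p powr (\<Sum>f\<in>occs G. \<gamma> f * real (?m f) / 2)"
      using n p finocc by (simp add: prod.distrib powr_sum A_def prod_power_distrib)
    finally show ?thesis
      unfolding E_def by (intro conjI prod_nonneg pm(1))
  qed
  have self_typed: "xs \<in> typed_walks G I p (firsts G xs) (lasts G xs)" if "xs \<in> walks G I p" for xs
    using that by (simp add: typed_walks_def)
  have E0: "E xs = 0" if xs: "xs \<in> closed_lists G I p" "xs \<notin> walks G I p" for xs
  proof -
    obtain f q where f: "f \<in> occs G" "odd (card {k. k < 2 * p \<and> restrict (xs ! k) (scope G f) = q})"
      using closed_lists_subset_walks[OF xs(1) p] xs(2) by blast
    have "{k. k < 2 * p \<and> restrict (xs ! k) (scope G f) = q} \<noteq> {}"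
      using f(2) by (metis card.empty even_zero)
    then obtain k where k: "k < 2 * p" "restrict (xs ! k) (scope G f) = q" by blast
    have "xs ! k \<in> PiE (roles G) I"
      using xs(1) k(1) nth_mem[of k xs] by (auto simp: closed_lists_def simp del: nth_mem)
    then have "q \<in> PiE (scope G f) I"
      using k(2) shape_scope(1)[OF shape f(1)] by fastforce
    then show ?thesis
      unfolding E_def using f odd_moment_zero[OF probL(2,3)[OF f(1)] f(2)] finY finocc
      by (auto intro!: prod_zero bexI[of _ f] bexI[of _ q])
  qed
  define ty where "ty xs = (restrict (firsts G xs) {..<2 * p}, restrict (lasts G xs) {..<2 * p})" for xs :: "('w \<Rightarrow> 'l) list"
  define T where "T = PiE {..<2 * p} (\<lambda>_. Pow (roles G)) \<times> PiE {..<2 * p} (\<lambda>_. Pow (roles G))"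
  have finT: "finite T" unfolding T_def using finr by (intro finite_cartesian_product finite_PiE) auto
  \<comment> \<open>Each of the \<open>2 * p\<close> copies has two subsets of the roles as its
    type, which gives the factor \<open>4 ^ r\<close> per copy.\<close>
  have cardT: "real (card T) = (4 ^ r) ^ (2 * p)"
  proof -
    have "card T = (2 ^ r) ^ (2 * p) * (2 ^ r) ^ (2 * p)"
      unfolding T_def r_def using finr by (simp add: card_cartesian_product card_PiE card_Pow)
    then show ?thesis by (simp add: power_mult_distrib[symmetric])
  qed
  define Z where "Z = K ^ (2 * p) * n powr (real p * real r) * Fm ^ (p - 1)"
  have Z0: "0 \<le> Z"
  proof -
    have "0 \<le> Fm" using Fm[OF roles_in_separators] by (meson order_trans mult_nonneg_nonneg powr_ge_zero)
    then show ?thesis using c by (simp add: Z_def K_def A_def prod_nonneg zero_le_even_power)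
  qed
  have per_type: "(\<Sum>xs | xs \<in> walks G I p \<and> ty xs = t. E xs) \<le> Z" if t: "t \<in> T" for t
  proof -
    obtain F L' where FL: "t = (F, L')" "F \<in> extensional {..<2 * p}" "L' \<in> extensional {..<2 * p}"
      using t by (auto simp: T_def PiE_def)
    have eq: "{xs. xs \<in> walks G I p \<and> ty xs = t} = typed_walks G I p F L'"
      unfolding FL(1) ty_def typed_walks_def
      using FL(2,3) by (auto simp: fun_eq_iff restrict_def extensional_def)
    show ?thesis
    proof (cases "typed_walks G I p F L' = {}")
      case True
      then show ?thesis unfolding eq using Z0 by simp
    next
      case False
      then obtain xs0 where xs0: "xs0 \<in> typed_walks G I p F L'" by blast
      have A0: "0 \<le> A" by (simp add: A_def prod_nonneg)
      have "sum E (typed_walks G I p F L') \<le> real (card (typed_walks G I p F L')) * (A ^ (2 * p) *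
        n powr (\<Sum>f\<in>occs G. \<beta> f * real (card {j \<in> {1..<2 * p - 1}. scope G f \<subseteq> roles G - F j - L' j}) / 2) *
        real p powr (\<Sum>f\<in>occs G. \<gamma> f * real (card {j \<in> {1..<2 * p - 1}. scope G f \<subseteq> roles G - F j - L' j}) / 2))"
        by (rule sum_bounded_above) (use bound in blast)
      also have "\<dots> \<le> Z"
        unfolding Z_def K_def r_def by (rule typed_class_bound[OF G p fin n c D xs0 A0 Kp Fm])
      finally show ?thesis unfolding eq .
    qed
  qed
  have "(LINT \<omega>|M. shape_trace_power G I (shape_matrix G I (\<lambda>f y. \<xi> f y \<omega>)) p) = (\<Sum>xs\<in>closed_lists G I p. E xs)"
    unfolding trace using w by (simp add: Bochner_Integration.integral_sum)
  also have "\<dots> = (\<Sum>xs\<in>closed_lists G I p \<inter> walks G I p. E xs)"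
    by (rule sum.mono_neutral_right) (use finc E0 in auto)
  \<comment> \<open>All multiplicities along a walk are even, so each term is nonnegative and the
    range may be enlarged.\<close>
  also have "\<dots> \<le> (\<Sum>xs\<in>walks G I p. E xs)"
    using finw bound[OF self_typed] by (intro sum_mono2) auto
  also have "\<dots> = (\<Sum>t\<in>T. \<Sum>xs | xs \<in> walks G I p \<and> ty xs = t. E xs)"
  proof (rule sum.group[symmetric])
    show "ty ` walks G I p \<subseteq> T"
      by (auto simp: T_def ty_def firsts_def lasts_def)
  qed (use finw finT in auto)
  also have "\<dots> \<le> (\<Sum>t\<in>T. Z)" by (intro sum_mono per_type)
  also have "\<dots> = (4 ^ r * K) ^ (2 * p) * n powr (real p * real r) * Fm ^ (p - 1)"
    by (simp add: cardT Z_def power_mult_distrib)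
  finally show ?bound by (simp only: K_def A_def r_def)
qed

section \<open>Norm bounds\<close>

lemma polylog_le_power:
  fixes a d C :: real
  assumes "0 < d" "0 < C"
  shows "\<forall>\<^sub>F n in sequentially. (C * ln (real n)) powr a \<le> real n powr d"
  using assms by real_asymp

text \<open>The left-hand side is the term of the constant sequence \<open>S0\<close>, and all other
  terms are nonnegative.\<close>

lemma power_le_sum_sequences:
  fixes \<kappa> b d :: "'s \<Rightarrow> real"
  assumes "finite T" "S0 \<in> T" "0 < n" "0 < q"
  shows "n powr x * (n powr (- \<kappa> S0) * q powr (b S0 + K * d S0)) ^ (p - 1)
    \<le> (\<Sum>S \<in> PiE {1..p - 1} (\<lambda>_. T). n powr (x - (\<Sum>k=1..p - 1. \<kappa> (S k))) *
         q powr ((\<Sum>k=1..p - 1. b (S k)) + K * (\<Sum>k=1..p - 1. d (S k))))"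
    (is "_ \<le> (\<Sum>S\<in>_. ?g S)")
proof -
  define S where "S = restrict (\<lambda>_. S0) {1..p - 1}"
  have c: "(\<Sum>k=1..p - 1. h (S k)) = real (p - 1) * h S0" for h :: "'s \<Rightarrow> real"
    by (simp add: S_def)
  have pw: "y powr (real m * z) = (y powr z) ^ m" if "0 < y" for y z :: real and m
    using that by (simp add: powr_powr[symmetric] powr_realpow mult.commute[of "real m"])
  have "?g S = n powr (x + real (p - 1) * (- \<kappa> S0)) * q powr (real (p - 1) * (b S0 + K * d S0))"
    unfolding c by (simp add: algebra_simps)
  also have "\<dots> = n powr x * (n powr (- \<kappa> S0) * q powr (b S0 + K * d S0)) ^ (p - 1)"
    unfolding powr_add[of n] pw[OF assms(3)] pw[OF assms(4)] by (simp add: power_mult_distrib)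
  finally have "n powr x * (n powr (- \<kappa> S0) * q powr (b S0 + K * d S0)) ^ (p - 1) = ?g S" by simp
  also have "\<dots> \<le> (\<Sum>S \<in> PiE {1..p - 1} (\<lambda>_. T). ?g S)"
    by (rule member_le_sum) (use assms in \<open>auto simp: S_def intro!: finite_PiE\<close>)
  finally show ?thesis .
qed

text \<open>Where \<open>X\<close> exceeds \<open>a\<close>, the ratio \<open>X / a\<close> is at
  most its own \<open>N\<close>-th power, so \<open>X\<close> is bounded pointwise by
  \<open>a + a * (T / a ^ N)\<close>. This gives integrability and the mean at once; the tail is
  Markov's inequality for \<open>T\<close>.\<close>

lemma norm_bounds_from_moment:
  fixes X T :: "'a \<Rightarrow> real"
  assumes "prob_space M" and X: "X \<in> borel_measurable M" "\<And>\<omega>. 0 \<le> X \<omega>"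
    and T: "\<And>\<omega>. X \<omega> ^ N \<le> T \<omega>" "integrable M T" "(LINT \<omega>|M. T \<omega>) \<le> a ^ N"
    and a: "0 < a" and N: "1 \<le> N"
  shows "integrable M X" "(LINT \<omega>|M. X \<omega>) \<le> 2 * a"
    and "\<And>c. 0 < c \<Longrightarrow> measure M {\<omega> \<in> space M. X \<omega> > c} \<le> (a / c) ^ N"
proof -
  interpret prob_space M by fact
  have T0: "0 \<le> T \<omega>" for \<omega> using T(1)[of \<omega>] X(2)[of \<omega>] by (meson order_trans zero_le_power)
  have le: "X \<omega> \<le> a + a * (T \<omega> / a ^ N)" for \<omega>
  proof (cases "X \<omega> \<le> a")
    case True
    then show ?thesis using a T0[of \<omega>] by (simp add: add_increasing2)
  next
    case False
    then have "1 \<le> X \<omega> / a" using a by simp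
    then have "X \<omega> / a \<le> (X \<omega> / a) ^ N" using N by (intro self_le_power) auto
    also have "\<dots> \<le> T \<omega> / a ^ N"
      using T(1)[of \<omega>] a by (simp add: power_divide divide_right_mono)
    finally have "a * (X \<omega> / a) \<le> a * (T \<omega> / a ^ N)" using a by (intro mult_left_mono) auto
    then show ?thesis using a by simp
  qed
  have intb: "integrable M (\<lambda>\<omega>. a + a * (T \<omega> / a ^ N))" using T(2) by simp
  show int: "integrable M X"
    by (rule Bochner_Integration.integrable_bound[OF intb X(1)])
      (use le X(2) in \<open>auto intro!: AE_I2 order_trans[OF _ abs_ge_self]\<close>)
  have "(LINT \<omega>|M. X \<omega>) \<le> (LINT \<omega>|M. a + a * (T \<omega> / a ^ N))"
    by (rule integral_mono[OF int intb le])
  also have "\<dots> = a + a * ((LINT \<omega>|M. T \<omega>) / a ^ N)"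
    using T(2) by (simp add: prob_space)
  also have "\<dots> \<le> a + a * 1"
    using T(3) a by (intro add_left_mono mult_left_mono) auto
  finally show "(LINT \<omega>|M. X \<omega>) \<le> 2 * a" by simp
  show "measure M {\<omega> \<in> space M. X \<omega> > c} \<le> (a / c) ^ N" if c: "0 < c" for c
  proof -
    have Tm: "T \<in> borel_measurable M" using T(2) by simp
    have "c ^ N \<le> T \<omega>" if "X \<omega> > c" for \<omega>
      using T(1)[of \<omega>] power_mono[of c "X \<omega>" N] that c by linarith
    then have "measure M {\<omega> \<in> space M. X \<omega> > c} \<le> measure M {\<omega> \<in> space M. T \<omega> \<ge> c ^ N}"
      using Tm by (intro finite_measure_mono) auto
    also have "\<dots> \<le> (LINT \<omega>|M. T \<omega>) / c ^ N"
      using T0 c T(2) by (intro integral_Markov_inequality_measure[where A = "space M"]) auto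
    also have "\<dots> \<le> a ^ N / c ^ N" using T(3) c by (intro divide_right_mono) auto
    finally show ?thesis by (simp add: power_divide)
  qed
qed

lemma borel_measurable_shape_matrix:
  assumes "is_shape G"
    and "\<And>f y. f \<in> occs G \<Longrightarrow> y \<in> PiE (scope G f) I \<Longrightarrow> \<xi> f y \<in> borel_measurable M"
  shows "(\<lambda>\<omega>. shape_matrix G I (\<lambda>f y. \<xi> f y \<omega>) i j) \<in> borel_measurable M"
proof -
  have "\<xi> f (restrict x (scope G f)) \<in> borel_measurable M" if "x \<in> PiE (roles G) I" "f \<in> occs G" for x f
    using shape_scope(1)[OF assms(1) that(2)] that(1) by (intro assms(2)[OF that(2)]) auto
  then show ?thesis
    unfolding shape_matrix_def by (intro borel_measurable_sum borel_measurable_times borel_measurable_prod) auto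
qed

lemma shape_op_norm_power_le_trace:
  assumes "is_shape G" "\<And>w. w \<in> roles G \<Longrightarrow> finite (I w)" "0 < q"
  shows "shape_op_norm G I H ^ (2 * (2 * q)) \<le> shape_trace_power G I H (2 * q)"
    and "0 \<le> shape_op_norm G I H"
proof -
  have "finite (label_tuples I (lbdry G))" "finite (label_tuples I (rbdry G))"
    using assms(1,2) by (auto simp: is_shape_def intro!: finite_label_tuples)
  from op_norm_power_le_trace[OF this assms(3), of H] op_norm_nonneg[OF this, of H]
  show "shape_op_norm G I H ^ (2 * (2 * q)) \<le> shape_trace_power G I H (2 * q)"
    "0 \<le> shape_op_norm G I H"
    by (simp_all add: shape_op_norm_def shape_trace_power_def Let_def)
qed

theorem proposition5p4:
  fixes G Gc :: "('w, 'f) shape"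
    and I :: "nat \<Rightarrow> 'w \<Rightarrow> 'l set"
    and cl cu :: "'w \<Rightarrow> real"
    and M :: "nat \<Rightarrow> 'a measure"
    and L :: "nat \<Rightarrow> 'f \<Rightarrow> real measure"
    and \<xi> :: "nat \<Rightarrow> 'f \<Rightarrow> ('w \<Rightarrow> 'l) \<Rightarrow> 'a \<Rightarrow> real"
    and C0 :: real
    and \<beta> \<gamma> Ce :: "'f \<Rightarrow> real"
    and Hc :: "nat \<Rightarrow> 'a \<Rightarrow> 'l list \<Rightarrow> 'l list \<Rightarrow> real"
    and r s :: nat
    and \<kappa> b :: "'w set \<Rightarrow> real"
    and K' \<kappa>min bmw :: real
  assumes shape: "is_shape G"
    and size_consts: "\<forall>x\<in>roles G. 0 < cl x \<and> 0 < cu x"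
    and sizes: "\<forall>n\<ge>1. \<forall>x\<in>roles G. finite (I n x) \<and>
          cl x * real n \<le> real (card (I n x)) \<and> real (card (I n x)) \<le> cu x * real n"
    and arrays: "\<forall>n\<ge>1. independent_factor_arrays G (I n) (M n) (L n) (\<xi> n)"
    and laws: "\<forall>n\<ge>1. \<forall>f\<in>occs G. symmetric_unit_variance (L n f)"
    and C0_pos: "C0 > 0"
    and exponents: "\<forall>f\<in>occs G. 0 \<le> \<beta> f \<and> 0 \<le> \<gamma> f"
    and moments: "\<forall>\<^sub>F n in sequentially. \<forall>f\<in>occs G. \<forall>t::nat.
          1 \<le> t \<and> real t \<le> C0 * ln (real n) \<longrightarrow>
            integrable (L n f) (\<lambda>z. \<bar>z\<bar> ^ (2 * t)) \<and>
            (LINT z|L n f. \<bar>z\<bar> ^ (2 * t))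
              \<le> Ce f ^ (2 * t) * real n powr (\<beta> f * (real t - 1)) * real t powr (\<gamma> f * (real t - 1))"
    and Gc: "Gc = core G"
    and Hc: "Hc = (\<lambda>n \<omega>. shape_matrix Gc (I n) (\<lambda>f y. \<xi> n f y \<omega>))"
    and r: "r = card (roles Gc)"
    and s: "s = min_separator_size Gc"
    and \<kappa>: "\<kappa> = sep_kappa Gc \<beta>"
    and b: "b = sep_b Gc \<gamma>"
    and K': "K' = 3 * (real r)\<^sup>2 + 11 * real r + 2"
    and \<kappa>min: "\<kappa>min = Min (\<kappa> ` separators Gc)"
    and bmw: "bmw = Max (b ` {S \<in> separators Gc. \<kappa> S = \<kappa>min})"
  shows "(\<exists>C::real. \<forall>\<^sub>F n in sequentially. \<forall>p::nat. 2 \<le> p \<and> real p \<le> C0 * ln (real n) \<longrightarrow>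
           integrable (M n) (\<lambda>\<omega>. shape_trace_power Gc (I n) (Hc n \<omega>) p) \<and>
           (LINT \<omega>|M n. shape_trace_power Gc (I n) (Hc n \<omega>) p)
             \<le> C ^ (2 * p) *
               (\<Sum>S \<in> PiE {1..p - 1} (\<lambda>_. separators Gc).
                  real n powr (real p * real r - (\<Sum>k=1..p - 1. \<kappa> (S k))) *
                  real p powr ((\<Sum>k=1..p - 1. b (S k))
                               + K' * (\<Sum>k=1..p - 1. real (card (S k)) - real s)))) \<and>
         ((\<forall>S\<in>separators Gc. \<kappa> S = \<kappa>min \<longrightarrow> card S = s) \<longrightarrow>
           (\<exists>C::real. \<forall>\<^sub>F n in sequentially.
              integrable (M n) (\<lambda>\<omega>. shape_op_norm Gc (I n) (Hc n \<omega>)) \<and>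
              (LINT \<omega>|M n. shape_op_norm Gc (I n) (Hc n \<omega>))
                \<le> C * real n powr ((real r - \<kappa>min) / 2) * ln (real n) powr (bmw / 2)) \<and>
           (\<forall>A>0. \<exists>CA::real. \<forall>\<^sub>F n in sequentially.
              measure (M n) {\<omega> \<in> space (M n). shape_op_norm Gc (I n) (Hc n \<omega>)
                  > CA * real n powr ((real r - \<kappa>min) / 2) * ln (real n) powr (bmw / 2)}
                \<le> real n powr (- A)))"
proof -
  have shp: "is_shape Gc" and cor: "cored Gc"
    using cored_core[OF shape] by (simp_all add: Gc cored_def)
  have sub: "roles Gc \<subseteq> roles G" "occs Gc \<subseteq> occs G" "scope Gc = scope G"
    by (auto simp: Gc core_roles_def used_roles_def)
  have finG: "finite (roles G)" using shape by (simp add: is_shape_def)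
  have fin: "finite (I n w)" if "1 \<le> n" "w \<in> roles Gc" for n w
    using sizes that sub by blast
  define T where "T = separators Gc"
  have T: "finite T" "T \<noteq> {}" using finite_separators[OF shp] roles_in_separators[of Gc] by (auto simp: T_def)
  \<comment> \<open>One constant for all roles; the summand \<open>1\<close> makes it at least
    \<open>1\<close>, so that its powers increase.\<close>
  define c where "c = 1 + (\<Sum>x\<in>roles G. cu x)"
  have "0 \<le> (\<Sum>x\<in>roles G. cu x)" by (rule sum_nonneg) (use size_consts in force)
  then have c1: "1 \<le> c" by (simp add: c_def)
  have sizec: "real (card (I n w)) \<le> c * real n" if "1 \<le> n" "w \<in> roles Gc" for n w
  proof -
    have "cu w \<le> (\<Sum>x\<in>roles G. cu x)"
      using that sub finG size_consts by (intro member_le_sum) (auto intro: less_imp_le)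
    then have "cu w * real n \<le> c * real n" by (intro mult_right_mono) (auto simp: c_def)
    then show ?thesis using sizes that sub by (meson order_trans subsetD)
  qed
  \<comment> \<open>The added \<open>1\<close> keeps \<open>K\<close> positive even if some
    \<open>Ce f\<close> vanishes; the norm bounds divide by a multiple of \<open>K\<close>.\<close>
  define K where "K = 4 ^ r * ((\<Prod>f\<in>occs Gc. \<bar>Ce f\<bar>) * c ^ r * 2 ^ (3 * r + 2 * r\<^sup>2)) + 1"
  have K1: "1 \<le> K" using c1 by (simp add: K_def prod_nonneg)
  define g where "g n p S = real n powr (- \<kappa> S) * real p powr (b S + K' * (real (card S) - real s))"
    for n p :: nat and S
  \<comment> \<open>The count of walks produces the exponent \<open>2 * r\<close> per unit of
    excess; here it is compared with \<open>K'\<close>.\<close>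
  have K'r: "2 * real r \<le> K'"
    unfolding K' using zero_le_power2[of "real r"] of_nat_0_le_iff[of r] by linarith
  have pspace: "prob_space (M n)" if "1 \<le> n" for n
    using arrays that by (auto simp: independent_factor_arrays_def)
  have indep: "prob_space.indep_vars (M n) (\<lambda>_. borel) (\<lambda>(f, y). \<xi> n f y) (SIGMA f:occs Gc. PiE (scope Gc f) (I n))"
    if "1 \<le> n" for n
  proof (rule prob_space.indep_vars_subset[OF pspace[OF that]])
    show "prob_space.indep_vars (M n) (\<lambda>_. borel) (\<lambda>(f, y). \<xi> n f y) (SIGMA f:occs G. PiE (scope G f) (I n))"
      using arrays that by (auto simp: independent_factor_arrays_def)
  qed (use sub in auto)
  have law: "distr (M n) borel (\<xi> n f y) = L n f" if "1 \<le> n" "f \<in> occs Gc" "y \<in> PiE (scope Gc f) (I n)" for n f y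
    using arrays that sub by (auto simp: independent_factor_arrays_def)
  have key: "\<forall>\<^sub>F n in sequentially. \<forall>p Fm. 1 \<le> p \<and> real p \<le> C0 * ln (real n) \<and> (\<forall>S\<in>T. g n p S \<le> Fm) \<longrightarrow>
      integrable (M n) (\<lambda>\<omega>. shape_trace_power Gc (I n) (Hc n \<omega>) p) \<and>
      (LINT \<omega>|M n. shape_trace_power Gc (I n) (Hc n \<omega>) p) \<le> K ^ (2 * p) * real n powr (real p * real r) * Fm ^ (p - 1)"
    using moments eventually_ge_at_top[of 1]
  proof eventually_elim
    case (elim n)
    note n = elim(2)
    show ?case
    proof (intro allI impI, elim conjE)
      fix p Fm
      assume p: "1 \<le> p" "real p \<le> C0 * ln (real n)" and Fm: "\<forall>S\<in>T. g n p S \<le> Fm"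
      have sym: "symmetric_unit_variance (L n f)" if "f \<in> occs Gc" for f
        using laws n that sub by blast
      have bg: "0 \<le> \<beta> f \<and> 0 \<le> \<gamma> f" if "f \<in> occs Gc" for f
        using exponents that sub by blast
      have mom: "integrable (L n f) (\<lambda>z. \<bar>z\<bar> ^ (2 * t)) \<and> (LINT z|L n f. \<bar>z\<bar> ^ (2 * t))
          \<le> Ce f ^ (2 * t) * real n powr (\<beta> f * (real t - 1)) * real t powr (\<gamma> f * (real t - 1))"
        if "f \<in> occs Gc" "1 \<le> t" "t \<le> p" for f t
      proof -
        have "real t \<le> C0 * ln (real n)" using that(3) p(2) by (meson of_nat_le_iff order_trans)
        then show ?thesis using elim(1) that sub by blast
      qed
      have Fm': "real n powr (- sep_kappa Gc \<beta> S) * real p powr (sep_b Gc \<gamma> S +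
          K' * (real (card S) - real (min_separator_size Gc))) \<le> Fm" if "S \<in> separators Gc" for S
        using Fm that by (simp add: g_def T_def \<kappa> b s)
      have n1: "1 \<le> real n" using n by simp
      note tr = expected_trace_le[OF cor pspace[OF n] p(1) fin[OF n] n1 c1 sizec[OF n] indep[OF n]
          law[OF n] sym bg mom K'r[unfolded r] Fm', folded r]
      have "0 \<le> Fm"
      proof -
        obtain S where "S \<in> T" using T by blast
        then have "g n p S \<le> Fm" using Fm by blast
        then show ?thesis by (rule order_trans[rotated]) (simp add: g_def)
      qed
      moreover have "(4 ^ r * ((\<Prod>f\<in>occs Gc. \<bar>Ce f\<bar>) * c ^ r * 2 ^ (3 * r + 2 * r\<^sup>2))) ^ (2 * p) \<le> K ^ (2 * p)"
        using c1 by (intro power_mono) (auto simp: K_def prod_nonneg)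
      ultimately have "(4 ^ r * ((\<Prod>f\<in>occs Gc. \<bar>Ce f\<bar>) * c ^ r * 2 ^ (3 * r + 2 * r\<^sup>2))) ^ (2 * p) *
          real n powr (real p * real r) * Fm ^ (p - 1) \<le> K ^ (2 * p) * real n powr (real p * real r) * Fm ^ (p - 1)"
        by (intro mult_right_mono) auto
      with tr show "integrable (M n) (\<lambda>\<omega>. shape_trace_power Gc (I n) (Hc n \<omega>) p) \<and>
        (LINT \<omega>|M n. shape_trace_power Gc (I n) (Hc n \<omega>) p) \<le> K ^ (2 * p) * real n powr (real p * real r) * Fm ^ (p - 1)"
        unfolding Hc by linarith
    qed
  qed
  show ?thesis
  proof (intro conjI impI)
    have part1: "\<forall>\<^sub>F n in sequentially. \<forall>p::nat. 2 \<le> p \<and> real p \<le> C0 * ln (real n) \<longrightarrow>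
           integrable (M n) (\<lambda>\<omega>. shape_trace_power Gc (I n) (Hc n \<omega>) p) \<and>
           (LINT \<omega>|M n. shape_trace_power Gc (I n) (Hc n \<omega>) p)
             \<le> K ^ (2 * p) *
               (\<Sum>S \<in> PiE {1..p - 1} (\<lambda>_. separators Gc).
                  real n powr (real p * real r - (\<Sum>k=1..p - 1. \<kappa> (S k))) *
                  real p powr ((\<Sum>k=1..p - 1. b (S k))
                               + K' * (\<Sum>k=1..p - 1. real (card (S k)) - real s)))"
      using key eventually_ge_at_top[of 1]
    proof eventually_elim
      case (elim n)
      show ?case
      proof (intro allI impI, elim conjE)
        fix p :: nat assume p: "2 \<le> p" "real p \<le> C0 * ln (real n)"
        \<comment> \<open>The maximum is attained at some separator \<open>S0\<close>, whose
          constant sequence then majorizes the trace bound.\<close>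
        define Fm where "Fm = Max (g n p ` T)"
        have "Fm \<in> g n p ` T" unfolding Fm_def using T by (intro Max_in) auto
        then obtain S0 where S0: "S0 \<in> T" "Fm = g n p S0" by blast
        have "\<forall>S\<in>T. g n p S \<le> Fm" using T by (simp add: Fm_def)
        then have tr: "integrable (M n) (\<lambda>\<omega>. shape_trace_power Gc (I n) (Hc n \<omega>) p)"
          "(LINT \<omega>|M n. shape_trace_power Gc (I n) (Hc n \<omega>) p) \<le> K ^ (2 * p) * real n powr (real p * real r) * Fm ^ (p - 1)"
          using elim(1) p by auto
        have "real n powr (real p * real r) * Fm ^ (p - 1) \<le> (\<Sum>S \<in> PiE {1..p - 1} (\<lambda>_. separators Gc).
                  real n powr (real p * real r - (\<Sum>k=1..p - 1. \<kappa> (S k))) *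
                  real p powr ((\<Sum>k=1..p - 1. b (S k))
                               + K' * (\<Sum>k=1..p - 1. real (card (S k)) - real s)))"
          unfolding S0(2) g_def T_def[symmetric]
          using power_le_sum_sequences[OF T(1) S0(1), of "real n" "real p" "real p * real r" \<kappa> b K' "\<lambda>S. real (card S) - real s" p] elim(2) p(1)
          by simp
        then have "K ^ (2 * p) * (real n powr (real p * real r) * Fm ^ (p - 1)) \<le> K ^ (2 * p) * (\<Sum>S \<in> PiE {1..p - 1} (\<lambda>_. separators Gc).
                  real n powr (real p * real r - (\<Sum>k=1..p - 1. \<kappa> (S k))) *
                  real p powr ((\<Sum>k=1..p - 1. b (S k))
                               + K' * (\<Sum>k=1..p - 1. real (card (S k)) - real s)))"
          using K1 by (intro mult_left_mono) auto
        with tr show "integrable (M n) (\<lambda>\<omega>. shape_trace_power Gc (I n) (Hc n \<omega>) p) \<and>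
           (LINT \<omega>|M n. shape_trace_power Gc (I n) (Hc n \<omega>) p)
             \<le> K ^ (2 * p) *
               (\<Sum>S \<in> PiE {1..p - 1} (\<lambda>_. separators Gc).
                  real n powr (real p * real r - (\<Sum>k=1..p - 1. \<kappa> (S k))) *
                  real p powr ((\<Sum>k=1..p - 1. b (S k))
                               + K' * (\<Sum>k=1..p - 1. real (card (S k)) - real s)))"
          by (simp add: mult.assoc)
      qed
    qed
    show "\<exists>C::real. \<forall>\<^sub>F n in sequentially. \<forall>p::nat. 2 \<le> p \<and> real p \<le> C0 * ln (real n) \<longrightarrow>
           integrable (M n) (\<lambda>\<omega>. shape_trace_power Gc (I n) (Hc n \<omega>) p) \<and>
           (LINT \<omega>|M n. shape_trace_power Gc (I n) (Hc n \<omega>) p)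
             \<le> C ^ (2 * p) *
               (\<Sum>S \<in> PiE {1..p - 1} (\<lambda>_. separators Gc).
                  real n powr (real p * real r - (\<Sum>k=1..p - 1. \<kappa> (S k))) *
                  real p powr ((\<Sum>k=1..p - 1. b (S k))
                               + K' * (\<Sum>k=1..p - 1. real (card (S k)) - real s)))"
      by (rule exI[where x = K]) (fact part1)
  next
    assume H: "\<forall>S\<in>separators Gc. \<kappa> S = \<kappa>min \<longrightarrow> card S = s"
    \<comment> \<open>The trace power will be \<open>p = 2 * q n\<close>, even and at most
      \<open>C0 * ln (real n)\<close>. Once the latter is at least \<open>4\<close>, rounding loses
      no more than half, so \<open>4 * q n\<close> is at least
      \<open>C0 * ln (real n)\<close>.\<close>
    define q where "q n = nat \<lfloor>C0 * ln (real n) / 2\<rfloor>" for n :: nat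
    define t where "t n = real n powr ((real r - \<kappa>min) / 2) * ln (real n) powr (bmw / 2)" for n :: nat
    \<comment> \<open>\<open>K\<close> comes from the trace bound, the power of \<open>C0\<close>
      from replacing \<open>p\<close> by \<open>C0 * ln (real n)\<close>, and the exponential pays
      for having \<open>p - 1\<close> instead of \<open>p\<close> separator weights.\<close>
    define Q where "Q = K * C0 powr (bmw / 2) * exp (\<bar>\<kappa>min\<bar> / C0)"
    have Q0: "0 < Q" using K1 C0_pos by (simp add: Q_def)
    have \<kappa>le: "\<kappa>min \<le> \<kappa> S" if "S \<in> T" for S
      unfolding \<kappa>min using T that by (simp add: T_def)
    have finmin: "finite (b ` {S \<in> T. \<kappa> S = \<kappa>min})" using T by simp
    have "\<kappa>min \<in> \<kappa> ` T" unfolding \<kappa>min T_def[symmetric] using T by (intro Min_in) auto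
    then obtain S1 where S1: "S1 \<in> T" "\<kappa> S1 = \<kappa>min" by auto
    have b0: "0 \<le> b S" for S
      unfolding b sep_b_def using exponents sub by (intro add_nonneg_nonneg sum_nonneg) auto
    have ble: "b S \<le> bmw" if "S \<in> T" "\<kappa> S = \<kappa>min" for S
      unfolding bmw T_def[symmetric] using finmin that by (intro Max_ge) auto
    have bmw0: "0 \<le> bmw" using ble[OF S1] b0[of S1] by simp
    \<comment> \<open>A separator that does not minimize \<open>\<kappa>\<close> loses a fixed
      positive power of \<open>n\<close>, which beats every power of the logarithm; there are
      finitely many separators, so this holds for all of them eventually.\<close>
    have "\<forall>\<^sub>F n in sequentially. \<forall>S\<in>T. \<kappa> S \<noteq> \<kappa>min \<longrightarrow>
        (C0 * ln (real n)) powr \<bar>b S + K' * (real (card S) - real s)\<bar> \<le> real n powr (\<kappa> S - \<kappa>min)"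
    proof (rule eventually_ball_finite[OF T(1)], rule ballI)
      fix S assume S: "S \<in> T"
      show "\<forall>\<^sub>F n in sequentially. \<kappa> S \<noteq> \<kappa>min \<longrightarrow>
        (C0 * ln (real n)) powr \<bar>b S + K' * (real (card S) - real s)\<bar> \<le> real n powr (\<kappa> S - \<kappa>min)"
      proof (cases "\<kappa> S = \<kappa>min")
        case False
        then have "0 < \<kappa> S - \<kappa>min" using \<kappa>le[OF S] by simp
        from polylog_le_power[OF this C0_pos, of "\<bar>b S + K' * (real (card S) - real s)\<bar>"] show ?thesis by (rule eventually_mono) simp
      qed simp
    qed
    moreover have "\<forall>\<^sub>F n in sequentially. 4 \<le> C0 * ln (real n)"
      using C0_pos by real_asymp
    ultimately have main: "\<forall>\<^sub>F n in sequentially.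
        integrable (M n) (\<lambda>\<omega>. shape_op_norm Gc (I n) (Hc n \<omega>)) \<and>
        (LINT \<omega>|M n. shape_op_norm Gc (I n) (Hc n \<omega>)) \<le> 2 * (Q * t n) \<and> 0 < t n \<and> 0 < n \<and>
        C0 * ln (real n) \<le> real (4 * q n) \<and>
        (\<forall>d>0. measure (M n) {\<omega> \<in> space (M n). shape_op_norm Gc (I n) (Hc n \<omega>) > d} \<le> (Q * t n / d) ^ (4 * q n))"
      using key eventually_ge_at_top[of 2]
    proof eventually_elim
      case (elim n)
      define p where "p = 2 * q n"
      have n: "1 \<le> n" "1 < real n" using elim(4) by auto
      have ln0: "0 < ln (real n)" using n by simp
      have q: "1 \<le> q n" "real (2 * q n) \<le> C0 * ln (real n)" "C0 * ln (real n) \<le> real (4 * q n)"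
        using elim(2) unfolding q_def by linarith+
      have p: "1 \<le> p" "real p \<le> C0 * ln (real n)" "C0 * ln (real n) \<le> 2 * real p" using q by (auto simp: p_def)
      define Fm where "Fm = real n powr (- \<kappa>min) * real p powr bmw"
      have g_le: "g n p S \<le> Fm" if S: "S \<in> T" for S
      proof (cases "\<kappa> S = \<kappa>min")
        case True
        \<comment> \<open>The extra hypothesis enters here: a minimizer of \<open>\<kappa>\<close>
          has no excess, so the term with \<open>K'\<close> vanishes.\<close>
        then have "card S = s" using H S by (simp add: T_def)
        then show ?thesis
          using True ble[OF S True] p(1) by (simp add: g_def Fm_def mult_left_mono powr_mono)
      next
        case False
        have "real p powr (b S + K' * (real (card S) - real s)) \<le> real p powr \<bar>b S + K' * (real (card S) - real s)\<bar>"
          using p(1) by (intro powr_mono) auto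
        also have "\<dots> \<le> (C0 * ln (real n)) powr \<bar>b S + K' * (real (card S) - real s)\<bar>"
          using p by (intro powr_mono2) auto
        also have "\<dots> \<le> real n powr (\<kappa> S - \<kappa>min)" using elim(1) S False by blast
        finally have "g n p S \<le> real n powr (- \<kappa> S) * real n powr (\<kappa> S - \<kappa>min)"
          unfolding g_def by (intro mult_left_mono) auto
        also have "\<dots> = real n powr (- \<kappa>min) * 1" by (simp add: powr_add[symmetric])
        also have "\<dots> \<le> Fm"
          unfolding Fm_def using p(1) bmw0 by (intro mult_left_mono ge_one_powr_ge_zero) auto
        finally show ?thesis .
      qed
      have tr: "integrable (M n) (\<lambda>\<omega>. shape_trace_power Gc (I n) (Hc n \<omega>) p)"
        "(LINT \<omega>|M n. shape_trace_power Gc (I n) (Hc n \<omega>) p) \<le> K ^ (2 * p) * real n powr (real p * real r) * Fm ^ (p - 1)"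
        using elim(3) p(1,2) g_le by auto
      have pw: "y powr (z * real m) = (y powr z) ^ m" if "0 < y" for y z :: real and m
        using that by (simp add: powr_powr[symmetric] powr_realpow)
      have "Fm ^ (p - 1) \<le> real n powr (- \<kappa>min * real p) * exp (\<bar>\<kappa>min\<bar> / C0) ^ (2 * p) * (C0 * ln (real n)) powr (bmw * real p)"
      proof -
        have "Fm ^ (p - 1) = real n powr (- \<kappa>min * real (p - 1)) * real p powr (bmw * real (p - 1))"
        proof -
          have "0 < real n" "0 < real p" using n p(1) by auto
          then show ?thesis by (simp only: Fm_def power_mult_distrib pw)
        qed
        also have "\<dots> \<le> (real n powr (- \<kappa>min * real p) * exp (\<bar>\<kappa>min\<bar> / C0) ^ (2 * p)) * (C0 * ln (real n)) powr (bmw * real p)"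
        proof (rule mult_mono)
          \<comment> \<open>The missing separator weight leaves a factor
            \<open>n powr \<kappa>min\<close>. Since \<open>ln (real n) \<le> 2 * p / C0\<close>, it
            is at most exponential in \<open>p\<close>.\<close>
          have "real n powr (- \<kappa>min * real (p - 1)) = real n powr (- \<kappa>min * real p) * real n powr \<kappa>min"
            using p(1) by (simp add: powr_add[symmetric] of_nat_diff algebra_simps)
          also have "\<dots> \<le> real n powr (- \<kappa>min * real p) * exp (\<bar>\<kappa>min\<bar> / C0) ^ (2 * p)"
          proof (rule mult_left_mono)
            have "real n powr \<kappa>min = exp (\<kappa>min * ln (real n))" using n by (simp add: powr_def)
            also have "\<dots> \<le> exp (\<bar>\<kappa>min\<bar> * (2 * real p / C0))"
              using p(3) C0_pos ln0
              by (intro exp_le_cancel_iff[THEN iffD2] mult_mono) (auto simp: field_simps)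
            also have "\<dots> = exp (\<bar>\<kappa>min\<bar> / C0) ^ (2 * p)"
              by (simp add: exp_of_nat_mult[symmetric] mult_ac)
            finally show "real n powr \<kappa>min \<le> exp (\<bar>\<kappa>min\<bar> / C0) ^ (2 * p)" .
          qed simp
          finally show "real n powr (- \<kappa>min * real (p - 1)) \<le> real n powr (- \<kappa>min * real p) * exp (\<bar>\<kappa>min\<bar> / C0) ^ (2 * p)" .
          have "real p powr (bmw * real (p - 1)) \<le> real p powr (bmw * real p)"
            using p(1) bmw0 by (intro powr_mono mult_left_mono) auto
          also have "\<dots> \<le> (C0 * ln (real n)) powr (bmw * real p)"
            using p bmw0 by (intro powr_mono2) auto
          finally show "real p powr (bmw * real (p - 1)) \<le> (C0 * ln (real n)) powr (bmw * real p)" .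
        qed auto
        finally show ?thesis .
      qed
      then have "K ^ (2 * p) * real n powr (real p * real r) * Fm ^ (p - 1) \<le> K ^ (2 * p) * real n powr (real p * real r) *
          (real n powr (- \<kappa>min * real p) * exp (\<bar>\<kappa>min\<bar> / C0) ^ (2 * p) * (C0 * ln (real n)) powr (bmw * real p))"
        using K1 by (intro mult_left_mono) auto
      also have "\<dots> = (Q * t n) ^ (2 * p)"
      proof -
        have 1: "real n powr (real p * real r) * real n powr (- \<kappa>min * real p) = (real n powr ((real r - \<kappa>min) / 2)) ^ (2 * p)"
        proof -
          have "0 < real n" using n by simp
          moreover have "(real r - \<kappa>min) / 2 * real (2 * p) = real p * real r + - \<kappa>min * real p"
            by (simp add: field_simps)
          ultimately show ?thesis by (simp only: pw[symmetric] powr_add[symmetric])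
        qed
        have 2: "(C0 * ln (real n)) powr (bmw * real p) = (C0 powr (bmw / 2) * ln (real n) powr (bmw / 2)) ^ (2 * p)"
        proof -
          have "(C0 * ln (real n)) powr (bmw * real p) = ((C0 * ln (real n)) powr (bmw / 2)) ^ (2 * p)"
            using C0_pos ln0 by (simp add: pw[symmetric])
          then show ?thesis using C0_pos ln0 by (simp add: powr_mult)
        qed
        show ?thesis unfolding 2 Q_def t_def power_mult_distrib 1[symmetric] by (simp only: mult_ac)
      qed
      finally have bound: "(LINT \<omega>|M n. shape_trace_power Gc (I n) (Hc n \<omega>) p) \<le> (Q * t n) ^ (2 * p)"
        using tr(2) by simp
      have t0: "0 < t n" using n ln0 by (simp add: t_def)
      have "0 < q n" using q(1) by simp
      note le = shape_op_norm_power_le_trace[OF shp fin[OF n(1)] this, folded p_def]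
      have rv: "\<xi> n f y \<in> borel_measurable (M n)" if "f \<in> occs Gc" "y \<in> PiE (scope Gc f) (I n)" for f y
      proof -
        have "\<forall>i\<in>(SIGMA f:occs Gc. PiE (scope Gc f) (I n)). (case i of (f, y) \<Rightarrow> \<xi> n f y) \<in> borel_measurable (M n)"
          using indep[OF n(1)] unfolding prob_space.indep_vars_def[OF pspace[OF n(1)]] by blast
        then show ?thesis using that by auto
      qed
      have meas: "(\<lambda>\<omega>. shape_op_norm Gc (I n) (Hc n \<omega>)) \<in> borel_measurable (M n)"
        unfolding shape_op_norm_def Hc
      proof (rule borel_measurable_op_norm)
        show "finite (label_tuples (I n) (lbdry Gc))" "finite (label_tuples (I n) (rbdry Gc))"
          using shp fin[OF n(1)] by (auto simp: is_shape_def intro!: finite_label_tuples)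
      qed (rule borel_measurable_shape_matrix[OF shp rv])
      have "1 \<le> 2 * p" using p(1) by simp
      note nb = norm_bounds_from_moment[OF pspace[OF n(1)] meas le(2) le(1) tr(1) bound mult_pos_pos[OF Q0 t0] this]
      have "2 * p = 4 * q n" by (simp add: p_def)
      then show ?case using nb t0 q(3) n(1) by auto
    qed
    show "\<exists>C::real. \<forall>\<^sub>F n in sequentially.
              integrable (M n) (\<lambda>\<omega>. shape_op_norm Gc (I n) (Hc n \<omega>)) \<and>
              (LINT \<omega>|M n. shape_op_norm Gc (I n) (Hc n \<omega>))
                \<le> C * real n powr ((real r - \<kappa>min) / 2) * ln (real n) powr (bmw / 2)"
      by (rule exI[of _ "2 * Q"], rule eventually_mono[OF main]) (simp add: t_def mult.assoc)
    show "\<forall>A>0. \<exists>CA::real. \<forall>\<^sub>F n in sequentially.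
              measure (M n) {\<omega> \<in> space (M n). shape_op_norm Gc (I n) (Hc n \<omega>)
                  > CA * real n powr ((real r - \<kappa>min) / 2) * ln (real n) powr (bmw / 2)}
                \<le> real n powr (- A)"
    proof (intro allI impI)
      fix A :: real assume A: "0 < A"
      show "\<exists>CA::real. \<forall>\<^sub>F n in sequentially.
              measure (M n) {\<omega> \<in> space (M n). shape_op_norm Gc (I n) (Hc n \<omega>)
                  > CA * real n powr ((real r - \<kappa>min) / 2) * ln (real n) powr (bmw / 2)}
                \<le> real n powr (- A)"
      \<comment> \<open>Enlarging the threshold by \<open>exp (A / C0)\<close> divides the tail
        bound by its power \<open>4 * q n\<close>, and \<open>4 * q n \<ge> C0 * ln (real n)\<close>
        turns this into \<open>n powr (- A)\<close>.\<close>
      proof (rule exI[of _ "Q * exp (A / C0)"], rule eventually_mono[OF main], elim conjE)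
        fix n assume t0: "0 < t n" and "0 < n" and q: "C0 * ln (real n) \<le> real (4 * q n)"
          and tail: "\<forall>d>0. measure (M n) {\<omega> \<in> space (M n). shape_op_norm Gc (I n) (Hc n \<omega>) > d} \<le> (Q * t n / d) ^ (4 * q n)"
        have "measure (M n) {\<omega> \<in> space (M n). shape_op_norm Gc (I n) (Hc n \<omega>) > Q * exp (A / C0) * t n}
            \<le> (Q * t n / (Q * exp (A / C0) * t n)) ^ (4 * q n)"
          by (rule tail[rule_format]) (use Q0 t0 in simp)
        also have "Q * t n / (Q * exp (A / C0) * t n) = exp (- (A / C0))"
          using Q0 t0 by (simp add: exp_minus field_simps)
        also have "exp (- (A / C0)) ^ (4 * q n) = exp (- (A / C0) * real (4 * q n))"
          by (simp only: exp_of_nat_mult[symmetric] mult.commute)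
        also have "\<dots> \<le> exp (- (A / C0) * (C0 * ln (real n)))"
          using q A C0_pos by (intro exp_le_cancel_iff[THEN iffD2] mult_left_mono_neg) auto
        also have "\<dots> = real n powr (- A)"
          using C0_pos \<open>0 < n\<close> by (simp add: powr_def)
        finally show "measure (M n) {\<omega> \<in> space (M n). shape_op_norm Gc (I n) (Hc n \<omega>)
                  > Q * exp (A / C0) * real n powr ((real r - \<kappa>min) / 2) * ln (real n) powr (bmw / 2)}
                \<le> real n powr (- A)"
          by (simp add: t_def mult.assoc)
      qed
    qed
  qed
qed

end
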